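(* Let $A$ be a $C^*$-algebra without 1-dimensional representations. Then $$\mathrm{span}(SN_2^c)=[\mathrm{Ped}(A),\mathrm{Ped}(A)].$$ If in addition $A$ is unital, then $\mathrm{span}(N_2)=[A,A]$. Furthermore, in the unital case there exists $K\in\mathbb{N}$ such that every single commutator $[x,y]$ with $x,y\in A$ is a sum of at most $K$ square zero elements of $A$.
   Context: $A$ has no 1-dimensional representations means that there is no nonzero $*$-homomorphism $A\to\mathbb{C}$. $[x,y]=xy-yx$, and for $X,Y\subseteq A$, $[X,Y]$ denotes the linear span of $\{[x,y]:x\in X,y\in Y\}$. $\mathrm{Ped}(A)$ is the Pedersen ideal of $A$, i.e. the smallest dense (not necessarily closed) two-sided ideal of $A$. $A_+$ is the set of positive elements of $A$. $N_2$ is the set of nilpotent elements of $A$ of order exactly $2$. Define $$N_2^c=\{x\in A : xe=fx=x \text{ for some } e,f\in A_+ \text{ such that } ef=0\},$$ $$SN_2^c=\bigcup_{x\in N_2\cup\{0\}}(1+x)N_2^c(1-x)=\{(1+x)y(1-x): x\in N_2\cup\{0\},\ y\in N_2^c\},$$ where $1$ is the unit of the unitization of $A$ if $A$ is not unital. Spans are linear spans (no closure). *)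

theory Defs
  imports "HOL-Analysis.Analysis"
begin

class complex_vector = real_vector +
  fixes scaleC :: "complex \<Rightarrow> 'a \<Rightarrow> 'a" (infixr "*\<^sub>C" 75)
  assumes scaleC_add_right: "c *\<^sub>C (x + y) = c *\<^sub>C x + c *\<^sub>C y"
    and scaleC_add_left: "(c + d) *\<^sub>C x = c *\<^sub>C x + d *\<^sub>C x"
    and scaleC_scaleC: "c *\<^sub>C d *\<^sub>C x = (c * d) *\<^sub>C x"
    and scaleC_of_real: "complex_of_real r *\<^sub>C x = r *\<^sub>R x"

global_interpretation complex_vector:
  vector_space "scaleC :: complex \<Rightarrow> 'a \<Rightarrow> 'a::complex_vector"
  defines csubspace = complex_vector.subspace
    and cspan = complex_vector.span
proof
  show "1 *\<^sub>C x = x" for x :: 'a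
    using scaleC_of_real[of 1 x] by simp
qed (simp_all add: scaleC_add_right scaleC_add_left scaleC_scaleC)

text \<open>Not assumed unital: the class \<open>real_normed_algebra\<close> has no unit. In particular the
  zero algebra is allowed.\<close>

class cstar_algebra = complex_vector + real_normed_algebra + banach +
  fixes star :: "'a \<Rightarrow> 'a"
  assumes mult_scaleC_left: "(c *\<^sub>C x) * y = c *\<^sub>C (x * y)"
    and mult_scaleC_right: "x * (c *\<^sub>C y) = c *\<^sub>C (x * y)"
    and norm_scaleC: "norm (c *\<^sub>C x) = cmod c * norm x"
    and star_add: "star (x + y) = star x + star y"
    and star_scaleC: "star (c *\<^sub>C x) = cnj c *\<^sub>C star x"
    and star_mult: "star (x * y) = star y * star x"
    and star_star: "star (star x) = x"
    and cstar_identity: "norm (star x * x) = (norm x)\<^sup>2"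

instantiation complex :: cstar_algebra
begin

definition scaleC_complex :: "complex \<Rightarrow> complex \<Rightarrow> complex"
  where "scaleC_complex c x = c * x"

definition star_complex :: "complex \<Rightarrow> complex"
  where "star_complex = cnj"

instance
  by standard
    (auto simp: scaleC_complex_def star_complex_def algebra_simps scaleR_conv_of_real
      norm_mult power2_eq_square)

end

definition star_hom :: "('a::cstar_algebra \<Rightarrow> 'b::cstar_algebra) \<Rightarrow> bool"
  where "star_hom \<phi> \<longleftrightarrow> Vector_Spaces.linear scaleC scaleC \<phi> \<and>
    (\<forall>x y. \<phi> (x * y) = \<phi> x * \<phi> y) \<and> (\<forall>x. \<phi> (star x) = star (\<phi> x))"

definition no_one_dim_reps :: "'a::cstar_algebra itself \<Rightarrow> bool"
  where "no_one_dim_reps _ \<longleftrightarrow>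
    \<not> (\<exists>\<phi> :: 'a \<Rightarrow> complex. star_hom \<phi> \<and> \<phi> \<noteq> (\<lambda>_. 0))"

definition is_unital :: "'a::cstar_algebra itself \<Rightarrow> bool"
  where "is_unital _ \<longleftrightarrow> (\<exists>u::'a. \<forall>a. u * a = a \<and> a * u = a)"

text \<open>The (algebraic) unitization: \<open>Unitization a c\<close> stands for \<open>a + c 1\<close>. Only its ring structure
  is needed below. It adjoins a new unit even if the algebra already has one.\<close>

datatype 'a unitization = Unitization (elem_part: 'a) (scalar_part: complex)

instantiation unitization :: (cstar_algebra) ring_1
begin

definition "0 = Unitization 0 0"
definition "1 = Unitization 0 1"
definition "u + v = Unitization (elem_part u + elem_part v) (scalar_part u + scalar_part v)"
definition "u - v = Unitization (elem_part u - elem_part v) (scalar_part u - scalar_part v)"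
definition "- u = Unitization (- elem_part u) (- scalar_part u)"
definition "u * v =
  Unitization
    (elem_part u * elem_part v + scalar_part u *\<^sub>C elem_part v + scalar_part v *\<^sub>C elem_part u)
    (scalar_part u * scalar_part v)"

instance
  by standard
    (auto simp: zero_unitization_def one_unitization_def plus_unitization_def
      minus_unitization_def uminus_unitization_def times_unitization_def algebra_simps
      mult_scaleC_left mult_scaleC_right complex_vector.scale_right_distrib
      complex_vector.scale_left_distrib)

end

definition in_unitization :: "'a::cstar_algebra \<Rightarrow> 'a unitization"
  where "in_unitization a = Unitization a 0"

text \<open>The spectrum is computed in the unitization. If the algebra is unital, this differs from the
  spectrum in the algebra itself at most by the point 0, so the positive elements are the usual
  ones in both cases.\<close>

definition spectrum :: "'a::cstar_algebra \<Rightarrow> complex set"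
  where "spectrum a =
    {c. \<not> (\<exists>v. (in_unitization a - Unitization 0 c) * v = 1 \<and>
             v * (in_unitization a - Unitization 0 c) = 1)}"

definition positives :: "'a::cstar_algebra set"
  where "positives = {a. star a = a \<and> spectrum a \<subseteq> complex_of_real ` {0..}}"

definition two_sided_ideal :: "'a::cstar_algebra set \<Rightarrow> bool"
  where "two_sided_ideal I \<longleftrightarrow>
    csubspace I \<and> (\<forall>a. \<forall>x\<in>I. a * x \<in> I \<and> x * a \<in> I)"

text \<open>The smallest dense two-sided ideal, as the intersection of all of them.\<close>

definition Ped :: "'a::cstar_algebra set"
  where "Ped = \<Inter> {I. two_sided_ideal I \<and> closure I = UNIV}"

definition commutator :: "'a::cstar_algebra \<Rightarrow> 'a \<Rightarrow> 'a"
  where "commutator x y = x * y - y * x"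

definition commutator_span :: "'a::cstar_algebra set \<Rightarrow> 'a set \<Rightarrow> 'a set"
  where "commutator_span X Y = cspan {commutator x y | x y. x \<in> X \<and> y \<in> Y}"

definition N2 :: "'a::cstar_algebra set"
  where "N2 = {x. x * x = 0 \<and> x \<noteq> 0}"

definition N2c :: "'a::cstar_algebra set"
  where "N2c = {x. \<exists>e\<in>positives. \<exists>f\<in>positives. x * e = x \<and> f * x = x \<and> e * f = 0}"

text \<open>The products are formed in the unitization but lie in the algebra, where they equal
  \<open>y + x y - y x - x y x\<close>. If the algebra has a unit, the same formula describes the products
  taken with that unit.\<close>

definition SN2c :: "'a::cstar_algebra set"
  where "SN2c = {z. \<exists>x \<in> N2 \<union> {0}. \<exists>y \<in> N2c.
    in_unitization z = (1 + in_unitization x) * in_unitization y * (1 - in_unitization x)}"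

lemma in_unitization_conj_iff:
  "in_unitization z = (1 + in_unitization x) * in_unitization y * (1 - in_unitization x) \<longleftrightarrow>
    z = y + x * y - y * x - x * y * x"
  by (auto simp: in_unitization_def one_unitization_def plus_unitization_def
      minus_unitization_def times_unitization_def algebra_simps)

lemma SN2c_altdef:
  "SN2c = {y + x * y - y * x - x * y * x | x y. x \<in> N2 \<union> {0} \<and> y \<in> N2c}"
  unfolding SN2c_def in_unitization_conj_iff by blast

end

theory Submission
  imports Defs "HOL-Computational_Algebra.Polynomial"
begin

text \<open>
  The reason why commutators are spanned by square-zero elements is a computation with \<open>2 \<times> 2\<close>
  blocks, and the only obstruction to it is a commutative quotient, which would have a character.

  One inclusion is direct. If \<open>y\<close> lies in \<open>N2c\<close> with orthogonal local units \<open>e\<close> and \<open>f\<close>, then \<open>y\<close> is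
  the commutator of \<open>y\<close> and \<open>e\<close>; and for a square-zero \<open>x\<close> the element \<open>x y x\<close> is the commutator of
  \<open>x y\<close> and \<open>x\<close>. An element with a local unit belongs to every dense ideal, by a Neumann series, so
  \<open>SN2c\<close> consists of sums of commutators \<open>[p, a]\<close> with \<open>p \<in> Ped\<close>. Since \<open>Ped\<close> is spanned by products of
  its own elements, these lie in \<open>[Ped, Ped]\<close> (\<open>SN2c_subset_commutators\<close>).

  For the other inclusion let \<open>U\<close> be the span of \<open>SN2c\<close>. Comparing \<open>x\<close> with \<open>- x\<close> in
  \<open>(1 + x) y (1 - x)\<close> shows that \<open>U\<close> contains \<open>[x, y]\<close> and \<open>x y x\<close> for square-zero \<open>x\<close> and \<open>y \<in> N2c\<close>.
  Cutting an arbitrary \<open>a\<close> into blocks along the local units of \<open>y\<close> gives \<open>[y, a] \<in> U\<close>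
  (\<open>commutator_N2c\<close>). Next, for \<open>z \<in> N2c\<close> and \<open>k = z* z\<close>, a square-zero element of the form \<open>x = u v\<close>
  with \<open>v u = 0\<close> can be chosen such that \<open>x z* x\<close> is \<open>[p, q k q]\<close> up to terms already known to
  be in \<open>U\<close>; polarization yields \<open>[A k, k A] \<subseteq> U\<close> (\<open>commutator_mult_star_mult\<close>), hence
  \<open>[A k k A, A] \<subseteq> U\<close>. Every step uses a fixed number of summands from \<open>SN2c\<close>.

  So the elements \<open>k k\<close> generate an ideal \<open>I\<close> (\<open>core_ideal\<close>) with \<open>[I, A] \<subseteq> U\<close>, and it suffices that \<open>I\<close> is
  dense, for then \<open>Ped \<subseteq> I\<close>. The closure of \<open>I\<close> contains all square-zero elements, as each of them is a
  limit of elements of \<open>N2c\<close>. If the closure is proper, it omits some self-adjoint \<open>h\<close>, and an ideal \<open>M\<close>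
  containing it that is maximal among those keeping a fixed positive distance from \<open>h\<close> is closed and prime.
  For a self-adjoint \<open>a\<close> and continuous \<open>f\<close>, \<open>g\<close> with \<open>f g = 0\<close> the elements \<open>f(a) x g(a)\<close> have square
  zero, so they lie in \<open>M\<close>, and primeness puts \<open>f(a)\<close> or \<open>g(a)\<close> into \<open>M\<close>. Thus the spectrum of \<open>a\<close> modulo \<open>M\<close>
  is a single point, \<open>a\<close> is a scalar modulo \<open>M\<close>, and sending \<open>a\<close> to this scalar is a nonzero
  character (\<open>character_exists\<close>).

  If the algebra is unital, \<open>Ped\<close> is everything. The unit is then a finite sum of generators of
  \<open>I\<close>, and expanding \<open>x = x 1\<close> bounds the number of square-zero summands of \<open>[x, y]\<close> uniformly. Finally, a
  square-zero \<open>w\<close> factors as \<open>w = y k\<close> with \<open>k\<close> the square root of the absolute value of \<open>w\<close>, and \<open>k y = 0\<close>, so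
  that \<open>w = [y, k]\<close> (\<open>square_zero_is_commutator\<close>).

  The arguments use continuous functions of self-adjoint elements. These are obtained in a unital
  C*-algebra from square roots, which make the squares of self-adjoint elements a convex cone, and
  from Bernstein polynomials, which turn this cone into the bound of \<open>p(a)\<close> by the supremum of
  \<open>p\<close>; the general case follows in the unitization.
\<close>

section \<open>The involution\<close>

class unital_cstar_algebra = cstar_algebra + real_normed_algebra_1

lemma star_zero [simp]: "star (0::'a::cstar_algebra) = 0"
  using star_add[of "0::'a" 0] by simp

lemma star_minus [simp]: "star (- x) = - star (x::'a::cstar_algebra)"
  using star_add[of x "- x"] by (simp add: eq_neg_iff_add_eq_0 add.commute)

lemma star_diff: "star (x - y) = star x - star (y::'a::cstar_algebra)"
  using star_add[of x "- y"] by simp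

lemma star_scaleR: "star (r *\<^sub>R x) = r *\<^sub>R star (x::'a::cstar_algebra)"
  by (simp add: star_scaleC flip: scaleC_of_real)

lemma norm_star [simp]: "norm (star x) = norm (x::'a::cstar_algebra)"
proof -
  have le: "norm x \<le> norm (star x)" for x :: 'a
  proof (cases "x = 0")
    case False
    have "norm x * norm x \<le> norm (star x) * norm x"
      using cstar_identity[of x] norm_mult_ineq[of "star x" x] by (simp add: power2_eq_square)
    then show ?thesis using False by simp
  qed simp
  show ?thesis using le[of x] le[of "star x"] by (simp add: star_star)
qed

lemma bounded_linear_star: "bounded_linear (star :: 'a::cstar_algebra \<Rightarrow> 'a)"
  by (rule bounded_linear_intro[where K = 1]) (auto simp: star_add star_scaleR)

lemmas tendsto_star = bounded_linear.tendsto[OF bounded_linear_star]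

lemma star_one [simp]: "star (1::'a::unital_cstar_algebra) = 1"
  by (metis mult.right_neutral mult_1 star_mult star_star)

section \<open>Square roots\<close>

text \<open>
  The fixed point \<open>w = (y + w\<^sup>2)/2\<close> that this iteration approaches is \<open>1 - sqrt (1 - y)\<close>.
\<close>
primrec sqrt_iter :: "'a::real_algebra \<Rightarrow> nat \<Rightarrow> 'a" where
  "sqrt_iter y 0 = 0"
| "sqrt_iter y (Suc n) = (1/2) *\<^sub>R (y + sqrt_iter y n * sqrt_iter y n)"

lemma norm_sqrt_iter:
  fixes y :: "'a::real_normed_algebra"
  assumes "norm y \<le> 1"
  shows "norm (sqrt_iter y n) \<le> sqrt_iter 1 n"
proof (induction n)
  case (Suc n)
  have "norm (y + sqrt_iter y n * sqrt_iter y n) \<le> norm y + norm (sqrt_iter y n) * norm (sqrt_iter y n)"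
    by (meson add_left_mono norm_mult_ineq norm_triangle_le order_trans)
  also have "\<dots> \<le> 1 + sqrt_iter 1 n * sqrt_iter 1 n"
    using assms Suc by (intro add_mono mult_mono) (auto intro: order_trans[OF norm_ge_zero])
  finally show ?case by simp
qed simp

text \<open>
  The iterates are polynomials in \<open>y\<close> whose coefficients are nonnegative and increase with \<open>n\<close>, so for
  \<open>\<parallel>y\<parallel> \<le> 1\<close> the scalar iteration at \<open>1\<close> majorizes everything. This gives convergence on the whole closed unit
  ball.
\<close>
lemma norm_sqrt_iter_Suc_diff:
  fixes y :: "'a::real_normed_algebra"
  assumes "norm y \<le> 1"
  shows "norm (sqrt_iter y (Suc n) - sqrt_iter y n) \<le> sqrt_iter 1 (Suc n) - sqrt_iter 1 n"
proof (induction n)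
  case 0
  show ?case using assms by simp
next
  case (Suc n)
  define u v where "u = sqrt_iter y (Suc n)" and "v = sqrt_iter y n"
  define r s where "r = sqrt_iter (1::real) (Suc n)" and "s = sqrt_iter (1::real) n"
  have uv: "norm u \<le> r" "norm v \<le> s" "norm (u - v) \<le> r - s"
    using norm_sqrt_iter[OF assms, of "Suc n"] norm_sqrt_iter[OF assms, of n] Suc
    unfolding u_def v_def r_def s_def by blast+
  have "0 \<le> s" "s \<le> r"
    using uv norm_ge_zero[of v] norm_ge_zero[of "u - v"] by linarith+
  have "norm (u * (u - v) + (u - v) * v) \<le> norm u * norm (u - v) + norm (u - v) * norm v"
    by (meson add_mono norm_mult_ineq norm_triangle_le)
  also have "\<dots> \<le> r * (r - s) + (r - s) * s"
    using uv \<open>0 \<le> s\<close> \<open>s \<le> r\<close> by (intro add_mono mult_mono) auto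
  finally have *: "norm (u * u - v * v) \<le> r * r - s * s"
    by (simp add: algebra_simps)
  have "sqrt_iter y (Suc (Suc n)) - sqrt_iter y (Suc n) = (1/2) *\<^sub>R (u * u - v * v)"
    unfolding u_def v_def by (simp add: algebra_simps)
  moreover have "sqrt_iter 1 (Suc (Suc n)) - sqrt_iter 1 (Suc n) = (r * r - s * s) / 2"
    unfolding r_def s_def by (simp add: field_simps)
  ultimately show ?case using * by (simp add: u_def v_def)
qed

lemma norm_sqrt_iter_diff:
  fixes y :: "'a::real_normed_algebra"
  assumes "norm y \<le> 1"
  shows "norm (sqrt_iter y (n + k) - sqrt_iter y n) \<le> sqrt_iter 1 (n + k) - sqrt_iter 1 n"
proof (induction k)
  case (Suc k)
  have "sqrt_iter y (n + Suc k) - sqrt_iter y n =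
      (sqrt_iter y (Suc (n + k)) - sqrt_iter y (n + k)) + (sqrt_iter y (n + k) - sqrt_iter y n)"
    by simp
  also have "norm \<dots> \<le> (sqrt_iter 1 (Suc (n + k)) - sqrt_iter 1 (n + k)) +
      (sqrt_iter 1 (n + k) - sqrt_iter 1 n)"
    by (intro norm_triangle_le add_mono norm_sqrt_iter_Suc_diff[OF assms] Suc)
  finally show ?case by simp
qed simp

lemma Cauchy_sqrt_iter:
  fixes y :: "'a::real_normed_algebra"
  assumes "norm y \<le> 1"
  shows "Cauchy (sqrt_iter y)"
proof -
  define r where "r = sqrt_iter (1::real)"
  have nonneg: "0 \<le> r n" for n
    using order_trans[OF norm_ge_zero norm_sqrt_iter[of "1::real" n]] by (simp add: r_def)
  have le: "r n \<le> 1" for n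
  proof (induction n)
    case (Suc n)
    have "r n * r n \<le> 1" using Suc mult_mono[of "r n" 1 "r n" 1] nonneg by simp
    then show ?case by (simp add: r_def)
  qed (simp add: r_def)
  have mono: "r n \<le> r (Suc n)" for n
    using order_trans[OF norm_ge_zero norm_sqrt_iter_Suc_diff[of "1::real" n]] unfolding r_def by simp
  have "incseq r" using mono by (intro incseq_SucI)
  then obtain L where "r \<longlonglongrightarrow> L" using incseq_convergent[of r 1] le by blast
  then have "convergent r" by (rule convergentI)
  then have "Cauchy r" by (rule convergent_Cauchy)
  show ?thesis
  proof (rule CauchyI')
    fix e :: real assume "e > 0"
    then obtain M where M: "\<And>m n. m \<ge> M \<Longrightarrow> n \<ge> M \<Longrightarrow> norm (r m - r n) < e"
      using \<open>Cauchy r\<close> CauchyD by blast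
    have "norm (sqrt_iter y m - sqrt_iter y n) < e" if "m \<ge> M" "n > m" for m n
    proof -
      have "norm (sqrt_iter y n - sqrt_iter y m) \<le> r n - r m"
        using norm_sqrt_iter_diff[OF assms, of m "n - m"] that unfolding r_def by simp
      also have "\<dots> < e" using M[of n m] that by auto
      finally show ?thesis by (simp add: norm_minus_commute)
    qed
    then show "\<exists>M. \<forall>m\<ge>M. \<forall>n>m. dist (sqrt_iter y m) (sqrt_iter y n) < e"
      unfolding dist_norm by blast
  qed
qed

lemma sqrt_iter_commute: "c * y = y * c \<Longrightarrow> c * sqrt_iter y n = sqrt_iter y n * c"
  by (induction n) (simp_all add: algebra_simps, metis mult.assoc)

lemma star_sqrt_iter: "star y = y \<Longrightarrow> star (sqrt_iter y n) = sqrt_iter y n"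
  for y :: "'a::cstar_algebra"
  by (induction n) (simp_all add: star_add star_scaleR star_mult)

text \<open>
  The root commutes with the whole commutant of \<open>x\<close> because its approximants are polynomials in \<open>x\<close>;
  products of commuting squares depend on this.
\<close>
lemma sqrt_exists:
  fixes x :: "'a::unital_cstar_algebra"
  assumes "star x = x" "norm (1 - x) \<le> 1"
  obtains s where "star s = s" "s * s = x" "\<And>c. c * x = x * c \<Longrightarrow> c * s = s * c"
proof -
  let ?w = "sqrt_iter (1 - x)"
  obtain w where w: "?w \<longlonglongrightarrow> w"
    using Cauchy_sqrt_iter[OF assms(2)] Cauchy_convergent_iff convergentD by metis
  have "(\<lambda>n. ?w (Suc n)) \<longlonglongrightarrow> (1/2) *\<^sub>R ((1 - x) + w * w)"
    unfolding sqrt_iter.simps by (intro tendsto_intros w)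
  then have "w = (1/2) *\<^sub>R ((1 - x) + w * w)"
    using LIMSEQ_unique LIMSEQ_Suc[OF w] by blast
  then have "2 *\<^sub>R w = 2 *\<^sub>R (1/2) *\<^sub>R ((1 - x) + w * w)" by (rule arg_cong)
  then have "2 *\<^sub>R w = (1 - x) + w * w" by simp
  then have 1: "(1 - w) * (1 - w) = x" by (simp add: algebra_simps scaleR_2)
  have "star w = w"
    using LIMSEQ_unique[OF tendsto_star[OF w]] w assms(1) by (simp add: star_sqrt_iter star_diff)
  then have 2: "star (1 - w) = 1 - w" by (simp add: star_diff)
  have 3: "c * (1 - w) = (1 - w) * c" if "c * x = x * c" for c
  proof -
    have "c * ?w n = ?w n * c" for n
      by (rule sqrt_iter_commute) (use that in \<open>simp add: algebra_simps\<close>)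
    moreover have "(\<lambda>n. c * ?w n) \<longlonglongrightarrow> c * w" "(\<lambda>n. ?w n * c) \<longlonglongrightarrow> w * c"
      by (intro tendsto_intros w)+
    ultimately have "c * w = w * c" using LIMSEQ_unique by simp
    then show ?thesis by (simp add: left_diff_distrib right_diff_distrib)
  qed
  show thesis by (rule that[OF 2 1 3])
qed

section \<open>Squares of self-adjoint elements\<close>

definition squares :: "'a::cstar_algebra set"
  where "squares = {s * s | s. star s = s}"

lemma squares_selfadjoint: "x \<in> squares \<Longrightarrow> star x = x"
  by (auto simp: squares_def star_mult)

text \<open>
  The element \<open>v = x + \<i> s\<close> is a multiple of a unitary, as \<open>v* v = x\<^sup>2 + s\<^sup>2 = M\<^sup>2\<close>, and \<open>x\<close> is its real
  part.
\<close>
lemma norm_le_of_sum_squares: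
  fixes x s :: "'a::unital_cstar_algebra"
  assumes "star x = x" "star s = s" "x * s = s * x" "x * x + s * s = (M * M) *\<^sub>R 1" "M \<ge> 0"
  shows "norm x \<le> M"
proof -
  define v where "v = x + \<i> *\<^sub>C s"
  have sv: "star v = x - \<i> *\<^sub>C s"
    using assms by (simp add: v_def star_add star_scaleC)
  have "star v * v = x * x + s * s"
    unfolding sv unfolding v_def using assms(3)
    by (simp add: algebra_simps mult_scaleC_left mult_scaleC_right scaleC_scaleC)
  then have "(norm v)\<^sup>2 = M\<^sup>2" using cstar_identity[of v] assms(4)
    by (simp add: power2_eq_square)
  then have nv: "norm v = M" using assms(5) by (simp add: power2_eq_iff_nonneg)
  have "2 *\<^sub>R x = v + star v" unfolding sv by (simp add: v_def scaleR_2)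
  then have "norm (2 *\<^sub>R x) \<le> norm v + norm (star v)" by (simp only: norm_triangle_ineq)
  then show ?thesis using nv by simp
qed

text \<open>
  By the previous lemma applied to the root \<open>r\<close> of \<open>1 - s\<^sup>2\<close>, since \<open>r\<^sup>2 + s\<^sup>2 = 1\<close>.
\<close>
lemma norm_one_minus_square:
  fixes s :: "'a::unital_cstar_algebra"
  assumes "star s = s" "norm s \<le> 1"
  shows "norm (1 - s * s) \<le> 1"
proof -
  have "norm (s * s) \<le> 1" using norm_mult_ineq[of s s] assms(2) mult_mono[of "norm s" 1 "norm s" 1] by simp
  then have "norm (1 - (1 - s * s)) \<le> 1" by simp
  moreover have "star (1 - s * s) = 1 - s * s" using assms by (simp add: star_diff star_mult)
  ultimately obtain r where r: "star r = r" "r * r = 1 - s * s"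
      "\<And>c. c * (1 - s * s) = (1 - s * s) * c \<Longrightarrow> c * r = r * c"
    using sqrt_exists by blast
  have "norm r \<le> 1"
    by (rule norm_le_of_sum_squares[of r s]) (use r(1,2) assms r(3)[of s] in \<open>auto simp: algebra_simps\<close>)
  then show ?thesis using norm_mult_ineq[of r r] mult_mono[of "norm r" 1 "norm r" 1] by (simp add: r(2)[symmetric])
qed

lemma squares_scaleR: "x \<in> squares \<Longrightarrow> c \<ge> 0 \<Longrightarrow> c *\<^sub>R x \<in> squares"
proof -
  assume "x \<in> squares" "c \<ge> 0"
  then obtain s where "star s = s" "x = s * s" by (auto simp: squares_def)
  then show "c *\<^sub>R x \<in> squares" using \<open>c \<ge> 0\<close>
    unfolding squares_def by (auto simp: star_scaleR intro!: exI[of _ "sqrt c *\<^sub>R s"])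
qed

text \<open>
  Being a square amounts to \<open>\<parallel>1 - x/c\<parallel> \<le> 1\<close> for large \<open>c\<close>, by \<open>sqrt_exists\<close> in the other
  direction. The inequality is convex in \<open>x\<close>, which is how sums of squares become squares.
\<close>
lemma squares_bound:
  fixes x :: "'a::unital_cstar_algebra"
  assumes "x \<in> squares"
  obtains C where "C > 0" "\<And>c. c \<ge> C \<Longrightarrow> norm (1 - (1/c) *\<^sub>R x) \<le> 1"
proof -
  obtain s where s: "star s = s" "x = s * s" using assms by (auto simp: squares_def)
  have "norm (1 - (1/c) *\<^sub>R x) \<le> 1" if "c \<ge> (norm s)\<^sup>2 + 1" for c
  proof -
    have "c > 0" using that by (smt (verit) zero_le_power2)
    have "norm s \<le> sqrt c" using that by (intro real_le_rsqrt) simp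
    then have "norm ((1 / sqrt c) *\<^sub>R s) \<le> 1" using \<open>c > 0\<close> by simp
    from norm_one_minus_square[OF _ this] s \<open>c > 0\<close> show ?thesis by (simp add: star_scaleR)
  qed
  moreover have "(norm s)\<^sup>2 + 1 > 0" by (smt (verit) zero_le_power2)
  ultimately show thesis using that by blast
qed

lemma squares_sqrt:
  fixes x :: "'a::unital_cstar_algebra"
  assumes "x \<in> squares"
  obtains s where "star s = s" "s * s = x" "\<And>c. c * x = x * c \<Longrightarrow> c * s = s * c"
proof -
  obtain C where C: "C > 0" "norm (1 - (1/C) *\<^sub>R x) \<le> 1" using squares_bound[OF assms] by blast
  obtain s where s: "star s = s" "s * s = (1/C) *\<^sub>R x"
      "\<And>c. c * ((1/C) *\<^sub>R x) = ((1/C) *\<^sub>R x) * c \<Longrightarrow> c * s = s * c"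
    using sqrt_exists[OF _ C(2)] squares_selfadjoint[OF assms] by (metis star_scaleR)
  have "(sqrt C *\<^sub>R s) * (sqrt C *\<^sub>R s) = C *\<^sub>R (s * s)" using C(1) by simp
  also have "\<dots> = x" using C(1) unfolding s(2) by simp
  finally have 1: "(sqrt C *\<^sub>R s) * (sqrt C *\<^sub>R s) = x" .
  have 2: "star (sqrt C *\<^sub>R s) = sqrt C *\<^sub>R s" using s(1) by (simp add: star_scaleR)
  have 3: "c * (sqrt C *\<^sub>R s) = (sqrt C *\<^sub>R s) * c" if "c * x = x * c" for c
    using s(3)[of c] that by (simp only: mult_scaleR_left mult_scaleR_right)
  show thesis by (rule that[OF 2 1 3])
qed

lemma squares_add:
  fixes x y :: "'a::unital_cstar_algebra"
  assumes "x \<in> squares" "y \<in> squares"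
  shows "x + y \<in> squares"
proof -
  obtain C where C: "C > 0" "\<And>c. c \<ge> C \<Longrightarrow> norm (1 - (1/c) *\<^sub>R x) \<le> 1"
    using squares_bound[OF assms(1)] by blast
  obtain D where D: "D > 0" "\<And>c. c \<ge> D \<Longrightarrow> norm (1 - (1/c) *\<^sub>R y) \<le> 1"
    using squares_bound[OF assms(2)] by blast
  \<comment> \<open>A scale that is large enough for both summands.\<close>
  define c where "c = max C D"
  have c: "c > 0" "norm (1 - (1/c) *\<^sub>R x) \<le> 1" "norm (1 - (1/c) *\<^sub>R y) \<le> 1"
    using C D by (auto simp: c_def)
  have eq: "1 - (1/(2*c)) *\<^sub>R (x + y) = (1/2) *\<^sub>R ((1 - (1/c) *\<^sub>R x) + (1 - (1/c) *\<^sub>R y))"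
    by (simp add: algebra_simps flip: scaleR_2) 
  have "norm (1 - (1/(2*c)) *\<^sub>R (x + y)) \<le> 1"
    unfolding eq using c(2,3) norm_triangle_ineq[of "1 - (1/c) *\<^sub>R x" "1 - (1/c) *\<^sub>R y"] by simp
  moreover have "star ((1/(2*c)) *\<^sub>R (x + y)) = (1/(2*c)) *\<^sub>R (x + y)"
    using assms[THEN squares_selfadjoint] by (simp only: star_scaleR star_add)
  ultimately obtain s where s: "star s = s" "s * s = (1/(2*c)) *\<^sub>R (x + y)"
    using sqrt_exists by blast
  then have "(1/(2*c)) *\<^sub>R (x + y) \<in> squares" unfolding squares_def by (metis (mono_tags, lifting) mem_Collect_eq)
  from squares_scaleR[OF this, of "2*c"] c(1) show ?thesis by simp
qed

lemma squares_zero: "0 \<in> squares"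
  by (auto simp: squares_def intro!: exI[of _ 0])

lemma squares_one: "(1::'a::unital_cstar_algebra) \<in> squares"
  by (auto simp: squares_def intro!: exI[of _ 1])

lemma squares_sum:
  fixes g :: "'i \<Rightarrow> 'a::unital_cstar_algebra"
  shows "(\<And>i. i \<in> A \<Longrightarrow> g i \<in> squares) \<Longrightarrow> sum g A \<in> squares"
  by (induction A rule: infinite_finite_induct) (auto simp: squares_zero intro: squares_add)

lemma squares_mult:
  fixes x y :: "'a::unital_cstar_algebra"
  assumes "x \<in> squares" "y \<in> squares" "x * y = y * x"
  shows "x * y \<in> squares"
proof -
  obtain s where s: "star s = s" "s * s = x" "\<And>c. c * x = x * c \<Longrightarrow> c * s = s * c"
    using squares_sqrt[OF assms(1)] by blast
  obtain r where r: "star r = r" "r * r = y" "\<And>c. c * y = y * c \<Longrightarrow> c * r = r * c"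
    using squares_sqrt[OF assms(2)] by blast
  have "s * y = y * s" using s(3)[of y] assms(3) by simp
  then have rs: "s * r = r * s" using r(3)[of s] by simp
  then have "(s * r) * (s * r) = x * y" by (metis mult.assoc s(2) r(2))
  moreover have "star (s * r) = s * r" using s(1) r(1) rs by (simp add: star_mult)
  ultimately show ?thesis unfolding squares_def by (metis (mono_tags, lifting) mem_Collect_eq)
qed

text \<open>
  The product \<open>(M - x)(M + x) = M\<^sup>2 - x\<^sup>2\<close> of commuting squares is again a square \<open>s\<^sup>2\<close>, so that
  \<open>x\<^sup>2 + s\<^sup>2 = M\<^sup>2\<close>.
\<close>
lemma norm_le_of_squares:
  fixes x :: "'a::unital_cstar_algebra"
  assumes "M *\<^sub>R 1 - x \<in> squares" "M *\<^sub>R 1 + x \<in> squares" "M \<ge> 0"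
  shows "norm x \<le> M"
proof -
  have sx: "star x = x"
    using squares_selfadjoint[OF assms(2)] by (simp add: star_add star_scaleR)
  have "(M *\<^sub>R 1 - x) * (M *\<^sub>R 1 + x) \<in> squares"
    by (intro squares_mult assms) (simp add: algebra_simps)
  then obtain s where s: "star s = s" "s * s = (M *\<^sub>R 1 - x) * (M *\<^sub>R 1 + x)"
      "\<And>c. c * ((M *\<^sub>R 1 - x) * (M *\<^sub>R 1 + x)) = ((M *\<^sub>R 1 - x) * (M *\<^sub>R 1 + x)) * c \<Longrightarrow> c * s = s * c"
    using squares_sqrt by blast
  have "x * s = s * x" by (rule s(3)) (simp add: algebra_simps)
  then show ?thesis
    using norm_le_of_sum_squares[OF sx s(1), of M] assms(3) s(2) by (simp add: algebra_simps)
qed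

section \<open>Polynomials in an element\<close>

text \<open>
  Evaluation of a real polynomial in an algebra that may be noncommutative.
\<close>
definition poly_at :: "'a::real_algebra_1 \<Rightarrow> real poly \<Rightarrow> 'a"
  where "poly_at a p = fold_coeffs (\<lambda>c y. c *\<^sub>R 1 + a * y) p 0"

lemma poly_at_0 [simp]: "poly_at a 0 = 0"
  by (simp add: poly_at_def)

lemma poly_at_pCons [simp]: "poly_at a (pCons c p) = c *\<^sub>R 1 + a * poly_at a p"
  by (cases "p = 0 \<and> c = 0") (auto simp: poly_at_def)

lemma poly_at_1 [simp]: "poly_at a 1 = 1"
  by (simp add: one_pCons)

lemma poly_at_add: "poly_at a (p + q) = poly_at a p + poly_at a q"
  by (induction p q rule: poly_induct2) (simp_all add: algebra_simps)

lemma poly_at_smult: "poly_at a (smult c p) = c *\<^sub>R poly_at a p"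
  by (induction p) (simp_all add: algebra_simps)

lemma poly_at_minus: "poly_at a (p - q) = poly_at a p - poly_at a q"
proof -
  have "p - q = p + smult (-1) q" by simp
  then show ?thesis by (simp only: poly_at_add poly_at_smult) simp
qed

lemma poly_at_mult: "poly_at a (p * q) = poly_at a p * poly_at a q"
  by (induction p) (simp_all add: algebra_simps poly_at_add poly_at_smult)

lemma poly_at_power: "poly_at a (p ^ n) = poly_at a p ^ n"
  by (induction n) (simp_all add: poly_at_mult)

lemma poly_at_sum: "poly_at a (sum g A) = (\<Sum>i\<in>A. poly_at a (g i))"
  by (induction A rule: infinite_finite_induct) (simp_all add: poly_at_add)

lemma poly_at_pcompose: "poly_at a (pcompose p q) = poly_at (poly_at a q) p"
  by (induction p) (simp_all add: pcompose_pCons poly_at_add poly_at_mult)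

lemma poly_at_intertwine:
  assumes "x * a = c * x"
  shows "x * poly_at a p = poly_at c p * x"
proof (induction p)
  case (pCons d p)
  have "x * (a * poly_at a p) = c * (x * poly_at a p)" by (metis assms mult.assoc)
  then show ?case by (simp add: pCons algebra_simps)
qed simp

lemma star_poly_at:
  fixes a :: "'a::unital_cstar_algebra"
  shows "star a = a \<Longrightarrow> star (poly_at a p) = poly_at a p"
  by (induction p) (simp_all add: star_add star_scaleR star_mult poly_at_intertwine)

text \<open>
  The left ratio is the coefficient of \<open>t ^ m\<close> in the Bernstein basis of degree \<open>n\<close>, the power is the value
  of \<open>t ^ m\<close> at the node \<open>k / n\<close>. They agree up to \<open>O(1/n)\<close> uniformly in \<open>k\<close>: this is the
  induction on \<open>m\<close>, multiplying by \<open>(k - m) / (n - m)\<close> on one side and by \<open>k / n\<close> on the other.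
\<close>
lemma binomial_ratio_bound:
  assumes "k \<le> n" "d < n"
  shows "m \<le> d \<Longrightarrow>
    \<bar>real (k choose m) / real (n choose m) - (real k / real n) ^ m\<bar> \<le> real m * (real d / (real n - real d))"
proof (induction m)
  case (Suc m)
  define R where "R = real (k choose m) / real (n choose m)"
  define B where "B = real d / (real n - real d)"
  have step: "real (j choose Suc m) * real (Suc m) = real (j choose m) * real (j - m)" for j
  proof (cases "m < j")
    case True
    then obtain b where b: "j = Suc (m + b)" using less_imp_Suc_add by blast
    show ?thesis using Suc_times_binomial_add[of m b] unfolding b
      by (simp only: of_nat_mult[symmetric] of_nat_eq_iff) (simp add: algebra_simps)
  qed (cases "m = j", simp_all)
  have npos: "real (n choose m) > 0" "n > m" "real (n choose Suc m) > 0" using Suc.prems assms by auto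
  have R1: "0 \<le> R" "R \<le> 1"
    unfolding R_def using npos binomial_right_mono[OF assms(1), of m] by auto
  have "real (k choose Suc m) / real (n choose Suc m) =
      (real (k choose Suc m) * real (Suc m)) / (real (n choose Suc m) * real (Suc m))" by simp
  also have "\<dots> = R * (real (k - m) / real (n - m))" unfolding step R_def by simp
  finally have RS: "real (k choose Suc m) / real (n choose Suc m) = R * (real (k - m) / real (n - m))" .
  have *: "\<bar>R * (real (k - m) / real (n - m) - real k / real n)\<bar> \<le> B"
  proof (cases "k < m")
    case True
    then have "R = 0" by (simp add: R_def binomial_eq_0)
    then show ?thesis using assms by (simp add: B_def)
  next
    case False
    have nn: "real n > 0" "real n - real m > 0" using npos by auto
    have "real (k - m) / real (n - m) - real k / real n =
        - (real m / (real n - real m)) * ((real n - real k) / real n)"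
      using False nn npos by (simp add: of_nat_diff field_simps)
    also have "\<bar>\<dots>\<bar> = (real m / (real n - real m)) * ((real n - real k) / real n)"
      using nn assms by (simp add: abs_mult)
    also have "\<dots> \<le> (real m / (real n - real m)) * 1"
      using nn assms by (intro mult_left_mono) auto
    also have "\<dots> \<le> B" unfolding B_def mult_1_right using Suc.prems assms nn by (intro frac_le) auto
    finally have "\<bar>real (k - m) / real (n - m) - real k / real n\<bar> \<le> B" .
    then show ?thesis using R1 mult_mono[of R 1 "\<bar>real (k - m) / real (n - m) - real k / real n\<bar>" B]
      by (simp add: abs_mult)
  qed
  have **: "\<bar>(R - (real k / real n) ^ m) * (real k / real n)\<bar> \<le> real m * B * 1"
    unfolding abs_mult using Suc assms unfolding R_def B_def by (intro mult_mono) auto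
  have "R * (real (k - m) / real (n - m)) - (real k / real n) ^ Suc m =
      R * (real (k - m) / real (n - m) - real k / real n) + (R - (real k / real n) ^ m) * (real k / real n)"
    by (simp add: algebra_simps)
  also have "\<bar>\<dots>\<bar> \<le> B + real m * B * 1" by (rule order_trans[OF abs_triangle_ineq add_mono[OF * **]])
  also have "\<dots> = real (Suc m) * B" by (simp add: algebra_simps)
  finally show ?case unfolding RS B_def .
qed simp

definition bernstein_poly :: "nat \<Rightarrow> nat \<Rightarrow> real poly"
  where "bernstein_poly n k = smult (real (n choose k)) ([:0, 1:] ^ k * [:1, -1:] ^ (n - k))"

text \<open>
  Expand the factor \<open>(t + (1 - t)) ^ (n - m)\<close> of \<open>t ^ m = t ^ m (t + (1 - t)) ^ (n - m)\<close>.
\<close>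
lemma monom_bernstein:
  assumes "m \<le> n"
  shows "monom 1 m = (\<Sum>k\<le>n. smult (real (k choose m) / real (n choose m)) (bernstein_poly n k))"
proof -
  have "t ^ m = (\<Sum>k\<le>n. real (k choose m) / real (n choose m) * (real (n choose k) * (t ^ k * (1 - t) ^ (n - k))))"
    for t :: real
  proof -
    have "(\<Sum>k\<le>n. real (k choose m) / real (n choose m) * (real (n choose k) * (t ^ k * (1 - t) ^ (n - k)))) =
       (\<Sum>k\<in>{m..n}. real (k choose m) / real (n choose m) * (real (n choose k) * (t ^ k * (1 - t) ^ (n - k))))"
      by (rule sum.mono_neutral_right) (auto simp: binomial_eq_0)
    also have "\<dots> = (\<Sum>k\<in>{m..n}. real ((n - m) choose (k - m)) * (t ^ k * (1 - t) ^ (n - k)))"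
    proof (rule sum.cong)
      fix k assume k: "k \<in> {m..n}"
      have "(n choose k) * (k choose m) = (n choose m) * ((n - m) choose (k - m))"
        using k by (intro choose_mult) auto
      then have "real (n choose k) * real (k choose m) = real (n choose m) * real ((n - m) choose (k - m))"
        by (metis of_nat_mult)
      moreover have "real (n choose m) > 0" using assms by simp
      ultimately have "real (k choose m) / real (n choose m) * real (n choose k) = real ((n - m) choose (k - m))"
        by (simp add: field_simps)
      then show "real (k choose m) / real (n choose m) * (real (n choose k) * (t ^ k * (1 - t) ^ (n - k))) =
          real ((n - m) choose (k - m)) * (t ^ k * (1 - t) ^ (n - k))"
        by (metis mult.assoc)
    qed simp
    also have "\<dots> = (\<Sum>j\<in>{0..n-m}. real ((n - m) choose j) * (t ^ (j + m) * (1 - t) ^ (n - (j + m))))"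
      using assms sum.shift_bounds_cl_nat_ivl[of "\<lambda>k. real ((n - m) choose (k - m)) * (t ^ k * (1 - t) ^ (n - k))" 0 m "n - m"]
      by simp
    also have "\<dots> = t ^ m * (\<Sum>j\<le>n-m. real ((n - m) choose j) * t ^ j * (1 - t) ^ (n - m - j))"
      by (simp add: sum_distrib_left power_add algebra_simps atLeast0AtMost)
    also have "(\<Sum>j\<le>n-m. real ((n - m) choose j) * t ^ j * (1 - t) ^ (n - m - j)) = (t + (1 - t)) ^ (n - m)"
      by (rule binomial_ring[symmetric])
    finally show ?thesis by simp
  qed
  then have "poly (monom 1 m) = poly (\<Sum>k\<le>n. smult (real (k choose m) / real (n choose m)) (bernstein_poly n k))"
    by (intro ext) (simp add: poly_monom poly_sum bernstein_poly_def mult.assoc)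
  then show ?thesis by (simp only: poly_eq_poly_eq_iff)
qed

lemma squares_power:
  fixes x :: "'a::unital_cstar_algebra"
  shows "x \<in> squares \<Longrightarrow> x ^ n \<in> squares"
  by (induction n) (auto intro!: squares_one squares_mult simp: power_commutes)

lemma poly_at_bernstein:
  "poly_at b (bernstein_poly n k) = real (n choose k) *\<^sub>R (b ^ k * (1 - b) ^ (n - k))"
  by (simp add: bernstein_poly_def poly_at_smult poly_at_mult poly_at_power)

lemma bernstein_in_squares:
  fixes b :: "'a::unital_cstar_algebra"
  assumes "b \<in> squares" "1 - b \<in> squares"
  shows "poly_at b (bernstein_poly n k) \<in> squares"
  unfolding poly_at_bernstein
proof (intro squares_scaleR squares_mult squares_power assms)
  have "b * (1 - b) ^ j = (1 - b) ^ j * b" for j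
    by (induction j) (simp_all add: algebra_simps, metis mult.assoc)
  then show "b ^ k * (1 - b) ^ (n - k) = (1 - b) ^ (n - k) * b ^ k"
    by (metis power_commuting_commutes)
qed simp

text \<open>
  In the Bernstein basis of large degree \<open>n\<close> the coefficients \<open>c k\<close> of \<open>p\<close> are close to the values
  \<open>p (k/n)\<close>, hence at most \<open>M + e\<close>. The basis polynomials take values in the squares at \<open>b\<close> and sum up to \<open>1\<close>,
  so \<open>(M + e) 1 \<plusminus> p(b)\<close> is a sum of squares.
\<close>
lemma norm_poly_at_unit_interval:
  fixes b :: "'a::unital_cstar_algebra"
  assumes b: "b \<in> squares" "1 - b \<in> squares"
    and M: "\<And>t. 0 \<le> t \<Longrightarrow> t \<le> 1 \<Longrightarrow> \<bar>poly p t\<bar> \<le> M"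
  shows "norm (poly_at b p) \<le> M"
proof (rule field_le_epsilon)
  fix e :: real assume e: "e > 0"
  define D where "D = degree p"
  define S where "S = (\<Sum>m\<le>D. \<bar>coeff p m\<bar>)"
  have "S \<ge> 0" unfolding S_def by (simp add: sum_nonneg)
  \<comment> \<open>\<open>n\<close> is chosen so large that \<open>binomial_ratio_bound\<close>, summed against the coefficients, is at most \<open>e\<close>.\<close>
  obtain n0 :: nat where n0: "real n0 > S * (real D * real D) / e" using reals_Archimedean2 by blast
  define n where "n = n0 + D + 1"
  have Dn: "D < n" by (simp add: n_def)
  have "S * (real D * real D) < (real n - real D) * e"
  proof -
    have "S * (real D * real D) < real n0 * e" using n0 e by (simp add: field_simps)
    also have "\<dots> \<le> (real n - real D) * e" using e by (intro mult_right_mono) (auto simp: n_def)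
    finally show ?thesis .
  qed
  then have small: "S * (real D * (real D / (real n - real D))) \<le> e" using Dn by (simp add: field_simps)
  define c where "c k = (\<Sum>m\<le>D. coeff p m * (real (k choose m) / real (n choose m)))" for k
  have c: "\<bar>c k\<bar> \<le> M + e" if "k \<le> n" for k
  proof -
    have "\<bar>c k - poly p (real k / real n)\<bar> =
        \<bar>\<Sum>m\<le>D. coeff p m * (real (k choose m) / real (n choose m) - (real k / real n) ^ m)\<bar>"
      by (simp add: c_def poly_altdef D_def sum_subtractf algebra_simps)
    also have "\<dots> \<le> (\<Sum>m\<le>D. \<bar>coeff p m\<bar> * (real D * (real D / (real n - real D))))"
    proof (rule order_trans[OF sum_abs sum_mono])
      fix m assume m: "m \<in> {..D}"
      have "\<bar>real (k choose m) / real (n choose m) - (real k / real n) ^ m\<bar> \<le> real m * (real D / (real n - real D))"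
        using m by (intro binomial_ratio_bound that Dn) auto
      also have "\<dots> \<le> real D * (real D / (real n - real D))"
        using m Dn by (intro mult_right_mono) auto
      finally show "\<bar>coeff p m * (real (k choose m) / real (n choose m) - (real k / real n) ^ m)\<bar>
          \<le> \<bar>coeff p m\<bar> * (real D * (real D / (real n - real D)))"
        unfolding abs_mult by (rule mult_left_mono) simp
    qed
    also have "\<dots> = S * (real D * (real D / (real n - real D)))"
      unfolding S_def by (rule sum_distrib_right[symmetric])
    also note small
    finally have "\<bar>c k - poly p (real k / real n)\<bar> \<le> e" .
    moreover have "\<bar>poly p (real k / real n)\<bar> \<le> M" using that by (intro M) (auto simp: divide_le_eq_1)
    ultimately show ?thesis by linarith
  qed
  have "p = (\<Sum>m\<le>D. smult (coeff p m) (monom 1 m))"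
    unfolding D_def smult_monom by (simp add: poly_as_sum_of_monoms)
  also have "\<dots> = (\<Sum>m\<le>D. \<Sum>k\<le>n. smult (coeff p m * (real (k choose m) / real (n choose m))) (bernstein_poly n k))"
  proof (rule sum.cong)
    fix m assume "m \<in> {..D}"
    then have "m \<le> n" using Dn by simp
    show "smult (coeff p m) (monom 1 m) = (\<Sum>k\<le>n. smult (coeff p m * (real (k choose m) / real (n choose m))) (bernstein_poly n k))"
      unfolding monom_bernstein[OF \<open>m \<le> n\<close>]
      using sum_comp_morphism[of "smult (coeff p m)" "\<lambda>k. smult (real (k choose m) / real (n choose m)) (bernstein_poly n k)" "{..n}"]
      by (simp add: smult_add_right comp_def)
  qed simp
  also have "\<dots> = (\<Sum>k\<le>n. smult (c k) (bernstein_poly n k))"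
    unfolding c_def smult_sum by (rule sum.swap)
  finally have p: "poly_at b p = (\<Sum>k\<le>n. c k *\<^sub>R poly_at b (bernstein_poly n k))"
    by (metis (no_types, lifting) poly_at_sum poly_at_smult sum.cong)
  have "(monom 1 0 :: real poly) = (\<Sum>k\<le>n. bernstein_poly n k)"
    using monom_bernstein[of 0 n] by simp
  then have one: "1 = (\<Sum>k\<le>n. poly_at b (bernstein_poly n k))"
    by (metis poly_at_sum poly_at_1 monom_eq_1)
  show "norm (poly_at b p) \<le> M + e"
  proof (rule norm_le_of_squares)
    have "(M + e) *\<^sub>R 1 - poly_at b p = (\<Sum>k\<le>n. (M + e - c k) *\<^sub>R poly_at b (bernstein_poly n k))"
      unfolding p by (subst one) (simp add: scaleR_sum_right sum_subtractf scaleR_left_diff_distrib)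
    also have "\<dots> \<in> squares"
    proof (intro squares_sum squares_scaleR bernstein_in_squares b)
      fix k assume "k \<in> {..n}" then show "0 \<le> M + e - c k" using c[of k] by auto
    qed
    finally show "(M + e) *\<^sub>R 1 - poly_at b p \<in> squares" .
    have "(M + e) *\<^sub>R 1 + poly_at b p = (\<Sum>k\<le>n. (M + e + c k) *\<^sub>R poly_at b (bernstein_poly n k))"
      unfolding p by (subst one) (simp add: scaleR_sum_right sum.distrib scaleR_left_distrib)
    also have "\<dots> \<in> squares"
    proof (intro squares_sum squares_scaleR bernstein_in_squares b)
      fix k assume "k \<in> {..n}" then show "0 \<le> M + e + c k" using c[of k] by auto
    qed
    finally show "(M + e) *\<^sub>R 1 + poly_at b p \<in> squares" .
    show "0 \<le> M + e" using c[of 0] by auto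
  qed
qed

text \<open>
  The affine substitution \<open>b = (1 + a/R)/2\<close> moves \<open>[-R, R]\<close> to the unit interval.
\<close>
lemma norm_poly_at_le:
  fixes a :: "'a::unital_cstar_algebra"
  assumes a: "star a = a" "norm a \<le> R" and R: "R > 0"
    and M: "\<And>t. t \<in> {-R..R} \<Longrightarrow> \<bar>poly p t\<bar> \<le> M"
  shows "norm (poly_at a p) \<le> M"
proof -
  define b where "b = (1/2) *\<^sub>R (1 + (1/R) *\<^sub>R a)"
  have na: "norm ((1/R) *\<^sub>R a) \<le> 1" using a R by simp
  have sq: "x \<in> squares" if "star x = x" "norm (1 - x) \<le> 1" for x :: 'a
    using sqrt_exists[OF that] unfolding squares_def by (metis (mono_tags, lifting) mem_Collect_eq)
  have "1 - b = (1/2) *\<^sub>R (1 - (1/R) *\<^sub>R a)"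
    unfolding b_def by (simp add: algebra_simps flip: scaleR_add_left)
  then have "norm (1 - b) \<le> 1"
    using norm_triangle_ineq4[of 1 "(1/R) *\<^sub>R a"] na by simp
  then have b1: "b \<in> squares"
    by (intro sq) (simp_all add: b_def star_scaleR star_add a)
  have "norm b \<le> 1"
    unfolding b_def using norm_triangle_ineq[of 1 "(1/R) *\<^sub>R a"] na by simp
  then have b2: "1 - b \<in> squares"
    by (intro sq) (simp_all add: b_def star_scaleR star_add star_diff a)
  define q where "q = pcompose p [:-R, 2 * R:]"
  have "poly_at b [:-R, 2 * R:] = a"
    using R by (simp add: b_def algebra_simps)
  then have "poly_at a p = poly_at b q" by (simp add: q_def poly_at_pcompose)
  moreover have "norm (poly_at b q) \<le> M"
  proof (rule norm_poly_at_unit_interval[OF b1 b2])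
    fix t :: real assume t: "0 \<le> t" "t \<le> 1"
    have "t * R \<le> R" using t R by (simp add: mult_left_le_one_le)
    moreover have "t * R \<ge> 0" using t R by simp
    ultimately show "\<bar>poly q t\<bar> \<le> M"
      unfolding q_def poly_pcompose by (intro M) (simp add: algebra_simps)
  qed
  ultimately show ?thesis by simp
qed

section \<open>Continuous functions of a self-adjoint element\<close>

lemma poly_approx:
  fixes f :: "real \<Rightarrow> real"
  assumes "continuous_on UNIV f"
  obtains P where "uniform_limit {-R..R} (\<lambda>n. poly (P n)) f sequentially"
proof -
  have "\<exists>p. \<forall>t\<in>{-R..R}. \<bar>f t - poly p t\<bar> < 1 / real (Suc n)" for n
  proof -
    obtain g where g: "polynomial_function g" "\<And>x. x \<in> {-R..R} \<Longrightarrow> norm (f x - g x) < 1 / real (Suc n)"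
      using Stone_Weierstrass_polynomial_function[of "{-R..R}" f "1 / real (Suc n)"]
        continuous_on_subset[OF assms] by auto
    then obtain a k where "g = (\<lambda>x. \<Sum>i\<le>k. a i * x ^ i)"
      unfolding real_polynomial_function_eq[symmetric] real_polynomial_function_iff_sum by blast
    then have "g = poly (\<Sum>i\<le>k. monom (a i) i)" by (auto simp: poly_sum poly_monom)
    then show ?thesis using g(2) by (intro exI[of _ "\<Sum>i\<le>k. monom (a i) i"] ballI) (metis real_norm_def)
  qed
  then obtain P where P: "\<And>n t. t \<in> {-R..R} \<Longrightarrow> \<bar>f t - poly (P n) t\<bar> < 1 / real (Suc n)" by metis
  have "uniform_limit {-R..R} (\<lambda>n. poly (P n)) f sequentially"
  proof (rule uniform_limitI)
    fix e :: real assume "e > 0"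
    then obtain N where N: "1 / real (Suc N) < e" using nat_approx_posE by blast
    show "\<forall>\<^sub>F n in sequentially. \<forall>t\<in>{-R..R}. dist (poly (P n) t) (f t) < e"
    proof (rule eventually_sequentiallyI[of N], intro ballI)
      fix n t assume "N \<le> n" "t \<in> {-R..R}"
      have "1 / real (Suc n) \<le> 1 / real (Suc N)" using \<open>N \<le> n\<close> by (simp add: frac_le)
      then show "dist (poly (P n) t) (f t) < e" using P[OF \<open>t \<in> _\<close>, of n] N by (simp add: dist_real_def abs_minus_commute)
    qed
  qed
  then show thesis by (rule that)
qed

text \<open>
  The radius exceeds the norm by one so that the interval has positive length also for \<open>a = 0\<close>.
\<close>
definition cfc :: "'a::unital_cstar_algebra \<Rightarrow> (real \<Rightarrow> real) \<Rightarrow> 'a"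
  where "cfc a f = lim (\<lambda>n. poly_at a ((SOME P.
    uniform_limit {-(norm a + 1)..norm a + 1} (\<lambda>n. poly (P n)) f sequentially) n))"

text \<open>
  Independence of the chosen approximation: two sequences of polynomials with the same uniform limit
  differ by polynomials that are uniformly small on the interval, hence small at \<open>a\<close>.
\<close>
lemma cfc_LIMSEQ:
  fixes a :: "'a::unital_cstar_algebra"
  assumes a: "star a = a" and Q: "uniform_limit {-R..R} (\<lambda>n. poly (Q n)) f sequentially"
    and R: "R \<ge> norm a + 1"
  shows "(\<lambda>n. poly_at a (Q n)) \<longlonglongrightarrow> cfc a f"
proof -
  define S where "S = {-(norm a + 1)..norm a + 1}"
  define P where "P = (SOME P. uniform_limit S (\<lambda>n. poly (P n)) f sequentially)"
  have QS: "uniform_limit S (\<lambda>n. poly (Q n)) f sequentially"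
    by (rule uniform_limit_on_subset[OF Q]) (use R in \<open>auto simp: S_def\<close>)
  then have PS: "uniform_limit S (\<lambda>n. poly (P n)) f sequentially"
    unfolding P_def by (rule someI[where P = "\<lambda>P. uniform_limit S (\<lambda>n. poly (P n)) f sequentially"])
  have close: "norm (poly_at a p - poly_at a q) \<le> e" if "\<And>t. t \<in> S \<Longrightarrow> \<bar>poly p t - poly q t\<bar> \<le> e" for p q e
    using norm_poly_at_le[of a "norm a + 1" "p - q" e] a that
    by (auto simp: S_def poly_at_minus add_nonneg_pos)
  have "Cauchy (\<lambda>n. poly_at a (P n))"
  proof (rule metric_CauchyI)
    fix e :: real assume "e > 0"
    then have "\<forall>\<^sub>F n in sequentially. \<forall>t\<in>S. dist (poly (P n) t) (f t) < e/4"
      using uniform_limitD[OF PS, of "e/4"] by simp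
    then obtain N where N: "\<And>n t. n \<ge> N \<Longrightarrow> t \<in> S \<Longrightarrow> dist (poly (P n) t) (f t) < e/4"
      unfolding eventually_sequentially by blast
    have "dist (poly_at a (P m)) (poly_at a (P n)) < e" if "m \<ge> N" "n \<ge> N" for m n
    proof -
      have "norm (poly_at a (P m) - poly_at a (P n)) \<le> e/2"
      proof (rule close)
        fix t assume "t \<in> S"
        show "\<bar>poly (P m) t - poly (P n) t\<bar> \<le> e/2"
          using N[OF that(1) \<open>t \<in> S\<close>] N[OF that(2) \<open>t \<in> S\<close>] unfolding dist_real_def by linarith
      qed
      then show ?thesis using \<open>e > 0\<close> by (simp add: dist_norm)
    qed
    then show "\<exists>M. \<forall>m\<ge>M. \<forall>n\<ge>M. dist (poly_at a (P m)) (poly_at a (P n)) < e" by blast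
  qed
  then have "(\<lambda>n. poly_at a (P n)) \<longlonglongrightarrow> cfc a f"
    unfolding cfc_def P_def S_def by (simp add: Cauchy_convergent_iff convergent_LIMSEQ_iff)
  moreover have "(\<lambda>n. poly_at a (Q n) - poly_at a (P n)) \<longlonglongrightarrow> 0"
  proof (rule LIMSEQ_I)
    fix e :: real assume "e > 0"
    have "\<forall>\<^sub>F n in sequentially. (\<forall>t\<in>S. dist (poly (P n) t) (f t) < e/4) \<and> (\<forall>t\<in>S. dist (poly (Q n) t) (f t) < e/4)"
      using uniform_limitD[OF PS, of "e/4"] uniform_limitD[OF QS, of "e/4"] \<open>e > 0\<close> by (auto intro: eventually_conj)
    then obtain N where N: "\<And>n t. n \<ge> N \<Longrightarrow> t \<in> S \<Longrightarrow> dist (poly (P n) t) (f t) < e/4"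
      "\<And>n t. n \<ge> N \<Longrightarrow> t \<in> S \<Longrightarrow> dist (poly (Q n) t) (f t) < e/4"
      unfolding eventually_sequentially by blast
    have "norm (poly_at a (Q n) - poly_at a (P n)) \<le> e/2" if "n \<ge> N" for n
    proof (rule close)
      fix t assume "t \<in> S"
      show "\<bar>poly (Q n) t - poly (P n) t\<bar> \<le> e/2"
        using N[OF that \<open>t \<in> S\<close>] unfolding dist_real_def by linarith
    qed
    then show "\<exists>no. \<forall>n\<ge>no. norm (poly_at a (Q n) - poly_at a (P n) - 0) < e"
      using \<open>e > 0\<close> by (intro exI[of _ N]) fastforce
  qed
  ultimately show ?thesis using tendsto_add by fastforce
qed

lemma cfc_approx:
  fixes a c :: "'a::unital_cstar_algebra"
  assumes "continuous_on UNIV f"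
  obtains P R where "uniform_limit {-R..R} (\<lambda>n. poly (P n)) f sequentially"
    "R \<ge> norm a + 1" "R \<ge> norm c + 1"
proof -
  obtain P where "uniform_limit {-(norm a + norm c + 1)..norm a + norm c + 1} (\<lambda>n. poly (P n)) f sequentially"
    using poly_approx[OF assms] .
  then show thesis by (rule that) auto
qed

lemma cfc_poly:
  fixes a :: "'a::unital_cstar_algebra"
  assumes "star a = a"
  shows "cfc a (poly p) = poly_at a p"
proof -
  have "(\<lambda>n. poly_at a p) \<longlonglongrightarrow> cfc a (poly p)"
    by (rule cfc_LIMSEQ[OF assms _ order_refl]) (rule uniform_limit_const)
  then show ?thesis using LIMSEQ_unique tendsto_const by blast
qed

lemma cfc_const: "star a = a \<Longrightarrow> cfc a (\<lambda>_. c) = c *\<^sub>R 1"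
proof -
  assume "star a = a"
  moreover have "poly [:c:] = (\<lambda>_. c)" by auto
  ultimately show ?thesis using cfc_poly[of a "[:c:]"] by simp
qed

lemma cfc_id: "star a = a \<Longrightarrow> cfc a (\<lambda>t. t) = a"
proof -
  assume "star a = a"
  moreover have "poly [:0, 1::real:] = (\<lambda>t. t)" by auto
  ultimately show ?thesis using cfc_poly[of a "[:0, 1:]"] by simp
qed

lemma cfc_add:
  fixes a :: "'a::unital_cstar_algebra"
  assumes a: "star a = a" and f: "continuous_on UNIV f" and g: "continuous_on UNIV g"
  shows "cfc a (\<lambda>t. f t + g t) = cfc a f + cfc a g"
proof -
  define R where "R = norm a + 1"
  obtain P where P: "uniform_limit {-R..R} (\<lambda>n. poly (P n)) f sequentially" using poly_approx[OF f] .
  obtain Q where Q: "uniform_limit {-R..R} (\<lambda>n. poly (Q n)) g sequentially" using poly_approx[OF g] .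
  have "uniform_limit {-R..R} (\<lambda>n. poly (P n + Q n)) (\<lambda>t. f t + g t) sequentially"
    unfolding poly_add by (rule uniform_limit_add[OF P Q])
  from cfc_LIMSEQ[OF a this] have "(\<lambda>n. poly_at a (P n) + poly_at a (Q n)) \<longlonglongrightarrow> cfc a (\<lambda>t. f t + g t)"
    by (simp add: R_def poly_at_add)
  moreover have "(\<lambda>n. poly_at a (P n) + poly_at a (Q n)) \<longlonglongrightarrow> cfc a f + cfc a g"
    by (intro tendsto_add cfc_LIMSEQ[OF a P] cfc_LIMSEQ[OF a Q]) (simp_all add: R_def)
  ultimately show ?thesis using LIMSEQ_unique by blast
qed

lemma cfc_mult:
  fixes a :: "'a::unital_cstar_algebra"
  assumes a: "star a = a" and f: "continuous_on UNIV f" and g: "continuous_on UNIV g"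
  shows "cfc a (\<lambda>t. f t * g t) = cfc a f * cfc a g"
proof -
  define R where "R = norm a + 1"
  obtain P where P: "uniform_limit {-R..R} (\<lambda>n. poly (P n)) f sequentially" using poly_approx[OF f] .
  obtain Q where Q: "uniform_limit {-R..R} (\<lambda>n. poly (Q n)) g sequentially" using poly_approx[OF g] .
  have bdd: "bounded (h ` {-R..R})" if "continuous_on UNIV h" for h :: "real \<Rightarrow> real"
    by (rule compact_imp_bounded[OF compact_continuous_image[OF continuous_on_subset[OF that]]]) auto
  have "uniform_limit {-R..R} (\<lambda>n. poly (P n * Q n)) (\<lambda>t. f t * g t) sequentially"
    unfolding poly_mult by (rule uniform_lim_mult[OF P Q bdd[OF f] bdd[OF g]])
  from cfc_LIMSEQ[OF a this] have "(\<lambda>n. poly_at a (P n) * poly_at a (Q n)) \<longlonglongrightarrow> cfc a (\<lambda>t. f t * g t)"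
    by (simp add: R_def poly_at_mult)
  moreover have "(\<lambda>n. poly_at a (P n) * poly_at a (Q n)) \<longlonglongrightarrow> cfc a f * cfc a g"
    by (intro tendsto_mult cfc_LIMSEQ[OF a P] cfc_LIMSEQ[OF a Q]) (simp_all add: R_def)
  ultimately show ?thesis using LIMSEQ_unique by blast
qed

lemma cfc_scale:
  assumes "star a = a" "continuous_on UNIV f"
  shows "cfc a (\<lambda>t. c * f t) = c *\<^sub>R cfc a f"
  using cfc_mult[OF assms(1) _ assms(2), of "\<lambda>_. c"] assms(1) by (simp add: cfc_const)

lemma cfc_diff:
  assumes "star a = a" "continuous_on UNIV f" "continuous_on UNIV g"
  shows "cfc a (\<lambda>t. f t - g t) = cfc a f - cfc a g"
  using cfc_add[OF assms(1,2), of "\<lambda>t. (-1) * g t"] cfc_scale[OF assms(1,3), of "-1"] assms(3)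
  by (auto intro: continuous_intros)

text \<open>
  For \<open>c = a\<close> this says that \<open>f(a)\<close> commutes with the commutant of \<open>a\<close>; for a scalar \<open>c\<close> it says that
  \<open>f(a)\<close> acts on eigenvectors of \<open>a\<close> by \<open>f\<close> of the eigenvalue.
\<close>
lemma cfc_intertwine:
  fixes a c :: "'a::unital_cstar_algebra"
  assumes "star a = a" "star c = c" "x * a = c * x" "continuous_on UNIV f"
  shows "x * cfc a f = cfc c f * x"
proof -
  obtain P R where P: "uniform_limit {-R..R} (\<lambda>n. poly (P n)) f sequentially"
      "R \<ge> norm a + 1" "R \<ge> norm c + 1" using cfc_approx[OF assms(4)] .
  have "(\<lambda>n. x * poly_at a (P n)) \<longlonglongrightarrow> x * cfc a f"
    by (intro tendsto_intros cfc_LIMSEQ[OF _ P(1)] assms P)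
  moreover have "(\<lambda>n. poly_at c (P n) * x) \<longlonglongrightarrow> cfc c f * x"
    by (intro tendsto_intros cfc_LIMSEQ[OF _ P(1)] assms P)
  ultimately show ?thesis using LIMSEQ_unique by (simp add: poly_at_intertwine[OF assms(3)])
qed

lemma star_cfc:
  assumes "star a = a" "continuous_on UNIV f"
  shows "star (cfc a f) = cfc a f"
proof -
  obtain P R where P: "uniform_limit {-R..R} (\<lambda>n. poly (P n)) f sequentially"
      "R \<ge> norm a + 1" using cfc_approx[OF assms(2)] .
  from cfc_LIMSEQ[OF assms(1) P] have L: "(\<lambda>n. poly_at a (P n)) \<longlonglongrightarrow> cfc a f" .
  from tendsto_star[OF L] L show ?thesis using LIMSEQ_unique by (simp add: star_poly_at[OF assms(1)])
qed

lemma norm_cfc_le: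
  fixes a :: "'a::unital_cstar_algebra"
  assumes a: "star a = a" and f: "continuous_on UNIV f"
    and M: "\<And>t. t \<in> {-(norm a + 1)..norm a + 1} \<Longrightarrow> \<bar>f t\<bar> \<le> M"
  shows "norm (cfc a f) \<le> M"
proof (rule field_le_epsilon)
  fix e :: real assume "e > 0"
  define R where "R = norm a + 1"
  obtain P where P: "uniform_limit {-R..R} (\<lambda>n. poly (P n)) f sequentially" using poly_approx[OF f] .
  show "norm (cfc a f) \<le> M + e"
  proof (rule Lim_norm_ubound)
    show "(\<lambda>n. poly_at a (P n)) \<longlonglongrightarrow> cfc a f" by (rule cfc_LIMSEQ[OF a P]) (simp add: R_def)
    show "\<forall>\<^sub>F n in sequentially. norm (poly_at a (P n)) \<le> M + e"
      using uniform_limitD[OF P \<open>e > 0\<close>]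
    proof eventually_elim
      case (elim n)
      show ?case
      proof (rule norm_poly_at_le[OF a, of R])
        show "\<bar>poly (P n) t\<bar> \<le> M + e" if "t \<in> {-R..R}" for t
          using elim that M[of t] unfolding R_def dist_real_def by fastforce
      qed (simp_all add: R_def add_nonneg_pos)
    qed
  qed simp
qed

lemma cfc_cong:
  fixes a :: "'a::unital_cstar_algebra"
  assumes "star a = a" "continuous_on UNIV f" "continuous_on UNIV g"
    "\<And>t. t \<in> {-(norm a + 1)..norm a + 1} \<Longrightarrow> f t = g t"
  shows "cfc a f = cfc a g"
  using norm_cfc_le[OF assms(1) continuous_on_diff[OF assms(2,3)], of 0] assms(4)
  by (simp add: cfc_diff[OF assms(1-3)])

section \<open>The unitization as a C*-algebra\<close>

lemma elem_part_simps [simp]: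
  "elem_part 0 = 0" "elem_part 1 = 0"
  "elem_part (u + v) = elem_part u + elem_part v"
  "elem_part (u - v) = elem_part u - elem_part v"
  "elem_part (- u) = - elem_part u"
  "elem_part (u * v) =
    elem_part u * elem_part v + scalar_part u *\<^sub>C elem_part v + scalar_part v *\<^sub>C elem_part u"
  by (simp_all add: zero_unitization_def one_unitization_def plus_unitization_def
      minus_unitization_def uminus_unitization_def times_unitization_def)

lemma scalar_part_simps [simp]:
  "scalar_part 0 = 0" "scalar_part 1 = 1"
  "scalar_part (u + v) = scalar_part u + scalar_part v"
  "scalar_part (u - v) = scalar_part u - scalar_part v"
  "scalar_part (- u) = - scalar_part u"
  "scalar_part (u * v) = scalar_part u * scalar_part v"
  by (simp_all add: zero_unitization_def one_unitization_def plus_unitization_def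
      minus_unitization_def uminus_unitization_def times_unitization_def)

lemma unitization_eq_iff: "u = v \<longleftrightarrow> elem_part u = elem_part v \<and> scalar_part u = scalar_part v"
  by (cases u; cases v) simp

instantiation unitization :: (cstar_algebra) complex_vector
begin

definition "scaleR r u = Unitization (r *\<^sub>R elem_part u) (r *\<^sub>R scalar_part u)"
definition "scaleC c u = Unitization (c *\<^sub>C elem_part u) (c * scalar_part u)"

instance
  by standard
    (auto simp: scaleR_unitization_def scaleC_unitization_def unitization_eq_iff algebra_simps
      scaleR_conv_of_real complex_vector.scale_right_distrib complex_vector.scale_left_distrib scaleC_of_real)

end

lemma elem_part_scale [simp]:
  "elem_part (r *\<^sub>R u) = r *\<^sub>R elem_part u" "elem_part (c *\<^sub>C u) = c *\<^sub>C elem_part u"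
  "scalar_part (r *\<^sub>R u) = of_real r * scalar_part u" "scalar_part (c *\<^sub>C u) = c * scalar_part u"
  by (simp_all add: scaleR_unitization_def scaleC_unitization_def scaleR_conv_of_real)

lemma bounded_linear_scaleC: "bounded_linear (\<lambda>b::'a::cstar_algebra. c *\<^sub>C b)"
proof (rule bounded_linear_intro[where K = "cmod c"])
  show "c *\<^sub>C (r *\<^sub>R x) = r *\<^sub>R (c *\<^sub>C x)" for r and x :: 'a
    by (simp add: scaleC_scaleC mult.commute flip: scaleC_of_real)
qed (simp_all add: complex_vector.scale_right_distrib norm_scaleC mult.commute)

text \<open>
  The algebra is an ideal of its unitization; \<open>act u\<close> is left multiplication by \<open>u\<close> on it.
\<close>
definition act :: "'a::cstar_algebra unitization \<Rightarrow> 'a \<Rightarrow> 'a"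
  where "act u b = elem_part u * b + scalar_part u *\<^sub>C b"

lemma bounded_linear_act: "bounded_linear (act u)"
  unfolding act_def by (intro bounded_linear_add bounded_linear_mult_right bounded_linear_scaleC)

lemma act_simps:
  "act (u + v) b = act u b + act v b" "act (u * v) b = act u (act v b)" "act 1 b = b"
  "act (c *\<^sub>C u) b = c *\<^sub>C act u b" "act (r *\<^sub>R u) b = r *\<^sub>R act u b"
  by (simp_all add: act_def algebra_simps mult_scaleC_left mult_scaleC_right scaleC_scaleC
      complex_vector.scale_right_distrib complex_vector.scale_left_distrib)
     (simp add: scaleC_scaleC flip: scaleC_of_real)

text \<open>
  If the algebra has a unit \<open>e\<close>, then \<open>1 - e\<close> annihilates it, and the operator norm of \<open>act\<close> is only a
  seminorm. The maximum with the scalar part is a norm in all cases.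
\<close>
instantiation unitization :: (cstar_algebra) real_normed_vector
begin

definition "norm u = max (cmod (scalar_part u)) (onorm (act u))"
definition "dist u v = norm (u - v :: 'a unitization)"
definition "sgn u = u /\<^sub>R norm (u :: 'a unitization)"
definition "uniformity = (INF e\<in>{0 <..}. principal {(x :: 'a unitization, y). dist x y < e})"
definition "open (U :: 'a unitization set) \<longleftrightarrow>
  (\<forall>x\<in>U. eventually (\<lambda>(x', y). x' = x \<longrightarrow> y \<in> U) uniformity)"

instance
proof
  fix x y :: "'a unitization" and r :: real
  show "dist x y = norm (x - y)" by (rule dist_unitization_def)
  show "sgn x = x /\<^sub>R norm x" by (rule sgn_unitization_def)
  show "uniformity = (INF e\<in>{0 <..}. principal {(x :: 'a unitization, y). dist x y < e})"
    by (rule uniformity_unitization_def)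
  show "open U \<longleftrightarrow> (\<forall>x\<in>U. eventually (\<lambda>(x', y). x' = x \<longrightarrow> y \<in> U) uniformity)"
    for U :: "'a unitization set" by (rule open_unitization_def)
  show "norm x = 0 \<longleftrightarrow> x = 0"
  proof
    assume "norm x = 0"
    then have s: "scalar_part x = 0" and o: "onorm (act x) = 0"
      using onorm_pos_le[OF bounded_linear_act[of x]] norm_ge_zero[of "scalar_part x"]
      unfolding norm_unitization_def max_def by (auto split: if_splits)
    have "act x (star (elem_part x)) = 0" using o onorm_eq_0[OF bounded_linear_act[of x]] by simp
    then have "elem_part x * star (elem_part x) = 0" by (simp add: act_def s)
    then have "(norm (star (elem_part x)))\<^sup>2 = 0" using cstar_identity[of "star (elem_part x)"] by (simp add: star_star)
    then show "x = 0" using s by (simp add: unitization_eq_iff)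
  next
    assume "x = 0"
    moreover have "act 0 = (\<lambda>b::'a. 0)" by (auto simp: act_def)
    ultimately show "norm x = 0" by (simp add: norm_unitization_def onorm_zero)
  qed
  show "norm (x + y) \<le> norm x + norm y"
    using onorm_triangle[OF bounded_linear_act[of x] bounded_linear_act[of y]]
      norm_triangle_ineq[of "scalar_part x" "scalar_part y"]
    unfolding norm_unitization_def by (simp add: act_simps[abs_def] max_def)
  show "norm (r *\<^sub>R x) = \<bar>r\<bar> * norm x"
    using onorm_scaleR[OF bounded_linear_act[of x], of r]
    unfolding norm_unitization_def by (simp add: act_simps[abs_def] norm_mult max_mult_distrib_left)
qed

end

lemma norm_act_le: "norm (act u b) \<le> norm u * norm b"
proof -
  have "norm (act u b) \<le> onorm (act u) * norm b" by (rule onorm[OF bounded_linear_act])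
  also have "\<dots> \<le> norm u * norm b" by (intro mult_right_mono) (auto simp: norm_unitization_def)
  finally show ?thesis .
qed

lemma norm_unitization_le:
  assumes "cmod (scalar_part u) \<le> K" "\<And>b. norm (act u b) \<le> K * norm b"
  shows "norm u \<le> K"
proof -
  have "0 \<le> K" using assms(1) norm_ge_zero order_trans by blast
  then show ?thesis
    unfolding norm_unitization_def using assms by (simp add: onorm_bound)
qed

lemma cmod_scalar_part_le: "cmod (scalar_part u) \<le> norm u"
  by (simp add: norm_unitization_def)

text \<open>
  Both components are controlled by the norm, so a Cauchy sequence converges componentwise.
\<close>
lemma norm_elem_part_le: "norm (elem_part u) \<le> 2 * norm (u::'a::cstar_algebra unitization)"
proof -
  define a where "a = elem_part u"
  have "(norm a)\<^sup>2 = norm (a * star a)" using cstar_identity[of "star a"] by (simp add: star_star)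
  also have "a * star a = act u (star a) - scalar_part u *\<^sub>C star a" by (simp add: act_def a_def)
  also have "norm \<dots> \<le> norm u * norm a + norm u * norm a"
    using norm_act_le[of u "star a"] cmod_scalar_part_le[of u] mult_right_mono[OF cmod_scalar_part_le[of u], of "norm a"]
    by (intro norm_triangle_le_diff add_mono) (simp_all add: norm_scaleC)
  finally have "norm a * norm a \<le> (2 * norm u) * norm a" by (simp add: power2_eq_square algebra_simps)
  then show ?thesis unfolding a_def[symmetric]
    by (cases "a = 0") auto
qed

lemma norm_in_unitization [simp]: "norm (in_unitization a) = norm (a::'a::cstar_algebra)"
proof (rule antisym)
  show "norm (in_unitization a) \<le> norm a"
    by (rule norm_unitization_le) (simp_all add: in_unitization_def act_def norm_mult_ineq)
  have "norm a * norm a = norm (a * star a)" using cstar_identity[of "star a"] by (simp add: star_star power2_eq_square)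
  also have "a * star a = act (in_unitization a) (star a)" by (simp add: act_def in_unitization_def)
  also have "norm \<dots> \<le> norm (in_unitization a) * norm a" using norm_act_le[of _ "star a"] by simp
  finally show "norm a \<le> norm (in_unitization a)" by (cases "a = 0") auto
qed

instance unitization :: (cstar_algebra) real_normed_algebra_1
proof
  fix x y :: "'a unitization" and r :: real
  show "r *\<^sub>R x * y = r *\<^sub>R (x * y)" "x * r *\<^sub>R y = r *\<^sub>R (x * y)"
    by (simp_all add: unitization_eq_iff algebra_simps scaleC_scaleC flip: scaleC_of_real)
       (simp_all add: scaleC_of_real scaleC_scaleC mult_scaleC_left mult_scaleC_right scaleC_add_right flip: scaleC_of_real)
  show "norm (x * y) \<le> norm x * norm y"
  proof (rule norm_unitization_le)
    show "cmod (scalar_part (x * y)) \<le> norm x * norm y"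
      by (simp add: norm_mult mult_mono cmod_scalar_part_le)
    show "norm (act (x * y) b) \<le> norm x * norm y * norm b" for b
      using norm_act_le[of x "act y b"] mult_left_mono[OF norm_act_le[of y b], of "norm x"]
      by (simp add: act_simps mult.assoc)
  qed
  show "norm (1 :: 'a unitization) = 1"
  proof (rule antisym)
    show "norm (1 :: 'a unitization) \<le> 1" by (rule norm_unitization_le) (simp_all add: act_simps)
    show "1 \<le> norm (1 :: 'a unitization)" using cmod_scalar_part_le[of "1 :: 'a unitization"] by simp
  qed
qed

lemma norm_unitization_le_sum: "norm u \<le> norm (elem_part u) + cmod (scalar_part u)"
proof (rule norm_unitization_le)
  show "norm (act u b) \<le> (norm (elem_part u) + cmod (scalar_part u)) * norm b" for b
    unfolding act_def distrib_right
    by (intro norm_triangle_le add_mono norm_mult_ineq) (simp add: norm_scaleC)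
qed simp

instance unitization :: (cstar_algebra) banach
proof
  fix X :: "nat \<Rightarrow> 'a unitization"
  assume X: "Cauchy X"
  have e: "Cauchy (\<lambda>n. elem_part (X n))"
  proof (rule metric_CauchyI)
    fix e :: real assume "e > 0"
    then obtain M where M: "\<And>m n. m \<ge> M \<Longrightarrow> n \<ge> M \<Longrightarrow> norm (X m - X n) < e/2"
      using CauchyD[OF X, of "e/2"] by auto
    have "dist (elem_part (X m)) (elem_part (X n)) < e" if "m \<ge> M" "n \<ge> M" for m n
      using norm_elem_part_le[of "X m - X n"] M[OF that] by (simp add: dist_norm)
    then show "\<exists>M. \<forall>m\<ge>M. \<forall>n\<ge>M. dist (elem_part (X m)) (elem_part (X n)) < e" by blast
  qed
  have s: "Cauchy (\<lambda>n. scalar_part (X n))"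
  proof (rule metric_CauchyI)
    fix e :: real assume "e > 0"
    then obtain M where M: "\<And>m n. m \<ge> M \<Longrightarrow> n \<ge> M \<Longrightarrow> norm (X m - X n) < e"
      using CauchyD[OF X, of e] by auto
    have "dist (scalar_part (X m)) (scalar_part (X n)) < e" if "m \<ge> M" "n \<ge> M" for m n
      using cmod_scalar_part_le[of "X m - X n"] M[OF that] by (simp add: dist_norm)
    then show "\<exists>M. \<forall>m\<ge>M. \<forall>n\<ge>M. dist (scalar_part (X m)) (scalar_part (X n)) < e" by blast
  qed
  obtain a where a: "(\<lambda>n. elem_part (X n)) \<longlonglongrightarrow> a" using e Cauchy_convergent_iff convergentD by blast
  obtain c where c: "(\<lambda>n. scalar_part (X n)) \<longlonglongrightarrow> c" using s Cauchy_convergent_iff convergentD by blast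
  have "(\<lambda>n. norm (elem_part (X n) - a) + norm (scalar_part (X n) - c)) \<longlonglongrightarrow> 0"
    using tendsto_add[OF tendsto_norm_zero[OF LIM_zero[OF a]] tendsto_norm_zero[OF LIM_zero[OF c]]] by simp
  then have "(\<lambda>n. norm (X n - Unitization a c)) \<longlonglongrightarrow> 0"
    by (rule Lim_null_comparison[rotated]) (use norm_unitization_le_sum[of "X _ - Unitization a c"] in simp)
  then have "X \<longlonglongrightarrow> Unitization a c" using LIM_zero_iff tendsto_norm_zero_iff by blast
  then show "convergent X" by (rule convergentI)
qed

instantiation unitization :: (cstar_algebra) unital_cstar_algebra
begin

definition "star u = Unitization (star (elem_part u)) (cnj (scalar_part u))"

instance
proof
  fix c :: complex and x y :: "'a unitization"
  show "c *\<^sub>C x * y = c *\<^sub>C (x * y)" "x * c *\<^sub>C y = c *\<^sub>C (x * y)"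
    by (simp_all add: unitization_eq_iff mult_scaleC_left mult_scaleC_right scaleC_add_right scaleC_scaleC algebra_simps)
  have act_star: "star (act u b) * b' = star b * act (star u) b'" for u :: "'a unitization" and b b'
    by (simp add: act_def star_unitization_def star_add star_mult star_scaleC algebra_simps mult_scaleC_left mult_scaleC_right)
  have le: "norm (c *\<^sub>C x) \<le> cmod c * norm x" for c and x :: "'a unitization"
    by (rule norm_unitization_le)
       (use mult_left_mono[OF norm_act_le, of "cmod c"] in
         \<open>simp_all add: norm_mult cmod_scalar_part_le mult_left_mono act_simps norm_scaleC mult.assoc\<close>)
  show "norm (c *\<^sub>C x) = cmod c * norm x"
  proof (cases "c = 0")
    case False
    have "norm (inverse c *\<^sub>C (c *\<^sub>C x)) \<le> cmod (inverse c) * norm (c *\<^sub>C x)" by (rule le)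
    then have "norm x \<le> norm (c *\<^sub>C x) / cmod c"
      using False by (simp add: scaleC_scaleC norm_inverse divide_inverse mult.commute)
    then have "cmod c * norm x \<le> norm (c *\<^sub>C x)" using False by (simp add: field_simps)
    with le[of c x] show ?thesis by simp
  qed simp
  show "star (x + y) = star x + star y" "star (c *\<^sub>C x) = cnj c *\<^sub>C star x" "star (x * y) = star y * star x"
    "star (star x) = x"
    by (simp_all add: star_unitization_def unitization_eq_iff star_add star_scaleC star_mult star_star algebra_simps)
  have lower: "(norm u)\<^sup>2 \<le> norm (star u * u)" for u :: "'a unitization"
  proof -
    define K where "K = norm (star u * u)"
    have K: "K \<ge> 0" by (simp add: K_def)
    have "norm u \<le> sqrt K"
    proof (rule norm_unitization_le)
      have "(cmod (scalar_part u))\<^sup>2 \<le> K"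
        using cmod_scalar_part_le[of "star u * u"] unfolding K_def
        by (simp add: star_unitization_def norm_mult power2_eq_square)
      then show "cmod (scalar_part u) \<le> sqrt K" by (rule real_le_rsqrt)
      fix b
      have "(norm (act u b))\<^sup>2 = norm (star b * act (star u * u) b)"
        by (simp add: cstar_identity[symmetric] act_star act_simps)
      also have "\<dots> \<le> norm b * (K * norm b)"
        using norm_mult_ineq[of "star b"] mult_left_mono[OF norm_act_le[of "star u * u" b], of "norm b"]
        unfolding K_def by (metis norm_star norm_ge_zero order_trans)
      also have "\<dots> = (sqrt K * norm b)\<^sup>2" using K by (simp add: power2_eq_square algebra_simps)
      finally show "norm (act u b) \<le> sqrt K * norm b" using K by (simp add: power2_le_iff_abs_le)
    qed
    then have "(norm u)\<^sup>2 \<le> (sqrt K)\<^sup>2" by (intro power_mono) simp_all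
    then show ?thesis using K by (simp add: K_def)
  qed
  have norm_star_le: "norm u \<le> norm (star u)" for u :: "'a unitization"
  proof (cases "u = 0")
    case False
    have "norm u * norm u \<le> norm (star u) * norm u"
      using lower[of u] norm_mult_ineq[of "star u" u] by (simp add: power2_eq_square)
    then show ?thesis using False by simp
  qed simp
  have "norm (star x) \<le> norm x" using norm_star_le[of "star x"] by (simp add: star_unitization_def star_star)
  then have "norm (star x * x) \<le> (norm x)\<^sup>2"
    using norm_mult_ineq[of "star x" x] mult_right_mono[of "norm (star x)" "norm x" "norm x"]
    by (simp add: power2_eq_square)
  then show "norm (star x * x) = (norm x)\<^sup>2" using lower[of x] by simp
qed

end

section \<open>Functions vanishing at zero\<close>

lemma in_unitization_simps:
  "in_unitization (a + b) = in_unitization a + in_unitization (b::'a::cstar_algebra)"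
  "in_unitization (a - b) = in_unitization a - in_unitization b"
  "in_unitization (a * b) = in_unitization a * in_unitization b"
  "in_unitization (star a) = star (in_unitization a)"
  "in_unitization (r *\<^sub>R a) = r *\<^sub>R in_unitization a"
  "in_unitization (c *\<^sub>C a) = c *\<^sub>C in_unitization a"
  "in_unitization (0::'a) = 0"
  by (simp_all add: in_unitization_def unitization_eq_iff star_unitization_def)

lemma in_unitization_inject [simp]: "in_unitization a = in_unitization b \<longleftrightarrow> a = b"
  by (simp add: in_unitization_def)

lemma elem_part_in_unitization [simp]: "elem_part (in_unitization a) = a"
  and scalar_part_in_unitization [simp]: "scalar_part (in_unitization a) = 0"
  by (simp_all add: in_unitization_def)

lemma in_unitization_act: "in_unitization (act u b) = u * in_unitization b"
  by (simp add: act_def unitization_eq_iff)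

lemma scalar_part_poly_at: "scalar_part (poly_at (in_unitization a) p) = of_real (poly p 0)"
  by (cases p) simp

lemma bounded_linear_scalar_part: "bounded_linear (scalar_part :: 'a::cstar_algebra unitization \<Rightarrow> complex)"
  by (rule bounded_linear_intro[where K = 1]) (simp_all add: cmod_scalar_part_le scaleR_conv_of_real[where 'a = complex])

text \<open>
  The scalar part is a continuous character that maps \<open>a\<close> to \<open>0\<close>, hence \<open>f(a)\<close> to \<open>f(0)\<close>.
\<close>
lemma scalar_part_cfc:
  fixes a :: "'a::cstar_algebra"
  assumes "star a = a" "continuous_on UNIV f"
  shows "scalar_part (cfc (in_unitization a) f) = of_real (f 0)"
proof -
  have sa: "star (in_unitization a) = in_unitization a" by (simp add: assms flip: in_unitization_simps)
  obtain P R where P: "uniform_limit {-R..R} (\<lambda>n. poly (P n)) f sequentially"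
      "R \<ge> norm (in_unitization a) + 1" using cfc_approx[OF assms(2)] .
  have "(\<lambda>n. scalar_part (poly_at (in_unitization a) (P n))) \<longlonglongrightarrow> scalar_part (cfc (in_unitization a) f)"
    by (intro bounded_linear.tendsto[OF bounded_linear_scalar_part] cfc_LIMSEQ[OF sa P])
  moreover have "(\<lambda>n. of_real (poly (P n) 0) :: complex) \<longlonglongrightarrow> of_real (f 0)"
    using tendsto_uniform_limitI[OF P(1), of 0] order_trans[OF norm_ge_zero P(2)[THEN order_trans[rotated]]] P(2) norm_ge_zero[of "in_unitization a"]
    by (intro tendsto_intros) auto
  ultimately show ?thesis using LIMSEQ_unique by (simp add: scalar_part_poly_at)
qed

text \<open>
  For \<open>f 0 = 0\<close> the scalar part of \<open>f(a)\<close> vanishes, and \<open>f(a)\<close> is an element of the algebra itself.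
\<close>
definition cfc0 :: "'a::cstar_algebra \<Rightarrow> (real \<Rightarrow> real) \<Rightarrow> 'a"
  where "cfc0 a f = elem_part (cfc (in_unitization a) f)"

locale selfadjoint =
  fixes a :: "'a::cstar_algebra"
  assumes selfadjoint: "star a = a"
begin

lemma selfadjoint_in_unitization: "star (in_unitization a) = in_unitization a"
  by (simp add: selfadjoint flip: in_unitization_simps)

lemma in_unitization_cfc0:
  "continuous_on UNIV f \<Longrightarrow> f 0 = 0 \<Longrightarrow> in_unitization (cfc0 a f) = cfc (in_unitization a) f"
  by (simp add: unitization_eq_iff cfc0_def scalar_part_cfc selfadjoint)

lemma cfc0_mult:
  assumes "continuous_on UNIV f" "f 0 = 0" "continuous_on UNIV g" "g 0 = 0"
  shows "cfc0 a (\<lambda>t. f t * g t) = cfc0 a f * cfc0 a g"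
proof -
  have "in_unitization (cfc0 a (\<lambda>t. f t * g t)) = in_unitization (cfc0 a f * cfc0 a g)"
    using assms by (simp add: in_unitization_cfc0 continuous_on_mult in_unitization_simps
        cfc_mult selfadjoint_in_unitization)
  then show ?thesis by simp
qed

lemma cfc0_diff:
  assumes "continuous_on UNIV f" "f 0 = 0" "continuous_on UNIV g" "g 0 = 0"
  shows "cfc0 a (\<lambda>t. f t - g t) = cfc0 a f - cfc0 a g"
proof -
  have "in_unitization (cfc0 a (\<lambda>t. f t - g t)) = in_unitization (cfc0 a f - cfc0 a g)"
    using assms by (simp add: in_unitization_cfc0 continuous_on_diff in_unitization_simps
        cfc_diff selfadjoint_in_unitization)
  then show ?thesis by simp
qed

lemma cfc0_id: "cfc0 a (\<lambda>t. t) = a"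
  by (simp add: cfc0_def cfc_id selfadjoint_in_unitization)

lemma star_cfc0:
  assumes "continuous_on UNIV f" "f 0 = 0"
  shows "star (cfc0 a f) = cfc0 a f"
proof -
  have "in_unitization (star (cfc0 a f)) = in_unitization (cfc0 a f)"
    using assms by (simp add: in_unitization_cfc0 in_unitization_simps star_cfc selfadjoint_in_unitization)
  then show ?thesis by simp
qed

lemma norm_diff_cfc0_le:
  assumes "continuous_on UNIV f" "f 0 = 0" "\<And>t. \<bar>t - f t\<bar> \<le> M"
  shows "norm (a - cfc0 a f) \<le> M"
proof -
  have "in_unitization (a - cfc0 a f) = cfc (in_unitization a) (\<lambda>t. t - f t)"
    using assms by (simp add: in_unitization_simps in_unitization_cfc0 cfc_diff cfc_id selfadjoint_in_unitization)
  then have "norm (a - cfc0 a f) = norm (cfc (in_unitization a) (\<lambda>t. t - f t))"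
    by (metis norm_in_unitization)
  also have "\<dots> \<le> M"
    using assms by (intro norm_cfc_le) (auto simp: selfadjoint_in_unitization intro: continuous_intros)
  finally show ?thesis .
qed

lemma cfc0_intertwine:
  assumes "star c = c" "x * a = c * x" "continuous_on UNIV f" "f 0 = 0"
  shows "x * cfc0 a f = cfc0 c f * x"
proof -
  interpret c: selfadjoint c by standard fact
  have "in_unitization x * cfc (in_unitization a) f = cfc (in_unitization c) f * in_unitization x"
    using assms(2,3) by (intro cfc_intertwine selfadjoint_in_unitization c.selfadjoint_in_unitization)
       (simp_all flip: in_unitization_simps)
  then have "in_unitization (x * cfc0 a f) = in_unitization (cfc0 c f * x)"
    using assms by (simp add: in_unitization_simps in_unitization_cfc0 c.in_unitization_cfc0)
  then show ?thesis by simp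
qed

end

lemma poly_at_scalar: "poly_at (r *\<^sub>R 1) p = poly p r *\<^sub>R 1"
  by (induction p) (simp_all add: algebra_simps)

lemma cfc_scalar:
  assumes "continuous_on UNIV f"
  shows "cfc (r *\<^sub>R 1 :: 'a::unital_cstar_algebra) f = f r *\<^sub>R 1"
proof -
  obtain P R where P: "uniform_limit {-R..R} (\<lambda>n. poly (P n)) f sequentially"
      "R \<ge> norm (r *\<^sub>R 1 :: 'a) + 1" using cfc_approx[OF assms] .
  have "(\<lambda>n. poly_at (r *\<^sub>R 1 :: 'a) (P n)) \<longlonglongrightarrow> cfc (r *\<^sub>R 1 :: 'a) f"
    by (intro cfc_LIMSEQ[OF _ P]) (simp add: star_scaleR)
  moreover have "(\<lambda>n. poly (P n) r *\<^sub>R (1::'a)) \<longlonglongrightarrow> f r *\<^sub>R 1"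
    using tendsto_uniform_limitI[OF P(1), of r] P(2) abs_ge_self[of r] abs_ge_minus_self[of r]
    by (intro tendsto_intros) auto
  ultimately show ?thesis using LIMSEQ_unique by (simp add: poly_at_scalar)
qed

context selfadjoint begin

lemma cfc0_eigen_right:
  assumes "x * a = r *\<^sub>R x" "continuous_on UNIV f" "f 0 = 0"
  shows "x * cfc0 a f = f r *\<^sub>R x"
proof -
  have "in_unitization x * cfc (in_unitization a) f = cfc (r *\<^sub>R 1) f * in_unitization x"
    using assms(1,2) by (intro cfc_intertwine selfadjoint_in_unitization)
      (simp_all add: star_scaleR flip: in_unitization_simps)
  then have "in_unitization (x * cfc0 a f) = in_unitization (f r *\<^sub>R x)"
    using assms by (simp add: in_unitization_simps in_unitization_cfc0 cfc_scalar)
  then show ?thesis by simp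
qed

lemma cfc0_eigen_left:
  assumes "a * x = r *\<^sub>R x" "continuous_on UNIV f" "f 0 = 0"
  shows "cfc0 a f * x = f r *\<^sub>R x"
proof -
  have "star x * a = star (a * x)" by (simp add: star_mult selfadjoint)
  also have "\<dots> = r *\<^sub>R star x" by (simp add: assms(1) star_scaleR)
  finally have "star x * cfc0 a f = f r *\<^sub>R star x" by (rule cfc0_eigen_right) (use assms in auto)
  from arg_cong[OF this, of star] show ?thesis
    using assms by (simp add: star_mult star_cfc0 star_scaleR star_star)
qed

end

lemma selfadjoint_star_mult: "selfadjoint (star z * z)"
  by standard (simp add: star_mult star_star)

text \<open>
  By the C*-identity the square of the left-hand side is the norm of \<open>t h(t)\<^sup>2\<close> evaluated at \<open>z* z\<close>.
  The hypothesis ranges over all real \<open>t\<close> because the spectrum of \<open>z* z\<close> is located only up to its norm.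
\<close>
lemma norm_mult_cfc_le:
  fixes z :: "'a::cstar_algebra"
  assumes "continuous_on UNIV h" "\<And>t. \<bar>t\<bar> * (h t)\<^sup>2 \<le> M"
  shows "norm (in_unitization z * cfc (in_unitization (star z * z)) h) \<le> sqrt M"
proof -
  interpret selfadjoint "star z * z" by (rule selfadjoint_star_mult)
  let ?p = "in_unitization (star z * z)"
  note sa = selfadjoint_in_unitization
  have "star (in_unitization z * cfc ?p h) * (in_unitization z * cfc ?p h) = cfc ?p h * (?p * cfc ?p h)"
    unfolding star_mult star_cfc[OF sa assms(1)] unfolding in_unitization_simps mult.assoc ..
  also have "\<dots> = cfc ?p h * (cfc ?p (\<lambda>t. t) * cfc ?p h)" by (simp only: cfc_id[OF sa])
  also have "\<dots> = cfc ?p (\<lambda>t. h t * (t * h t))"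
    using assms(1) by (simp add: cfc_mult sa continuous_on_mult continuous_on_id)
  also have "norm \<dots> \<le> M"
  proof (rule norm_cfc_le[OF sa])
    show "continuous_on UNIV (\<lambda>t. h t * (t * h t))" using assms(1) by (intro continuous_intros)
    show "\<bar>h t * (t * h t)\<bar> \<le> M" for t using assms(2)[of t] by (simp add: abs_mult power2_eq_square ac_simps)
  qed
  finally show ?thesis unfolding cstar_identity by (rule real_le_rsqrt)
qed

lemma norm_mult_cfc0_le:
  assumes "continuous_on UNIV h" "h 0 = 0" "\<And>t. \<bar>t\<bar> * (h t)\<^sup>2 \<le> M"
  shows "norm (z * cfc0 (star z * z) h) \<le> sqrt M"
proof -
  have "in_unitization (z * cfc0 (star z * z) h) = in_unitization z * cfc (in_unitization (star z * z)) h"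
    unfolding in_unitization_simps(3)[of z "cfc0 (star z * z) h"]
    by (simp only: selfadjoint.in_unitization_cfc0[OF selfadjoint_star_mult assms(1,2)])
  then have "norm (z * cfc0 (star z * z) h) = norm (in_unitization z * cfc (in_unitization (star z * z)) h)"
    by (metis norm_in_unitization)
  also have "\<dots> \<le> sqrt M" by (intro norm_mult_cfc_le assms)
  finally show ?thesis .
qed

lemma norm_diff_mult_cfc0_le:
  assumes "continuous_on UNIV g" "g 0 = 0" "\<And>t. \<bar>t\<bar> * (1 - g t)\<^sup>2 \<le> M"
  shows "norm (z - z * cfc0 (star z * z) g) \<le> sqrt M"
proof -
  interpret selfadjoint "star z * z" by (rule selfadjoint_star_mult)
  let ?p = "in_unitization (star z * z)"
  have "cfc ?p (\<lambda>t. 1 - g t) = 1 - cfc ?p g"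
    using cfc_diff[OF selfadjoint_in_unitization, of "\<lambda>_. 1" g] assms(1)
    by (simp add: cfc_const selfadjoint_in_unitization)
  then have "in_unitization (z - z * cfc0 (star z * z) g) = in_unitization z * cfc ?p (\<lambda>t. 1 - g t)"
    using assms by (simp add: in_unitization_simps(2,3) in_unitization_cfc0 right_diff_distrib)
  then have "norm (z - z * cfc0 (star z * z) g) = norm (in_unitization z * cfc ?p (\<lambda>t. 1 - g t))"
    by (metis norm_in_unitization)
  also have "\<dots> \<le> sqrt M"
    using assms by (intro norm_mult_cfc_le continuous_intros) auto
  finally show ?thesis .
qed

section \<open>Cutoffs\<close>

text \<open>
  The function vanishes for \<open>\<bar>t\<bar> \<le> e\<close>, equals \<open>1\<close> for \<open>\<bar>t\<bar> \<ge> 2 e\<close>, and is even, matching the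
  weight \<open>\<bar>t\<bar>\<close> in the norm estimates for \<open>z h(z* z)\<close>. A cutoff with parameter \<open>e\<close> is a local unit
  for one with parameter at least \<open>2 e\<close>.
\<close>
definition cutoff :: "real \<Rightarrow> real \<Rightarrow> real"
  where "cutoff e t = min 1 (max 0 ((\<bar>t\<bar> - e) / e))"

lemma continuous_cutoff: "e > 0 \<Longrightarrow> continuous_on UNIV (cutoff e)"
  unfolding cutoff_def[abs_def] by (intro continuous_intros) auto

lemma cutoff_bounds: "0 \<le> cutoff e t" "cutoff e t \<le> 1"
  by (auto simp: cutoff_def)

lemma cutoff_eq_0: "e > 0 \<Longrightarrow> \<bar>t\<bar> \<le> e \<Longrightarrow> cutoff e t = 0"
  by (simp add: cutoff_def divide_nonpos_pos max_absorb1)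

lemma cutoff_eq_1: "e > 0 \<Longrightarrow> \<bar>t\<bar> \<ge> 2 * e \<Longrightarrow> cutoff e t = 1"
  by (simp add: cutoff_def le_divide_eq min_absorb1 max.coboundedI2)

lemma cutoff_0 [simp]: "e > 0 \<Longrightarrow> cutoff e 0 = 0"
  by (simp add: cutoff_eq_0)

lemma cutoff_mult:
  assumes "e > 0" "d \<ge> 2 * e"
  shows "cutoff e t * cutoff d t = cutoff d t"
  using assms cutoff_eq_1[of e t] cutoff_eq_0[of d t] by (cases "\<bar>t\<bar> \<ge> 2 * e") auto

lemma cutoff_approx:
  assumes "e > 0"
  shows "\<bar>t\<bar> * (1 - cutoff e t)\<^sup>2 \<le> 2 * e" and "\<bar>t - t * cutoff e t\<bar> \<le> 2 * e"
proof -
  have *: "\<bar>t\<bar> * (1 - cutoff e t) \<le> 2 * e" 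
  proof (cases "\<bar>t\<bar> \<ge> 2 * e")
    case False
    then show ?thesis using mult_mono[of "\<bar>t\<bar>" "2 * e" "1 - cutoff e t" 1] cutoff_bounds[of e t] assms by simp
  qed (use cutoff_eq_1[of e t] assms in simp)
  have "(1 - cutoff e t)\<^sup>2 \<le> 1 - cutoff e t"
    using cutoff_bounds[of e t] mult_left_le[of "1 - cutoff e t" "1 - cutoff e t"] by (simp add: power2_eq_square)
  then have "\<bar>t\<bar> * (1 - cutoff e t)\<^sup>2 \<le> \<bar>t\<bar> * (1 - cutoff e t)" by (rule mult_left_mono) simp
  with * show "\<bar>t\<bar> * (1 - cutoff e t)\<^sup>2 \<le> 2 * e" by simp
  have "\<bar>t - t * cutoff e t\<bar> = \<bar>t\<bar> * (1 - cutoff e t)"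
    using cutoff_bounds[of e t] by (simp add: abs_mult flip: right_diff_distrib[of t 1, simplified])
  with * show "\<bar>t - t * cutoff e t\<bar> \<le> 2 * e" by simp
qed

lemma (in selfadjoint) cfc0_cutoff_mult:
  assumes "e > 0" "d \<ge> 2 * e"
  shows "cfc0 a (cutoff e) * cfc0 a (cutoff d) = cfc0 a (cutoff d)"
    "cfc0 a (cutoff d) * cfc0 a (cutoff e) = cfc0 a (cutoff d)"
proof -
  have d: "d > 0" using assms by simp
  show "cfc0 a (cutoff e) * cfc0 a (cutoff d) = cfc0 a (cutoff d)"
    using assms d by (subst cfc0_mult[symmetric]) (simp_all add: continuous_cutoff cutoff_mult)
  show "cfc0 a (cutoff d) * cfc0 a (cutoff e) = cfc0 a (cutoff d)"
    using assms d by (subst cfc0_mult[symmetric]) (simp_all add: continuous_cutoff cutoff_mult mult.commute[of "cutoff d _"])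
qed

section \<open>Positive elements\<close>

text \<open>
  If \<open>c\<close> is not a nonnegative real number, then \<open>d(t) = \<bar>t\<^sup>2 - c\<bar>\<^sup>2\<close> has no real zero. The product of
  \<open>h\<^sup>2 - c\<close> and \<open>h\<^sup>2 - cnj c\<close> is \<open>d(h)\<close>, so \<open>(h\<^sup>2 - cnj c) (1/d)(h)\<close> inverts \<open>h\<^sup>2 - c\<close>.
\<close>
lemma square_in_positives:
  fixes h :: "'a::cstar_algebra"
  assumes "star h = h"
  shows "h * h \<in> positives"
proof -
  interpret selfadjoint h by standard fact
  note sa = selfadjoint_in_unitization
  let ?u = "in_unitization h"
  have "c \<in> complex_of_real ` {0..}" if c: "c \<in> spectrum (h * h)" for c
  proof (rule ccontr)
    assume nc: "c \<notin> complex_of_real ` {0..}"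
    define d where "d = (\<lambda>t::real. (t * t - Re c) * (t * t - Re c) + Im c * Im c)"
    have d: "d t \<noteq> 0" for t
    proof
      assume "d t = 0"
      then have "Im c = 0" "t * t = Re c"
        unfolding d_def by (simp_all add: sum_squares_eq_zero_iff)
      then have "c = complex_of_real (t * t)" by (simp add: complex_eq_iff)
      moreover have "0 \<le> t * t" by (rule zero_le_square)
      ultimately have "c = complex_of_real (t * t)" "0 \<le> t * t" by blast+
      then show False using nc by blast
    qed
    have cd: "continuous_on UNIV d" unfolding d_def by (intro continuous_intros)
    define w where "w = cfc ?u (\<lambda>t. inverse (d t))"
    have cw: "continuous_on UNIV (\<lambda>t. inverse (d t))" using cd d by (intro continuous_intros) auto
    define x where "x = ?u * ?u - Unitization 0 c"
    define y where "y = ?u * ?u - Unitization 0 (cnj c)"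
    have C: "Unitization 0 z = z *\<^sub>C 1" for z :: complex by (simp add: unitization_eq_iff)
    have "x * y = ?u * ?u * (?u * ?u) - (c + cnj c) *\<^sub>C (?u * ?u) + (c * cnj c) *\<^sub>C 1"
      unfolding x_def y_def C
      by (simp add: algebra_simps mult_scaleC_left mult_scaleC_right scaleC_scaleC scaleC_add_left)
    also have "\<dots> = ?u * ?u * (?u * ?u) - (2 * Re c) *\<^sub>R (?u * ?u) + (Re c * Re c + Im c * Im c) *\<^sub>R 1"
      by (simp add: complex_add_cnj complex_mult_cnj power2_eq_square flip: scaleC_of_real)
    also have "\<dots> = cfc ?u (poly [:Re c * Re c + Im c * Im c, 0, - 2 * Re c, 0, 1:])"
      unfolding cfc_poly[OF sa] by (simp add: algebra_simps)
    also have "poly [:Re c * Re c + Im c * Im c, 0, - 2 * Re c, 0, 1:] = d"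
      unfolding d_def by (auto simp: algebra_simps)
    finally have xy: "x * y = cfc ?u d" .
    have yx: "y * x = x * y"
      unfolding x_def y_def C
      by (simp add: algebra_simps mult_scaleC_left mult_scaleC_right scaleC_scaleC)
    have 1: "cfc ?u d * w = 1"
      unfolding w_def using cfc_mult[OF sa cd cw] d cfc_const[OF sa, of 1] by simp
    have 2: "w * cfc ?u d = 1"
      unfolding w_def using cfc_mult[OF sa cw cd] d cfc_const[OF sa, of 1] by simp
    have r: "x * (y * w) = 1" using 1 by (simp add: xy flip: mult.assoc)
    have l: "(w * y) * x = 1" using 2 by (simp add: xy yx mult.assoc)
    have "w * y = (w * y) * (x * (y * w))" unfolding r by simp
    also have "\<dots> = ((w * y) * x) * (y * w)" by (simp only: mult.assoc)
    finally have "w * y = y * w" unfolding l by simp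
    with r l have "c \<notin> spectrum (h * h)"
      unfolding spectrum_def x_def in_unitization_simps by auto
    with c show False by simp
  qed
  then show ?thesis unfolding positives_def by (auto simp: star_mult assms)
qed

lemma positives_selfadjoint: "a \<in> positives \<Longrightarrow> star a = a"
  by (simp add: positives_def)

lemma (in selfadjoint) cfc0_cutoff_in_positives:
  assumes "e > 0"
  shows "cfc0 a (cutoff e) \<in> positives"
proof -
  let ?r = "\<lambda>t. sqrt (cutoff e t)"
  have r: "continuous_on UNIV ?r" "?r 0 = 0"
    using assms by (auto intro!: continuous_intros continuous_cutoff)
  have "(\<lambda>t. ?r t * ?r t) = cutoff e" using cutoff_bounds[of e] by auto
  then have "cfc0 a (cutoff e) = cfc0 a ?r * cfc0 a ?r"
    using cfc0_mult[OF r r] by simp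
  then show ?thesis using square_in_positives[OF star_cfc0[OF r]] by simp
qed

section \<open>Ideals\<close>

lemma ideal_zero: "two_sided_ideal I \<Longrightarrow> 0 \<in> I"
  and ideal_add: "two_sided_ideal I \<Longrightarrow> x \<in> I \<Longrightarrow> y \<in> I \<Longrightarrow> x + y \<in> I"
  and ideal_scale: "two_sided_ideal I \<Longrightarrow> x \<in> I \<Longrightarrow> c *\<^sub>C x \<in> I"
  and ideal_left: "two_sided_ideal I \<Longrightarrow> x \<in> I \<Longrightarrow> a * x \<in> I"
  and ideal_right: "two_sided_ideal I \<Longrightarrow> x \<in> I \<Longrightarrow> x * a \<in> I"
  by (auto simp: two_sided_ideal_def complex_vector.subspace_0 complex_vector.subspace_add
      complex_vector.subspace_scale)

lemma ideal_act: "two_sided_ideal I \<Longrightarrow> x \<in> I \<Longrightarrow> act u x \<in> I"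
  by (simp add: act_def ideal_add ideal_left ideal_scale)

lemma mult_left_in_cspan:
  fixes a :: "'a::cstar_algebra"
  assumes "\<And>s. s \<in> S \<Longrightarrow> a * s \<in> cspan T" "x \<in> cspan S"
  shows "a * x \<in> cspan T"
  using assms(2)
proof (induction rule: complex_vector.span_induct_alt)
  case base
  show ?case by (simp add: complex_vector.span_zero)
next
  case (step c x y)
  then show ?case using assms(1)
    by (simp add: distrib_left mult_scaleC_right complex_vector.span_add complex_vector.span_scale)
qed

lemma mult_right_in_cspan:
  fixes a :: "'a::cstar_algebra"
  assumes "\<And>s. s \<in> S \<Longrightarrow> s * a \<in> cspan T" "x \<in> cspan S"
  shows "x * a \<in> cspan T"
  using assms(2)
proof (induction rule: complex_vector.span_induct_alt)
  case base
  show ?case by (simp add: complex_vector.span_zero)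
next
  case (step c x y)
  then show ?case using assms(1)
    by (simp add: distrib_right mult_scaleC_left complex_vector.span_add complex_vector.span_scale)
qed

lemma ideal_cspan:
  assumes "\<And>a s. s \<in> S \<Longrightarrow> a * s \<in> S" "\<And>a s. s \<in> S \<Longrightarrow> s * a \<in> S"
  shows "two_sided_ideal (cspan S)"
proof -
  have "a * x \<in> cspan S" "x * a \<in> cspan S" if "x \<in> cspan S" for a x
    using that by (auto intro: mult_left_in_cspan[where S = S] mult_right_in_cspan[where S = S]
        complex_vector.span_base assms)
  then show ?thesis unfolding two_sided_ideal_def by (simp add: complex_vector.subspace_span)
qed

lemma ideal_closure:
  fixes I :: "'a::cstar_algebra set"
  assumes "two_sided_ideal I"
  shows "two_sided_ideal (closure I)"
  unfolding two_sided_ideal_def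
proof (intro conjI allI ballI complex_vector.subspaceI)
  show "0 \<in> closure I" using ideal_zero[OF assms] closure_subset by blast
next
  fix x y assume "x \<in> closure I" "y \<in> closure I"
  then obtain X Y where "\<And>n. X n \<in> I" "X \<longlonglongrightarrow> x" "\<And>n. Y n \<in> I" "Y \<longlonglongrightarrow> y"
    unfolding closure_sequential by blast
  then have "\<And>n. X n + Y n \<in> I" "(\<lambda>n. X n + Y n) \<longlonglongrightarrow> x + y"
    by (auto intro: tendsto_intros ideal_add assms)
  then show "x + y \<in> closure I" unfolding closure_sequential by (intro exI[of _ "\<lambda>n. X n + Y n"]) auto
next
  fix c x assume "x \<in> closure I"
  then obtain X where "\<And>n. X n \<in> I" "X \<longlonglongrightarrow> x" unfolding closure_sequential by blast
  then have "\<And>n. c *\<^sub>C X n \<in> I" "(\<lambda>n. c *\<^sub>C X n) \<longlonglongrightarrow> c *\<^sub>C x"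
    by (auto intro: bounded_linear.tendsto[OF bounded_linear_scaleC] ideal_scale assms)
  then show "c *\<^sub>C x \<in> closure I" unfolding closure_sequential by (intro exI[of _ "\<lambda>n. c *\<^sub>C X n"]) auto
next
  fix a x assume "x \<in> closure I"
  then obtain X where X: "\<And>n. X n \<in> I" "X \<longlonglongrightarrow> x" unfolding closure_sequential by blast
  then have "\<And>n. a * X n \<in> I" "(\<lambda>n. a * X n) \<longlonglongrightarrow> a * x" "\<And>n. X n * a \<in> I" "(\<lambda>n. X n * a) \<longlonglongrightarrow> x * a"
    by (auto intro: tendsto_intros ideal_left ideal_right assms)
  then show "a * x \<in> closure I" "x * a \<in> closure I"
    unfolding closure_sequential by (intro exI[of _ "\<lambda>n. a * X n"] exI[of _ "\<lambda>n. X n * a"]; auto)+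
qed

text \<open>
  The Neumann series \<open>v\<close> of \<open>q\<close> inverts \<open>1 - q\<close> in the unitization, so \<open>x = v (x - q x)\<close>, and ideals are stable
  under multiplication by elements of the unitization.
\<close>
lemma in_ideal_if_perturbed_fixpoint:
  fixes x q :: "'a::cstar_algebra"
  assumes I: "two_sided_ideal I" and q: "norm q < 1" and x: "x - q * x \<in> I"
  shows "x \<in> I"
proof -
  let ?q = "in_unitization q"
  have s: "summable (\<lambda>n. ?q ^ n)" by (rule complete_algebra_summable_geometric) (simp add: q)
  define v where "v = (\<Sum>n. ?q ^ n)"
  have "v = 1 + (\<Sum>n. ?q ^ Suc n)" unfolding v_def using suminf_split_head[OF s] by simp
  also have "(\<Sum>n. ?q ^ Suc n) = v * ?q"
    unfolding v_def power_Suc2 by (rule suminf_mult2[OF s, symmetric])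
  finally have "v - v * ?q = 1" by (simp only: diff_eq_eq)
  then have "in_unitization x = (v - v * ?q) * in_unitization x" by simp
  also have "\<dots> = v * in_unitization (x - q * x)" by (simp add: in_unitization_simps algebra_simps)
  also have "\<dots> = in_unitization (act v (x - q * x))" by (simp add: in_unitization_act)
  finally have "x = act v (x - q * x)" by simp
  then show ?thesis using ideal_act[OF I x, of v] by simp
qed

lemma dense_if_approximates_selfadjoint:
  fixes I :: "'a::cstar_algebra set"
  assumes I: "csubspace I" and ap: "\<And>a e. star a = a \<Longrightarrow> e > 0 \<Longrightarrow> \<exists>b\<in>I. norm (a - b) \<le> e"
  shows "closure I = UNIV"
proof -
  have "x \<in> closure I" for x
    unfolding closure_approachable
  proof (intro allI impI)
    fix e :: real assume "e > 0"
    define a where "a = (1/2) *\<^sub>R (x + star x)"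
    define b where "b = (- \<i> / 2) *\<^sub>C (x - star x)"
    have a: "star a = a" by (simp add: a_def star_scaleR star_add star_star add.commute)
    have b: "star b = b" by (simp add: b_def star_scaleC star_diff star_star complex_vector.scale_right_diff_distrib)
    have "\<i> *\<^sub>C b = (1/2) *\<^sub>R (x - star x)" by (simp add: b_def scaleC_scaleC flip: scaleC_of_real)
    then have "a + \<i> *\<^sub>C b = (1/2) *\<^sub>R (x + x)"
      unfolding a_def by (simp only: flip: scaleR_add_right) simp
    then have x: "x = a + \<i> *\<^sub>C b" by (simp add: scaleR_2[symmetric])
    obtain a' where a': "a' \<in> I" "norm (a - a') \<le> e/4" using ap[OF a, of "e/4"] \<open>e > 0\<close> by auto
    obtain b' where b': "b' \<in> I" "norm (b - b') \<le> e/4" using ap[OF b, of "e/4"] \<open>e > 0\<close> by auto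
    have "norm (x - (a' + \<i> *\<^sub>C b')) = norm ((a - a') + \<i> *\<^sub>C (b - b'))"
      unfolding x by (simp add: complex_vector.scale_right_diff_distrib algebra_simps)
    also have "\<dots> \<le> norm (a - a') + norm (b - b')"
      using norm_triangle_ineq[of "a - a'" "\<i> *\<^sub>C (b - b')"] by (simp add: norm_scaleC)
    also have "\<dots> < e" using a' b' \<open>e > 0\<close> by linarith
    finally have "dist (a' + \<i> *\<^sub>C b') x < e" by (simp add: dist_norm norm_minus_commute)
    moreover have "a' + \<i> *\<^sub>C b' \<in> I"
      using a' b' I by (simp add: complex_vector.subspace_add complex_vector.subspace_scale)
    ultimately show "\<exists>y\<in>I. dist y x < e" by blast
  qed
  then show ?thesis by blast
qed

section \<open>The Pedersen ideal\<close>

text \<open>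
  Approximate the local unit \<open>e\<close> by an \<open>e'\<close> in the ideal: \<open>x\<close> is fixed by \<open>e - e'\<close>, an element of norm
  below \<open>1\<close>, up to the term \<open>e' x\<close> of the ideal.
\<close>
lemma local_unit_in_dense_ideal:
  fixes x :: "'a::cstar_algebra"
  assumes I: "two_sided_ideal I" "closure I = UNIV" and "e * x = x"
  shows "x \<in> I"
proof -
  obtain e' where e': "e' \<in> I" "dist e' e < 1" using I(2) closure_approachable[of e I] by (metis UNIV_I zero_less_one)
  have "x - (e - e') * x = e' * x" by (simp add: left_diff_distrib assms(3))
  then have "x - (e - e') * x \<in> I" using e' by (simp add: ideal_right I)
  then show ?thesis
    by (rule in_ideal_if_perturbed_fixpoint[OF I(1), rotated]) (use e' in \<open>simp add: dist_norm norm_minus_commute\<close>)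
qed

lemma local_unit_in_Ped: "e * x = x \<Longrightarrow> x \<in> Ped"
  unfolding Ped_def using local_unit_in_dense_ideal by blast

lemma Ped_ideal: "two_sided_ideal (Ped :: 'a::cstar_algebra set)"
proof -
  have "csubspace (Ped :: 'a set)"
    unfolding Ped_def by (rule complex_vector.subspace_Inter) (auto simp: two_sided_ideal_def)
  then show ?thesis unfolding two_sided_ideal_def by (auto simp: Ped_def ideal_left ideal_right)
qed

text \<open>
  Local units come from cutoffs: \<open>b\<close> is \<open>a\<close> with the spectrum near \<open>0\<close> removed. That the local unit \<open>u\<close> has itself
  a local unit \<open>v\<close> puts both \<open>u\<close> and \<open>b\<close> into \<open>Ped\<close>.
\<close>
lemma selfadjoint_local_unit_approx:
  fixes a :: "'a::cstar_algebra"
  assumes "star a = a" "e > 0"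
  obtains b u v where "norm (a - b) \<le> e" "u * b = b" "v * u = u"
proof -
  interpret selfadjoint a by standard fact
  define d where "d = e / 2"
  have d: "d > 0" using assms by (simp add: d_def)
  define b where "b = cfc0 a (\<lambda>t. t * cutoff d t)"
  define u where "u = cfc0 a (cutoff (d/2))"
  define v where "v = cfc0 a (cutoff (d/4))"
  have c: "continuous_on UNIV (\<lambda>t. t * cutoff d t)" "continuous_on UNIV (cutoff (d/2))"
    using d by (auto intro!: continuous_intros continuous_cutoff)
  have "norm (a - b) \<le> 2 * d"
    unfolding b_def by (rule norm_diff_cfc0_le[OF c(1)]) (use cutoff_approx(2)[OF d] in auto)
  moreover have "u * b = cfc0 a (\<lambda>t. cutoff (d/2) t * (t * cutoff d t))"
    unfolding u_def b_def using d c by (subst cfc0_mult) auto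
  moreover have "(\<lambda>t. cutoff (d/2) t * (t * cutoff d t)) = (\<lambda>t. t * cutoff d t)"
  proof
    fix t show "cutoff (d/2) t * (t * cutoff d t) = t * cutoff d t"
      using cutoff_mult[of "d/2" d t] d by (simp add: mult.left_commute)
  qed
  moreover have "v * u = u" unfolding u_def v_def using d by (intro cfc0_cutoff_mult) auto
  ultimately show thesis using that[of b u v] by (simp add: d_def b_def)
qed

text \<open>
  The products span an ideal, and it is dense because it contains \<open>u b\<close> for the approximants \<open>b\<close> above.
\<close>
lemma Ped_subset_products: "(Ped :: 'a::cstar_algebra set) \<subseteq> cspan {b * c | b c. b \<in> Ped \<and> c \<in> Ped}" (is "_ \<subseteq> ?S")
proof -
  have "two_sided_ideal ?S"
  proof (rule ideal_cspan)
    fix a s :: 'a assume "s \<in> {b * c | b c. b \<in> Ped \<and> c \<in> Ped}"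
    then obtain b c where s: "s = b * c" "b \<in> Ped" "c \<in> Ped" by blast
    have "a * s = (a * b) * c" "s * a = b * (c * a)" by (simp_all add: s mult.assoc)
    then show "a * s \<in> {b * c | b c. b \<in> Ped \<and> c \<in> Ped}" "s * a \<in> {b * c | b c. b \<in> Ped \<and> c \<in> Ped}"
      using s(2,3) ideal_left[OF Ped_ideal] ideal_right[OF Ped_ideal] by blast+
  qed
  moreover have "closure ?S = UNIV"
  proof (rule dense_if_approximates_selfadjoint)
    fix a :: 'a and e :: real assume "star a = a" "e > 0"
    then obtain b u v where "norm (a - b) \<le> e" "u * b = b" "v * u = u" by (rule selfadjoint_local_unit_approx)
    moreover from this have "u * b \<in> ?S"
      by (intro complex_vector.span_base) (use local_unit_in_Ped in blast)
    ultimately show "\<exists>b\<in>?S. norm (a - b) \<le> e" by auto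
  qed (rule complex_vector.subspace_span)
  ultimately show ?thesis unfolding Ped_def by blast
qed

lemma Ped_subset: "two_sided_ideal I \<Longrightarrow> closure I = UNIV \<Longrightarrow> Ped \<subseteq> I"
  unfolding Ped_def by blast

lemma Ped_eq_UNIV_if_unital: "is_unital TYPE('a::cstar_algebra) \<Longrightarrow> (Ped :: 'a set) = UNIV"
  unfolding is_unital_def using local_unit_in_Ped by blast

section \<open>Commutators\<close>

lemma commutator_add_left: "commutator (x + y) a = commutator x a + commutator y a"
  and commutator_zero_left: "commutator 0 a = 0"
  by (simp_all add: commutator_def algebra_simps)

lemma commutator_scale_left: "commutator (c *\<^sub>C x) a = c *\<^sub>C commutator x a"
  by (simp add: commutator_def mult_scaleC_left mult_scaleC_right complex_vector.scale_right_diff_distrib)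

lemma commutator_mult_left: "commutator (x * y) a = commutator x (y * a) + commutator y (a * x)"
  by (simp add: commutator_def algebra_simps)

lemma commutator_in_commutator_span:
  "x \<in> X \<Longrightarrow> y \<in> Y \<Longrightarrow> commutator x y \<in> commutator_span X Y"
  unfolding commutator_span_def by (intro complex_vector.span_base) blast

text \<open>
  Write \<open>x\<close> as a combination of products \<open>b c\<close> and use \<open>[b c, a] = [b, c a] + [c, a b]\<close>.
\<close>
lemma commutator_Ped:
  fixes x a :: "'a::cstar_algebra"
  assumes "x \<in> Ped"
  shows "commutator x a \<in> commutator_span Ped Ped"
proof -
  have "x \<in> cspan {b * c | b c. b \<in> Ped \<and> c \<in> Ped}" using Ped_subset_products assms by blast
  then show ?thesis
  proof (induction rule: complex_vector.span_induct_alt)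
    case base
    show ?case by (simp add: commutator_zero_left commutator_span_def complex_vector.span_zero)
  next
    case (step k x y)
    then obtain b c where x: "x = b * c" "b \<in> Ped" "c \<in> Ped" by blast
    have "commutator b (c * a) \<in> commutator_span Ped Ped" "commutator c (a * b) \<in> commutator_span Ped Ped"
      using x by (auto intro!: commutator_in_commutator_span intro: ideal_right[OF Ped_ideal] ideal_left[OF Ped_ideal])
    then show ?case using step(2)
      unfolding commutator_add_left commutator_scale_left x(1) commutator_mult_left commutator_span_def
      by (intro complex_vector.span_add complex_vector.span_scale)
  qed
qed

section \<open>Compactly supported square-zero elements\<close>

lemma N2c_orthogonal:
  fixes y :: "'a::cstar_algebra"
  assumes "y * e = y" "f * y = y" "e * f = 0"
  shows "e * y = 0" "y * f = 0" "y * y = 0"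
proof -
  show 1: "e * y = 0" by (metis assms(2,3) mult.assoc mult_zero_left)
  show "y * f = 0" by (metis assms(1,3) mult.assoc mult_zero_right)
  show "y * y = 0" by (metis assms(1) 1 mult.assoc mult_zero_right)
qed

text \<open>
  All three parts of \<open>(1 + x) y (1 - x) = y + [x, y] - x y x\<close> are commutators with an entry in \<open>Ped\<close>:
  \<open>y = [y, e]\<close> and \<open>x y x = [x y, x]\<close>.
\<close>
lemma SN2c_subset_commutators:
  "(SN2c :: 'a::cstar_algebra set) \<subseteq> commutator_span Ped Ped"
proof
  fix z :: 'a assume "z \<in> SN2c"
  then obtain x y where z: "z = y + x * y - y * x - x * y * x" "x \<in> N2 \<union> {0}" "y \<in> N2c"
    unfolding SN2c_altdef by blast
  obtain e f where ef: "y * e = y" "f * y = y" "e * f = 0" using z(3) unfolding N2c_def by blast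
  have y: "y \<in> Ped" using ef(2) by (rule local_unit_in_Ped)
  have xx: "x * x = 0" using z(2) by (auto simp: N2_def)
  have "x * y * x = commutator (x * y) x"
    by (simp add: commutator_def xx flip: mult.assoc)
  moreover have "x * y - y * x = - commutator y x" by (simp add: commutator_def)
  moreover have "y = commutator y e" using ef(1) N2c_orthogonal(1)[OF ef] by (simp add: commutator_def)
  ultimately have eq: "z = commutator y e - commutator y x - commutator (x * y) x"
    unfolding z(1) by (metis (no_types, lifting) add_diff_eq diff_conv_add_uminus)
  have "commutator y e \<in> commutator_span Ped Ped" "commutator y x \<in> commutator_span Ped Ped"
    "commutator (x * y) x \<in> commutator_span Ped Ped"
    using y by (auto intro!: commutator_Ped ideal_left[OF Ped_ideal])
  then show "z \<in> commutator_span Ped Ped"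
    unfolding eq commutator_span_def by (intro complex_vector.span_diff)
qed

text \<open>
  The local units of \<open>y\<close> can be refined to chains, each member being a local unit for the one before.
  Apply cutoffs to \<open>e\<close> and \<open>f\<close>: as \<open>y e = y\<close>, a function of \<open>e\<close> with value \<open>1\<close> at \<open>1\<close> is still a local unit.
\<close>
lemma N2c_frame:
  fixes y :: "'a::cstar_algebra"
  assumes "y \<in> N2c"
  obtains e0 e1 e2 f0 f1 f2 where
    "e0 \<in> positives" "e1 \<in> positives" "e2 \<in> positives" "f0 \<in> positives" "f1 \<in> positives" "f2 \<in> positives"
    "y * e0 = y" "f0 * y = y"
    "e0 * e1 = e0" "e1 * e0 = e0" "e1 * e2 = e1" "e2 * e1 = e1"
    "f0 * f1 = f0" "f1 * f0 = f0" "f1 * f2 = f1" "f2 * f1 = f1"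
    "\<forall>i\<in>{e0, e1, e2}. \<forall>j\<in>{f0, f1, f2}. i * j = 0 \<and> j * i = 0"
proof -
  obtain e f where ef: "e \<in> positives" "f \<in> positives" "y * e = y" "f * y = y" "e * f = 0"
    using assms unfolding N2c_def by blast
  interpret e: selfadjoint e by standard (rule positives_selfadjoint[OF ef(1)])
  interpret f: selfadjoint f by standard (rule positives_selfadjoint[OF ef(2)])
  have c1: "cutoff d 1 = 1" if "d > 0" "2 * d \<le> 1" for d using cutoff_eq_1[of d 1] that by simp
  have ye: "y * cfc0 e (cutoff d) = y" if "d > 0" "2 * d \<le> 1" for d
    using e.cfc0_eigen_right[of y 1 "cutoff d"] that c1 ef(3) by (simp add: continuous_cutoff)
  have fy: "cfc0 f (cutoff d) * y = y" if "d > 0" "2 * d \<le> 1" for d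
    using f.cfc0_eigen_left[of y 1 "cutoff d"] that c1 ef(4) by (simp add: continuous_cutoff)
  have orth: "cfc0 e (cutoff d) * cfc0 f (cutoff d') = 0" if "d > 0" "d' > 0" for d d'
  proof -
    have "cfc0 e (cutoff d) * f = 0"
      using e.cfc0_eigen_left[of f 0 "cutoff d"] that ef(5) by (simp add: continuous_cutoff)
    then show ?thesis
      using f.cfc0_eigen_right[of "cfc0 e (cutoff d)" 0 "cutoff d'"] that by (simp add: continuous_cutoff)
  qed
  have orth': "cfc0 f (cutoff d') * cfc0 e (cutoff d) = 0" if "d > 0" "d' > 0" for d d'
    using arg_cong[OF orth[OF that], of star] that
    by (simp add: star_mult e.star_cfc0 f.star_cfc0 continuous_cutoff)
  show thesis
    by (rule that[of "cfc0 e (cutoff (1/2))" "cfc0 e (cutoff (1/4))" "cfc0 e (cutoff (1/8))"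
          "cfc0 f (cutoff (1/2))" "cfc0 f (cutoff (1/4))" "cfc0 f (cutoff (1/8))"])
       (use orth orth' in \<open>auto simp: ye fy e.cfc0_cutoff_mult f.cfc0_cutoff_mult
         e.cfc0_cutoff_in_positives f.cfc0_cutoff_in_positives\<close>)
qed

lemma N2cI: "y * e = y \<Longrightarrow> f * y = y \<Longrightarrow> e \<in> positives \<Longrightarrow> f \<in> positives \<Longrightarrow> e * f = 0 \<Longrightarrow> y \<in> N2c"
  unfolding N2c_def by blast

lemma N2c_scale: "y \<in> N2c \<Longrightarrow> c *\<^sub>C y \<in> N2c"
  unfolding N2c_def by (auto simp: mult_scaleC_left mult_scaleC_right)

lemma star_N2c: "y \<in> N2c \<Longrightarrow> star y \<in> N2c"
proof -
  assume "y \<in> N2c"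
  then obtain e f where ef: "e \<in> positives" "f \<in> positives" "y * e = y" "f * y = y" "e * f = 0"
    unfolding N2c_def by blast
  note sa = positives_selfadjoint[OF ef(1)] positives_selfadjoint[OF ef(2)]
  have "star y * f = star y" "e * star y = star y" "f * e = 0"
    using arg_cong[OF ef(4), of star] arg_cong[OF ef(3), of star] arg_cong[OF ef(5), of star]
    by (simp_all add: star_mult sa)
  then show ?thesis using ef(1,2) unfolding N2c_def by blast
qed

lemma square_zero_annihilator:
  fixes w :: "'a::cstar_algebra"
  assumes "w * w = 0" "continuous_on UNIV g" "g 0 = 0"
  shows "cfc0 (star w * w) g * w = 0"
proof -
  have "star w * w * w = 0 *\<^sub>R w" by (simp add: assms(1) mult.assoc)
  then show ?thesis using selfadjoint.cfc0_eigen_left[OF selfadjoint_star_mult _ assms(2,3), of w w 0] assms(3)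
    by simp
qed

text \<open>
  Cut \<open>w\<close> down to \<open>y = w r(w* w) = r(w w* ) w\<close>. Functions of \<open>w* w\<close> and of \<open>w w*\<close> serve as local units on the
  two sides, and \<open>w w = 0\<close> makes them orthogonal.
\<close>
lemma square_zero_approx_N2c:
  fixes w :: "'a::cstar_algebra"
  assumes w: "w * w = 0" and e: "e > 0"
  shows "\<exists>y\<in>N2c. norm (w - y) \<le> sqrt (2 * e)"
proof -
  define p q where "p = star w * w" and "q = w * star w"
  interpret p: selfadjoint p unfolding p_def by (rule selfadjoint_star_mult)
  interpret q: selfadjoint q unfolding q_def using selfadjoint_star_mult[of "star w"] by (simp add: star_star)
  note cont = continuous_cutoff
  define y where "y = w * cfc0 p (cutoff e)"
  define u v where "u = cfc0 p (cutoff (e/2))" and "v = cfc0 q (cutoff (e/2))"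
  have "w * p = q * w" by (simp add: p_def q_def mult.assoc)
  then have y2: "y = cfc0 q (cutoff e) * w"
    unfolding y_def using p.cfc0_intertwine[OF q.selfadjoint, of w "cutoff e"] cont e by simp
  have "y * u = y" unfolding y_def u_def using p.cfc0_cutoff_mult(2)[of "e/2" e] e by (simp add: mult.assoc)
  moreover have "v * y = y" unfolding y2 v_def using q.cfc0_cutoff_mult(1)[of "e/2" e] e by (simp flip: mult.assoc)
  moreover have "u * v = 0"
  proof -
    have "u * w = 0" unfolding u_def p_def using e by (intro square_zero_annihilator w cont) auto
    then have "u * q = 0 *\<^sub>R u" by (simp add: q_def flip: mult.assoc)
    from q.cfc0_eigen_right[OF this, of "cutoff (e/2)"] show ?thesis unfolding v_def using e cont by simp
  qed
  moreover have "u \<in> positives" "v \<in> positives"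
    unfolding u_def v_def using e by (auto intro: p.cfc0_cutoff_in_positives q.cfc0_cutoff_in_positives)
  ultimately have "y \<in> N2c" by (intro N2cI)
  moreover have "norm (w - y) \<le> sqrt (2 * e)"
    unfolding y_def p_def by (rule norm_diff_mult_cfc0_le) (use e cont cutoff_approx in auto)
  ultimately show ?thesis by blast
qed

text \<open>
  With \<open>p = w* w\<close> and \<open>k\<close> the fourth root of \<open>p\<close>, the elements \<open>w h\<^sub>n(p)\<close> for \<open>h\<^sub>n(t)\<close> approximating
  the inverse fourth root of \<open>t\<close> form a Cauchy sequence, because \<open>t\<close> times the square of that root still tends to \<open>0\<close>
  with \<open>t\<close>. The limit \<open>y\<close> satisfies \<open>w = y k\<close>. Moreover \<open>p w = 0\<close> gives \<open>k w = 0\<close> and then \<open>k y = 0\<close>.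
\<close>
lemma square_zero_is_commutator:
  fixes w :: "'a::cstar_algebra"
  assumes w: "w * w = 0"
  shows "\<exists>y k. w = commutator y k"
proof -
  define p where "p = star w * w"
  interpret selfadjoint p unfolding p_def by (rule selfadjoint_star_mult)
  define root where "root t = sqrt (sqrt \<bar>t\<bar>)" for t
  define d where "d n = 1 / real (Suc n)" for n
  \<comment> \<open>\<open>h n\<close> agrees with \<open>1 / root\<close> away from \<open>0\<close> and is bounded by it everywhere.\<close>
  define h where "h n t = cutoff (d n) t / root (max \<bar>t\<bar> (d n))" for n t
  have d: "d n > 0" for n by (simp add: d_def)
  have dmono: "d n \<le> d N" if "N \<le> n" for n N using that by (simp add: d_def frac_le)
  have root: "continuous_on UNIV root" "root 0 = 0" unfolding root_def by (auto intro!: continuous_intros)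
  have rootpos: "root t > 0" if "t \<noteq> 0" for t using that by (simp add: root_def)
  have max_d: "max \<bar>t\<bar> (d n) \<noteq> 0" for n t using d[of n] by (auto simp: max_def)
  have h: "continuous_on UNIV (h n)" "h n 0 = 0" for n
    unfolding h_def[abs_def] root_def using d[of n]
    by (auto intro!: continuous_intros continuous_on_max continuous_cutoff simp: max_d)
  have h_nonneg: "0 \<le> h n t" for n t
    unfolding h_def root_def by (intro divide_nonneg_nonneg cutoff_bounds) auto
  have h_le: "h n t * root t \<le> 1" for n t
  proof -
    have "root t \<le> root (max \<bar>t\<bar> (d n))" unfolding root_def using d[of n] by simp
    moreover have "root (max \<bar>t\<bar> (d n)) > 0" using d[of n] by (intro rootpos) auto
    moreover have "cutoff (d n) t * root t \<le> 1 * root t"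
      by (intro mult_right_mono cutoff_bounds) (simp add: root_def)
    ultimately show ?thesis unfolding h_def by (simp add: divide_le_eq)
  qed
  have h_eq: "h n t = 1 / root t" if "\<bar>t\<bar> \<ge> 2 * d n" for n t
    using that d[of n] cutoff_eq_1[of "d n" t] by (simp add: h_def max_def root_def)
  have close: "norm (w * cfc0 p (h m) - w * cfc0 p (h n)) \<le> sqrt (sqrt (2 * d N))" if "m \<ge> N" "n \<ge> N" for m n N
  proof -
    have "w * cfc0 p (h m) - w * cfc0 p (h n) = w * cfc0 p (\<lambda>t. h m t - h n t)"
      by (simp add: cfc0_diff h right_diff_distrib)
    also have "norm \<dots> \<le> sqrt (sqrt (2 * d N))"
      unfolding p_def
    proof (rule norm_mult_cfc0_le)
      show "\<bar>t\<bar> * (h m t - h n t)\<^sup>2 \<le> sqrt (2 * d N)" for t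
      proof (cases "\<bar>t\<bar> \<ge> 2 * d N")
        case True
        then have "h m t = h n t" using dmono[OF that(1)] dmono[OF that(2)] by (subst (1 2) h_eq) auto
        then show ?thesis using d[of N] by simp
      next
        case False
        have "\<bar>h m t * root t - h n t * root t\<bar> \<le> 1"
          using h_le[of m t] h_le[of n t] h_nonneg[of m t] h_nonneg[of n t]
          by (smt (verit) mult_nonneg_nonneg root_def real_sqrt_ge_zero abs_ge_zero)
        then have "(h m t * root t - h n t * root t)\<^sup>2 \<le> 1" by (simp add: abs_square_le_1)
        then have *: "sqrt \<bar>t\<bar> * (h m t - h n t)\<^sup>2 \<le> 1"
          by (simp add: root_def power_mult_distrib flip: left_diff_distrib) (simp add: mult.commute)
        have "\<bar>t\<bar> * (h m t - h n t)\<^sup>2 = sqrt \<bar>t\<bar> * (sqrt \<bar>t\<bar> * (h m t - h n t)\<^sup>2)"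
          by (simp flip: mult.assoc)
        also have "\<dots> \<le> sqrt \<bar>t\<bar> * 1" using * by (intro mult_left_mono) auto
        also have "\<dots> \<le> sqrt (2 * d N)" using False by simp
        finally show ?thesis .
      qed
    qed (use h in \<open>auto intro: continuous_intros\<close>)
    finally show ?thesis .
  qed
  have lim: "(\<lambda>n. sqrt (sqrt (2 * d n))) \<longlonglongrightarrow> 0" "(\<lambda>n. sqrt (2 * d n)) \<longlonglongrightarrow> 0"
  proof -
    have "(\<lambda>n. 2 * d n) \<longlonglongrightarrow> 2 * 0" unfolding d_def by (intro tendsto_intros LIMSEQ_Suc lim_1_over_n)
    from tendsto_real_sqrt[OF this] show "(\<lambda>n. sqrt (2 * d n)) \<longlonglongrightarrow> 0" by simp
    from tendsto_real_sqrt[OF this] show "(\<lambda>n. sqrt (sqrt (2 * d n))) \<longlonglongrightarrow> 0" by simp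
  qed
  have "Cauchy (\<lambda>n. w * cfc0 p (h n))"
  proof (rule metric_CauchyI)
    fix e :: real assume "e > 0"
    then obtain N where "norm (sqrt (sqrt (2 * d N)) - 0) < e" using LIMSEQ_D[OF lim(1), of e] by blast
    then have "sqrt (sqrt (2 * d N)) < e" by simp
    then show "\<exists>M. \<forall>m\<ge>M. \<forall>n\<ge>M. dist (w * cfc0 p (h m)) (w * cfc0 p (h n)) < e"
      using close[of N] unfolding dist_norm by (meson le_less_trans)
  qed
  then obtain y where y: "(\<lambda>n. w * cfc0 p (h n)) \<longlonglongrightarrow> y"
    using Cauchy_convergent_iff convergentD by blast
  define k where "k = cfc0 p root"
  have "norm (w - w * cfc0 p (h n) * k) \<le> sqrt (2 * d n)" for n
  proof -
    have "w * cfc0 p (h n) * k = w * cfc0 p (\<lambda>t. h n t * root t)"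
      unfolding k_def using h root by (simp add: cfc0_mult mult.assoc)
    also have "norm (w - \<dots>) \<le> sqrt (2 * d n)"
      unfolding p_def
    proof (rule norm_diff_mult_cfc0_le)
      show "\<bar>t\<bar> * (1 - h n t * root t)\<^sup>2 \<le> 2 * d n" for t
      proof (cases "\<bar>t\<bar> \<ge> 2 * d n")
        case True
        then have "t \<noteq> 0" using d[of n] by auto
        then show ?thesis using True rootpos[of t] d[of n] by (simp add: h_eq)
      next
        case False
        have "\<bar>1 - h n t * root t\<bar> \<le> 1" using h_le[of n t] h_nonneg[of n t] by (simp add: root_def)
        then have "(1 - h n t * root t)\<^sup>2 \<le> 1" by (simp add: abs_square_le_1)
        then have "\<bar>t\<bar> * (1 - h n t * root t)\<^sup>2 \<le> \<bar>t\<bar> * 1" by (intro mult_left_mono) auto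
        then show ?thesis using False by simp
      qed
    qed (use h root in \<open>auto intro: continuous_intros\<close>)
    finally show ?thesis .
  qed
  then have "(\<lambda>n. w - w * cfc0 p (h n) * k) \<longlonglongrightarrow> 0" by (intro Lim_null_comparison[OF _ lim(2)]) simp
  moreover have "(\<lambda>n. w - w * cfc0 p (h n) * k) \<longlonglongrightarrow> w - y * k" by (intro tendsto_intros y)
  ultimately have yk: "w = y * k" using LIMSEQ_unique by fastforce
  have "k * w = 0" unfolding k_def p_def by (rule square_zero_annihilator[OF w root])
  then have "(\<lambda>n. k * (w * cfc0 p (h n))) \<longlonglongrightarrow> 0" by (simp flip: mult.assoc)
  moreover have "(\<lambda>n. k * (w * cfc0 p (h n))) \<longlonglongrightarrow> k * y" by (intro tendsto_intros y)
  ultimately have "k * y = 0" using LIMSEQ_unique by blast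
  then have "w = commutator y k" using yk by (simp add: commutator_def)
  then show ?thesis by blast
qed

section \<open>Sums of boundedly many similar copies\<close>

text \<open>
  Keeping count of the summands, rather than working in the span, is what yields the uniform bound in
  the unital case.
\<close>
definition SN2c_sums :: "nat \<Rightarrow> 'a::cstar_algebra set"
  where "SN2c_sums n = {sum_list zs | zs. length zs \<le> n \<and> set zs \<subseteq> SN2c}"

lemma SN2c_sums_add:
  assumes "x \<in> SN2c_sums m" "y \<in> SN2c_sums n"
  shows "x + y \<in> SN2c_sums (m + n)"
proof -
  obtain xs ys where "length xs \<le> m" "set xs \<subseteq> SN2c" "x = sum_list xs"
    "length ys \<le> n" "set ys \<subseteq> SN2c" "y = sum_list ys"
    using assms unfolding SN2c_sums_def by blast
  then show ?thesis unfolding SN2c_sums_def by (intro CollectI exI[of _ "xs @ ys"]) auto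
qed

lemma SN2c_sums_zero: "0 \<in> SN2c_sums n"
  unfolding SN2c_sums_def by (intro CollectI exI[of _ "[]"]) auto

lemma SN2c_scale: "z \<in> SN2c \<Longrightarrow> c *\<^sub>C z \<in> SN2c"
proof -
  assume "z \<in> SN2c"
  then obtain x y where z: "z = y + x * y - y * x - x * y * x" "x \<in> N2 \<union> {0}" "y \<in> N2c"
    unfolding SN2c_altdef by blast
  have "c *\<^sub>C z = c *\<^sub>C y + x * c *\<^sub>C y - c *\<^sub>C y * x - x * c *\<^sub>C y * x"
    by (simp add: z(1) mult_scaleC_left mult_scaleC_right complex_vector.scale_right_diff_distrib scaleC_add_right)
  then show ?thesis unfolding SN2c_altdef using z(2) N2c_scale[OF z(3)] by blast
qed

lemma SN2c_sums_scale:
  assumes "x \<in> SN2c_sums n"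
  shows "c *\<^sub>C x \<in> SN2c_sums n"
proof -
  obtain zs where zs: "length zs \<le> n" "set zs \<subseteq> SN2c" "x = sum_list zs"
    using assms unfolding SN2c_sums_def by blast
  have "c *\<^sub>C sum_list zs = sum_list (map (scaleC c) zs)"
    by (induction zs) (simp_all add: scaleC_add_right)
  then show ?thesis unfolding SN2c_sums_def using zs SN2c_scale
    by (intro CollectI exI[of _ "map (scaleC c) zs"]) auto
qed

lemma SN2c_sums_minus: "x \<in> SN2c_sums n \<Longrightarrow> - x \<in> SN2c_sums n"
  using SN2c_sums_scale[of x n "-1"] by simp

lemma SN2c_sums_diff:
  assumes "x \<in> SN2c_sums m" "y \<in> SN2c_sums n"
  shows "x - y \<in> SN2c_sums (m + n)"
  using SN2c_sums_add[OF assms(1) SN2c_sums_minus[OF assms(2)]] by simp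

lemma SN2c_sums_one: "z \<in> SN2c \<Longrightarrow> z \<in> SN2c_sums 1"
  unfolding SN2c_sums_def by (intro CollectI exI[of _ "[z]"]) auto

lemma N2c_in_SN2c_sums: "y \<in> N2c \<Longrightarrow> y \<in> SN2c_sums 1"
  by (rule SN2c_sums_one) (unfold SN2c_altdef, intro CollectI exI[of _ 0] exI[of _ y], simp)

lemma SN2c_sums_subset_cspan: "SN2c_sums n \<subseteq> cspan SN2c"
proof
  fix x :: 'a assume "x \<in> SN2c_sums n"
  then obtain zs where "set zs \<subseteq> SN2c" "x = sum_list zs" unfolding SN2c_sums_def by blast
  then show "x \<in> cspan SN2c"
    by (induction zs arbitrary: x) (auto intro: complex_vector.span_zero complex_vector.span_add complex_vector.span_base)
qed

lemma SN2c_conj: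
  fixes x y :: "'a::cstar_algebra"
  assumes "x * x = 0" "y \<in> N2c"
  shows "y + x * y - y * x - x * y * x \<in> SN2c_sums 1"
  by (rule SN2c_sums_one) (use assms in \<open>auto simp: SN2c_altdef N2_def\<close>)

text \<open>
  The odd and the even part of \<open>x \<mapsto> (1 + x) y (1 - x)\<close> are \<open>[x, y]\<close> and \<open>y - x y x\<close>.
\<close>
lemma commutator_square_zero_N2c:
  fixes x y :: "'a::cstar_algebra"
  assumes "x * x = 0" "y \<in> N2c"
  shows "commutator x y \<in> SN2c_sums 2" "x * y * x \<in> SN2c_sums 3"
proof -
  define u where "u = y + x * y - y * x - x * y * x"
  define v where "v = y + (- x) * y - y * (- x) - (- x) * y * (- x)"
  have u: "u \<in> SN2c_sums 1" unfolding u_def by (rule SN2c_conj[OF assms])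
  have v: "v \<in> SN2c_sums 1" unfolding v_def by (rule SN2c_conj) (use assms in auto)
  have half: "(1/2) *\<^sub>R a \<in> SN2c_sums n" if "a \<in> SN2c_sums n" for a :: 'a and n
    using SN2c_sums_scale[OF that, of "of_real (1/2)"] by (simp only: scaleC_of_real)
  have "u - v = 2 *\<^sub>R commutator x y" by (simp add: u_def v_def commutator_def scaleR_2 algebra_simps)
  then have "commutator x y = (1/2) *\<^sub>R (u - v)" by simp
  then show "commutator x y \<in> SN2c_sums 2"
    using half[OF SN2c_sums_diff[OF u v]] by (simp only: one_add_one)
  have "u + v = 2 *\<^sub>R (y - x * y * x)" by (simp add: u_def v_def scaleR_2 algebra_simps)
  then have "x * y * x = y - (1/2) *\<^sub>R (u + v)" by simp
  then show "x * y * x \<in> SN2c_sums 3"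
    using SN2c_sums_diff[OF N2c_in_SN2c_sums[OF assms(2)] half[OF SN2c_sums_add[OF u v]]]
    by (simp add: numeral_3_eq_3)
qed

text \<open>
  Turns a product rule into one that also rewrites inside products associated to the right.
\<close>
lemma mult_assoc_rule: "a * b = c \<Longrightarrow> a * (b * x) = c * (x::'a::semigroup_mult)"
  by (simp flip: mult.assoc)

text \<open>
  Think of \<open>e\<close>, \<open>f\<close> and \<open>g = 1 - e - f\<close> as block projections with \<open>y = f y e\<close>. In \<open>y a = y a (e + f + g)\<close> the \<open>e\<close>-part
  is in \<open>N2c\<close>, and the \<open>g\<close>-part is \<open>[y, w]\<close> for the square-zero block \<open>w = e a g\<close>. Likewise for \<open>a y\<close>, with \<open>v = g a f\<close>.
  What remains is \<open>y a f - e a y\<close>, the commutator of \<open>y\<close> with the square-zero block \<open>c = e a f\<close>. The chains of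
  local units make this precise.
\<close>
lemma commutator_N2c:
  fixes y :: "'a::cstar_algebra"
  assumes y: "y \<in> N2c"
  shows "commutator y a \<in> SN2c_sums 8"
proof -
  obtain e0 e1 e2 f0 f1 f2 where pos: "e0 \<in> positives" "e1 \<in> positives" "e2 \<in> positives"
      "f0 \<in> positives" "f1 \<in> positives" "f2 \<in> positives"
    and fr: "y * e0 = y" "f0 * y = y"
    "e0 * e1 = e0" "e1 * e0 = e0" "e1 * e2 = e1" "e2 * e1 = e1"
    "f0 * f1 = f0" "f1 * f0 = f0" "f1 * f2 = f1" "f2 * f1 = f1"
    and orth: "\<forall>i\<in>{e0, e1, e2}. \<forall>j\<in>{f0, f1, f2}. i * j = 0 \<and> j * i = 0"
    using N2c_frame[OF y] .
  have o: "e0 * f0 = 0" "e1 * f0 = 0" "e2 * f0 = 0" "e0 * f1 = 0" "e1 * f1 = 0" "e0 * f2 = 0"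
    "f0 * e0 = 0" "f1 * e0 = 0" "f0 * e1 = 0" "f1 * e1 = 0"
    using orth by simp_all
  have ys: "y * e1 = y" "f1 * y = y" "e1 * y = 0" "y * f1 = 0" "e0 * y = 0" "y * f0 = 0" "e2 * y = 0"
    using fr o by (metis mult.assoc mult_zero_left mult_zero_right)+
  note rules = fr o ys fr[THEN mult_assoc_rule] o[THEN mult_assoc_rule] ys[THEN mult_assoc_rule]
  \<comment> \<open>\<open>w\<close> and \<open>v\<close> are the blocks \<open>e a g\<close> and \<open>g a f\<close> with \<open>g = 1 - e1 - f1\<close>.\<close>
  define w where "w = e0 * a - e0 * a * e1 - e0 * a * f1"
  define v where "v = a * f0 - e1 * a * f0 - f1 * a * f0"
  define c where "c = e1 * a * f1"
  define n where "n = y * a * e1"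
  define m where "m = f1 * a * y"
  have w: "w * w = 0" unfolding w_def by (simp add: algebra_simps rules)
  have v: "v * v = 0" unfolding v_def by (simp add: algebra_simps rules)
  have c: "c * c = 0" unfolding c_def by (simp add: algebra_simps rules)
  have n: "n \<in> N2c" by (rule N2cI[of n e2 f0]) (simp_all add: n_def mult.assoc rules pos)
  have m: "m \<in> N2c" by (rule N2cI[of m e0 f2]) (simp_all add: m_def mult.assoc rules pos)
  have eq: "commutator y a = ((n - m) - (commutator v y + commutator w y)) - commutator c y"
    unfolding commutator_def n_def m_def v_def w_def c_def by (simp add: algebra_simps rules)
  show ?thesis
    unfolding eq
    using SN2c_sums_diff[OF SN2c_sums_diff[OF SN2c_sums_diff[OF N2c_in_SN2c_sums[OF n] N2c_in_SN2c_sums[OF m]]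
          SN2c_sums_add[OF commutator_square_zero_N2c(1)[OF v y] commutator_square_zero_N2c(1)[OF w y]]]
        commutator_square_zero_N2c(1)[OF c y]]
    by simp
qed

text \<open>
  Let \<open>k = z* z\<close>, supported in the \<open>e\<close>-corner. Consider \<open>p = b z* z\<close> with \<open>f b = 0\<close> and \<open>q\<close> with \<open>q f = 0\<close>. The vectors
  \<open>u = p + z\<close> and \<open>v = q - q b z*\<close> satisfy \<open>v u = 0\<close>: the contribution \<open>q p\<close> is cancelled with the help of the \<open>f\<close>-block.
  So \<open>x = u v\<close> has square zero, and \<open>x z* x = u (q k) v\<close> is \<open>[p, q k q]\<close> up to commutators with \<open>z\<close> and \<open>z*\<close>.
  Replacing \<open>q\<close> by \<open>q + e\<close> polarizes \<open>q k q\<close> to \<open>q k + k q\<close>, whose first summand contributes only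
  commutators with elements of \<open>N2c\<close>. The constraints on \<open>b\<close> and \<open>q\<close> are removed
  by splitting off blocks that lie in \<open>N2c\<close>.
\<close>
lemma commutator_mult_star_mult:
  fixes z a q :: "'a::cstar_algebra"
  assumes z: "z \<in> N2c"
  shows "commutator (a * (star z * z)) ((star z * z) * q) \<in> SN2c_sums 113"
proof -
  define s where "s = star z"
  have sN: "s \<in> N2c" unfolding s_def by (rule star_N2c[OF z])
  obtain e0 e1 e2 f0 f1 f2 where pos: "e0 \<in> positives" "e1 \<in> positives" "e2 \<in> positives"
      "f0 \<in> positives" "f1 \<in> positives" "f2 \<in> positives"
    and fr: "z * e0 = z" "f0 * z = z"
    "e0 * e1 = e0" "e1 * e0 = e0" "e1 * e2 = e1" "e2 * e1 = e1"
    "f0 * f1 = f0" "f1 * f0 = f0" "f1 * f2 = f1" "f2 * f1 = f1"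
    and orth: "\<forall>i\<in>{e0, e1, e2}. \<forall>j\<in>{f0, f1, f2}. i * j = 0 \<and> j * i = 0"
    using N2c_frame[OF z] .
  have o: "e0 * f0 = 0" "f0 * e0 = 0" "e0 * f2 = 0" "f2 * e0 = 0" "e0 * f1 = 0" "f1 * e0 = 0"
    using orth by simp_all
  have ss: "e0 * s = s" "s * f0 = s"
    using arg_cong[OF fr(1), of star] arg_cong[OF fr(2), of star] pos[THEN positives_selfadjoint]
    by (simp_all add: star_mult s_def)
  have "z * z = z * (e0 * f0) * z" by (metis fr(1,2) mult.assoc)
  moreover have "s * s = s * (f0 * e0) * s" by (metis ss mult.assoc)
  moreover have "f1 * z = z" by (metis fr(2,8) mult.assoc)
  ultimately have zs: "z * z = 0" "s * s = 0" "f1 * z = z" by (simp_all add: o)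
  note rules = fr o ss zs fr[THEN mult_assoc_rule] o[THEN mult_assoc_rule] ss[THEN mult_assoc_rule] zs[THEN mult_assoc_rule]
  have quadratic: "commutator (b * s * z) (q * s * z * q) \<in> SN2c_sums 27"
    if b: "f0 * b = 0" and q: "q * f0 = 0" for b q
  proof -
    define p where "p = b * s * z"
    \<comment> \<open>Chosen so that \<open>r z = - q p\<close>, while \<open>q z\<close> and \<open>r p\<close> vanish.\<close>
    define r where "r = - (q * b * s)"
    have qz: "q * z = 0" by (metis fr(2) q mult.assoc mult_zero_left)
    have sb: "s * b = 0" by (metis ss(2) b mult.assoc mult_zero_right)
    note rules' = rules q b qz sb q[THEN mult_assoc_rule] b[THEN mult_assoc_rule] qz[THEN mult_assoc_rule] sb[THEN mult_assoc_rule]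
    define x where "x = (p + z) * (q + r)"
    have "(q + r) * (p + z) = 0" unfolding p_def r_def by (simp add: algebra_simps rules')
    then have "x * x = 0" unfolding x_def by (metis mult.assoc mult_zero_left mult_zero_right)
    then have x: "x * s * x \<in> SN2c_sums 3" by (rule commutator_square_zero_N2c(2)[OF _ sN])
    have eq: "commutator p (q * s * z * q) = ((x * s * x - commutator s (p * q * s * z * q * b)) -
        commutator z (q * s * z * q)) - commutator z (q * s * z * r)"
      unfolding commutator_def x_def p_def r_def by (simp add: algebra_simps rules')
    show ?thesis
      unfolding p_def[symmetric] eq
      using SN2c_sums_diff[OF SN2c_sums_diff[OF SN2c_sums_diff[OF x commutator_N2c[OF sN]] commutator_N2c[OF z]] commutator_N2c[OF z]]
      by simp
  qed
  have linear: "commutator (b * s * z) (s * z * q) \<in> SN2c_sums 97"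
    if b: "f0 * b = 0" and q: "q * f0 = 0" for b q
  proof -
    define p where "p = b * s * z"
    have zp: "z * p \<in> N2c" by (rule N2cI[of _ e0 f0]) (simp_all add: p_def mult.assoc rules pos)
    have 1: "commutator p ((q + e0) * s * z * (q + e0)) \<in> SN2c_sums 27"
      unfolding p_def by (rule quadratic[OF b]) (simp add: distrib_right q o)
    have 2: "commutator p (q * s * z * q) \<in> SN2c_sums 27"
      unfolding p_def by (rule quadratic[OF b q])
    have 3: "commutator p (e0 * s * z * e0) \<in> SN2c_sums 27"
      unfolding p_def by (rule quadratic[OF b o(1)])
    have eq: "commutator p (s * z * q) = ((((commutator p ((q + e0) * s * z * (q + e0)) -
        commutator p (q * s * z * q)) - commutator p (e0 * s * z * e0)) +
        commutator z (p * q * s)) - commutator (z * p) (q * s))"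
      unfolding commutator_def by (simp add: algebra_simps rules)
    show ?thesis
      unfolding p_def[symmetric] eq
      using SN2c_sums_diff[OF SN2c_sums_add[OF SN2c_sums_diff[OF SN2c_sums_diff[OF 1 2] 3] commutator_N2c[OF z]] commutator_N2c[OF zp]]
      by simp
  qed
  define b where "b = a - f1 * a"
  define q' where "q' = q - q * f1"
  have bq: "f0 * b = 0" "q' * f0 = 0" by (simp_all add: b_def q'_def algebra_simps rules)
  have l: "f1 * a * s * z \<in> N2c" by (rule N2cI[of _ e0 f2]) (simp_all add: mult.assoc rules pos)
  have r: "s * z * q * f1 \<in> N2c" by (rule N2cI[of _ f2 e0]) (simp_all add: mult.assoc rules pos)
  have eq: "commutator (a * (s * z)) ((s * z) * q) =
      (commutator (b * s * z) (s * z * q') + commutator (f1 * a * s * z) (s * z * q)) -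
      commutator (s * z * q * f1) (b * s * z)"
    unfolding commutator_def b_def q'_def by (simp add: algebra_simps)
  show ?thesis
    unfolding s_def[symmetric] eq
    using SN2c_sums_diff[OF SN2c_sums_add[OF linear[OF bq] commutator_N2c[OF l]] commutator_N2c[OF r]] by simp
qed

lemma commutator_generator:
  fixes z a b c :: "'a::cstar_algebra"
  assumes z: "z \<in> N2c"
  defines "k \<equiv> star z * z"
  shows "commutator (a * (k * k) * b) c \<in> SN2c_sums 226"
proof -
  have "commutator (a * (k * k) * b) c = commutator (a * k) (k * (b * c)) - commutator ((c * a) * k) (k * b)"
    by (simp add: commutator_def algebra_simps)
  then show ?thesis
    using SN2c_sums_diff[OF commutator_mult_star_mult[OF z] commutator_mult_star_mult[OF z]] unfolding k_def by simp
qed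

section \<open>A generating ideal\<close>

definition core_ideal :: "'a::cstar_algebra set"
  where "core_ideal = cspan {a * ((star z * z) * (star z * z)) * b | a b z. z \<in> N2c}"

lemma ideal_core_ideal: "two_sided_ideal (core_ideal :: 'a::cstar_algebra set)"
  unfolding core_ideal_def
proof (rule ideal_cspan)
  fix c s :: 'a assume "s \<in> {a * ((star z * z) * (star z * z)) * b | a b z. z \<in> N2c}"
  then obtain a b z where "s = a * ((star z * z) * (star z * z)) * b" "z \<in> N2c" by blast
  then have "c * s = (c * a) * ((star z * z) * (star z * z)) * b"
     "s * c = a * ((star z * z) * (star z * z)) * (b * c)" "z \<in> N2c"
    by (simp_all add: mult.assoc)
  then show "c * s \<in> {a * ((star z * z) * (star z * z)) * b | a b z. z \<in> N2c}"
    "s * c \<in> {a * ((star z * z) * (star z * z)) * b | a b z. z \<in> N2c}" by blast+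
qed

text \<open>
  The left factor \<open>a\<close> lets a single bound serve for all commutators \<open>[a x, c]\<close> at once; with the unit for \<open>x\<close> it bounds all commutators.
\<close>
lemma commutator_core_ideal:
  fixes x :: "'a::cstar_algebra"
  assumes "x \<in> core_ideal"
  shows "\<exists>n. \<forall>c a. commutator (a * x) c \<in> SN2c_sums n"
  using assms unfolding core_ideal_def
proof (induction rule: complex_vector.span_induct_alt)
  case base
  show ?case by (simp add: commutator_zero_left SN2c_sums_zero)
next
  case (step r x y)
  then obtain a b z n where x: "x = a * ((star z * z) * (star z * z)) * b" "z \<in> N2c"
      and n: "\<And>c a. commutator (a * y) c \<in> SN2c_sums n" by blast
  have "commutator (d * (r *\<^sub>C x + y)) c \<in> SN2c_sums (226 + n)" for c d
  proof -
    have "d * (r *\<^sub>C x + y) = r *\<^sub>C ((d * a) * ((star z * z) * (star z * z)) * b) + d * y"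
      by (simp add: x(1) distrib_left mult_scaleC_right mult.assoc)
    then show ?thesis
      using SN2c_sums_add[OF SN2c_sums_scale[OF commutator_generator[OF x(2)]] n]
      by (simp add: commutator_add_left commutator_scale_left)
  qed
  then show ?case by blast
qed

text \<open>
  A cutoff of \<open>k = z* z\<close> is divisible by \<open>k k\<close>, so \<open>z\<close> times this cutoff is in the ideal.
\<close>
lemma N2c_subset_closure_core_ideal: "(N2c :: 'a::cstar_algebra set) \<subseteq> closure core_ideal"
proof
  fix z :: 'a assume z: "z \<in> N2c"
  show "z \<in> closure core_ideal"
    unfolding closure_approachable
  proof (intro allI impI)
    fix r :: real assume "r > 0"
    define e where "e = (r/2)\<^sup>2 / 2"
    have e: "e > 0" "sqrt (2 * e) < r" using \<open>r > 0\<close> by (simp_all add: e_def)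
    define k where "k = star z * z"
    interpret selfadjoint k unfolding k_def by (rule selfadjoint_star_mult)
    define s where "s t = cutoff e t / (max \<bar>t\<bar> e)\<^sup>2" for t
    have s: "continuous_on UNIV s" "s 0 = 0"
    proof -
      have "max \<bar>t\<bar> e \<noteq> 0" for t using e by (auto simp: max_def)
      then show "continuous_on UNIV s" "s 0 = 0"
        unfolding s_def[abs_def] using e by (auto intro!: continuous_intros continuous_on_max continuous_cutoff)
    qed
    have "cutoff e t = t * t * s t" for t
      using cutoff_eq_0[of e t] e by (auto simp: s_def max_def power2_eq_square)
    then have "cfc0 k (cutoff e) = cfc0 k (\<lambda>t. t * t * s t)" by presburger
    also have "\<dots> = k * k * cfc0 k s"
      using cfc0_mult[of "\<lambda>t. t * t" s] cfc0_mult[of "\<lambda>t. t" "\<lambda>t. t"] s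
      by (simp add: cfc0_id continuous_on_mult continuous_on_id)
    finally have "z * cfc0 k (cutoff e) = z * (k * k) * cfc0 k s" by (simp add: mult.assoc)
    also have "\<dots> \<in> core_ideal"
      unfolding core_ideal_def k_def using z by (intro complex_vector.span_base) blast
    finally have "z * cfc0 k (cutoff e) \<in> core_ideal" .
    moreover have "norm (z - z * cfc0 k (cutoff e)) \<le> sqrt (2 * e)"
      unfolding k_def by (rule norm_diff_mult_cfc0_le) (use e cutoff_approx continuous_cutoff in auto)
    ultimately show "\<exists>y\<in>core_ideal. dist y z < r"
      using e(2) by (intro bexI[of _ "z * cfc0 k (cutoff e)"]) (simp_all add: dist_norm norm_minus_commute)
  qed
qed

lemma square_zero_in_closure_core_ideal:
  fixes w :: "'a::cstar_algebra"
  assumes "w * w = 0"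
  shows "w \<in> closure core_ideal"
proof -
  have "w \<in> closure N2c"
    unfolding closure_approachable
  proof (intro allI impI)
    fix r :: real assume "r > 0"
    define e where "e = (r/2)\<^sup>2 / 2"
    have e: "e > 0" "sqrt (2 * e) < r" using \<open>r > 0\<close> by (simp_all add: e_def)
    from square_zero_approx_N2c[OF assms e(1)] obtain y where "y \<in> N2c" "norm (w - y) \<le> sqrt (2 * e)" by blast
    then show "\<exists>y\<in>N2c. dist y w < r" using e(2) by (intro bexI[of _ y]) (auto simp: dist_norm norm_minus_commute)
  qed
  also have "closure N2c \<subseteq> closure core_ideal"
    using N2c_subset_closure_core_ideal by (rule closure_minimal) simp
  finally show ?thesis .
qed

section \<open>Prime ideals and characters\<close>

text \<open>
  Keeping a fixed distance from \<open>h\<close>, unlike merely omitting \<open>h\<close>, survives unions of chains as well as closures.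
\<close>
definition far_from :: "'a::cstar_algebra \<Rightarrow> real \<Rightarrow> 'a set \<Rightarrow> bool"
  where "far_from h d M \<longleftrightarrow> (\<forall>m\<in>M. d \<le> norm (h - m))"

text \<open>
  Put \<open>r = cfc0 h \<dots>\<close> and let \<open>g(t) = 1/t\<close> for \<open>\<bar>t\<bar> \<ge> d\<close>, so that \<open>h g(h) r = r\<close>. Splitting \<open>h = (h - m) + m\<close>, the first part contributes
  \<open>q r\<close> with \<open>\<parallel>q\<parallel> < 1\<close> and the second one lies in the ideal.
\<close>
lemma soft_threshold_in_ideal:
  fixes h :: "'a::cstar_algebra"
  assumes I: "two_sided_ideal I" and h: "star h = h" and m: "m \<in> I" "norm (h - m) < d"
  shows "cfc0 h (\<lambda>t. t - max (- d) (min d t)) \<in> I"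
proof -
  interpret selfadjoint h by standard fact
  let ?r = "\<lambda>t. t - max (- d) (min d t)"
  have d: "d > 0" using m(2) norm_ge_zero[of "h - m"] by linarith
  \<comment> \<open>\<open>1 / t\<close> for \<open>\<bar>t\<bar> \<ge> d\<close>, continued linearly through \<open>0\<close>.\<close>
  define g where "g t = t / (max \<bar>t\<bar> d)\<^sup>2" for t
  have nz: "max \<bar>t\<bar> d \<noteq> 0" for t using d by (auto simp: max_def)
  have g: "continuous_on UNIV g" "g 0 = 0"
    unfolding g_def[abs_def] by (auto intro!: continuous_intros continuous_on_max simp: nz)
  have r: "continuous_on UNIV ?r" "?r 0 = 0"
    using d by (auto intro!: continuous_intros continuous_on_max continuous_on_min)
  have g_le: "\<bar>g t\<bar> \<le> 1 / d" for t
  proof -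
    have "\<bar>t\<bar> * d \<le> max \<bar>t\<bar> d * max \<bar>t\<bar> d" using d by (intro mult_mono) auto
    then show ?thesis using d nz[of t] by (simp add: g_def abs_mult divide_simps power2_eq_square)
  qed
  have eq: "t * g t * ?r t = ?r t" for t
  proof (cases "\<bar>t\<bar> \<ge> d")
    case True
    then have "t * g t = 1" using d by (auto simp: g_def max_def power2_eq_square abs_if split: if_splits)
    then show ?thesis by simp
  next
    case False
    then have "?r t = 0" by auto
    then show ?thesis by simp
  qed
  define q where "q = (h - m) * cfc0 h g"
  have "norm (cfc0 h g) \<le> 1 / d"
  proof -
    have "norm (cfc (in_unitization h) g) \<le> 1 / d"
      by (rule norm_cfc_le[OF selfadjoint_in_unitization g(1)]) (rule g_le)
    then show ?thesis by (metis in_unitization_cfc0[OF g] norm_in_unitization)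
  qed
  then have "norm q \<le> norm (h - m) * (1 / d)"
    unfolding q_def by (meson norm_mult_ineq mult_left_mono norm_ge_zero order_trans)
  also have "\<dots> < 1" using m(2) d by simp
  finally have q: "norm q < 1" .
  have "h * cfc0 h g * cfc0 h ?r = cfc0 h (\<lambda>t. t * g t * ?r t)"
    using cfc0_mult[of "\<lambda>t. t" g] cfc0_mult[of "\<lambda>t. t * g t" ?r] g r
    by (simp add: cfc0_id continuous_on_mult continuous_on_id)
  also have "\<dots> = cfc0 h ?r" by (simp only: eq)
  finally have "cfc0 h ?r - q * cfc0 h ?r = m * (cfc0 h g * cfc0 h ?r)"
    by (simp add: q_def left_diff_distrib mult.assoc)
  then have "cfc0 h ?r - q * cfc0 h ?r \<in> I" using m(1) by (simp add: ideal_right I)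
  then show ?thesis by (rule in_ideal_if_perturbed_fixpoint[OF I q])
qed

text \<open>
  A cutoff of \<open>t\<close> is divisible by \<open>t\<^sup>3\<close>.
\<close>
lemma closed_ideal_cube_root:
  fixes v :: "'a::cstar_algebra"
  assumes I: "two_sided_ideal I" "closed I" and v: "star v = v" "v * v * v \<in> I"
  shows "v \<in> I"
proof -
  interpret selfadjoint v by standard fact
  have "v \<in> closure I"
    unfolding closure_approachable
  proof (intro allI impI)
    fix r :: real assume "r > 0"
    define e where "e = r / 4"
    have e: "e > 0" using \<open>r > 0\<close> by (simp add: e_def)
    define s where "s t = cutoff e t / (max \<bar>t\<bar> e)\<^sup>2" for t
    have nz: "max \<bar>t\<bar> e \<noteq> 0" for t using e by (auto simp: max_def)
    have s: "continuous_on UNIV s" "s 0 = 0"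
      unfolding s_def[abs_def] using e by (auto intro!: continuous_intros continuous_on_max continuous_cutoff simp: nz)
    have eq: "t * cutoff e t = t * t * t * s t" for t
      using cutoff_eq_0[of e t] e by (auto simp: s_def max_def power2_eq_square)
    have "cfc0 v (\<lambda>t. t * t * t * s t) = v * v * v * cfc0 v s"
      using cfc0_mult[of "\<lambda>t. t * t * t" s] cfc0_mult[of "\<lambda>t. t * t" "\<lambda>t. t"] cfc0_mult[of "\<lambda>t. t" "\<lambda>t. t"] s
      by (simp add: cfc0_id continuous_on_mult continuous_on_id)
    also have "\<dots> \<in> I" by (rule ideal_right[OF I(1) v(2)])
    finally have "cfc0 v (\<lambda>t. t * cutoff e t) \<in> I" by (simp only: eq)
    moreover have "norm (v - cfc0 v (\<lambda>t. t * cutoff e t)) \<le> 2 * e"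
      by (rule norm_diff_cfc0_le)
         (use e cutoff_approx continuous_cutoff in \<open>auto intro: continuous_intros\<close>)
    ultimately show "\<exists>y\<in>I. dist y v < r"
      using \<open>r > 0\<close> by (intro bexI[of _ "cfc0 v (\<lambda>t. t * cutoff e t)"]) (auto simp: e_def dist_norm norm_minus_commute)
  qed
  then show ?thesis using I(2) by simp
qed

lemma exists_maximal_far_ideal:
  fixes h :: "'a::cstar_algebra"
  assumes J: "two_sided_ideal J" "far_from h d J"
  obtains M where "two_sided_ideal M" "far_from h d M" "J \<subseteq> M" "closed M"
    "\<And>N. two_sided_ideal N \<Longrightarrow> M \<subseteq> N \<Longrightarrow> far_from h d N \<Longrightarrow> N = M"
proof -
  define F where "F = {M. two_sided_ideal M \<and> far_from h d M \<and> J \<subseteq> M}"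
  have "\<exists>M\<in>F. \<forall>X\<in>F. M \<subseteq> X \<longrightarrow> X = M"
  proof (rule subset_Zorn_nonempty)
    show "F \<noteq> {}" using J unfolding F_def by blast
    fix C assume C: "C \<noteq> {}" "subset.chain F C"
    have CF: "M \<in> C \<Longrightarrow> two_sided_ideal M \<and> far_from h d M \<and> J \<subseteq> M" for M
      using C(2) unfolding subset_chain_def F_def by blast
    have "two_sided_ideal (\<Union>C)"
      unfolding two_sided_ideal_def
    proof (intro conjI allI ballI complex_vector.subspaceI)
      show "0 \<in> \<Union>C" using C(1) CF ideal_zero by blast
    next
      fix x y assume "x \<in> \<Union>C" "y \<in> \<Union>C"
      then obtain X Y where XY: "X \<in> C" "Y \<in> C" "x \<in> X" "y \<in> Y" by blast
      then consider "X \<subseteq> Y" | "Y \<subseteq> X" using C(2) unfolding subset_chain_def by blast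
      then show "x + y \<in> \<Union>C"
      proof cases
        case 1 then show ?thesis using XY CF[of Y] ideal_add[of Y x y] by blast
      next
        case 2 then show ?thesis using XY CF[of X] ideal_add[of X x y] by blast
      qed
    qed (use CF ideal_scale ideal_left ideal_right in blast)+
    then show "\<Union>C \<in> F" using C(1) CF unfolding F_def far_from_def by blast
  qed
  then obtain M where M: "M \<in> F" "\<And>X. X \<in> F \<Longrightarrow> M \<subseteq> X \<Longrightarrow> X = M" by blast
  have "closure M \<in> F"
    unfolding F_def far_from_def
  proof (intro CollectI conjI ballI)
    show "two_sided_ideal (closure M)" using M(1) ideal_closure unfolding F_def by blast
    show "J \<subseteq> closure M" using M(1) closure_subset unfolding F_def by blast
    fix m assume "m \<in> closure M"
    then obtain X where X: "\<And>n. X n \<in> M" "X \<longlonglongrightarrow> m" unfolding closure_sequential by blast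
    have "(\<lambda>n. norm (h - X n)) \<longlonglongrightarrow> norm (h - m)" by (intro tendsto_intros X)
    then show "d \<le> norm (h - m)"
      by (rule Lim_bounded2[of _ _ 0]) (use M(1) X(1) in \<open>auto simp: F_def far_from_def\<close>)
  qed
  then have "closure M = M" by (rule M(2)) (rule closure_subset)
  then have "closed M" by (metis closed_closure)
  with M show thesis unfolding F_def by (intro that[of M]) auto
qed

locale far_maximal_ideal =
  fixes h :: "'a::cstar_algebra" and d :: real and M :: "'a set"
  assumes h: "star h = h" and ideal: "two_sided_ideal M" and closed: "closed M"
    and d: "d > 0" and far: "far_from h d M"
    and maximal: "\<And>N. two_sided_ideal N \<Longrightarrow> M \<subseteq> N \<Longrightarrow> far_from h d N \<Longrightarrow> N = M"
    and square_zero: "\<And>w. w * w = 0 \<Longrightarrow> w \<in> M"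
begin

text \<open>
  If neither \<open>x\<close> nor \<open>y\<close> is in \<open>M\<close>, the ideals \<open>M1\<close> and \<open>M2\<close> are strictly larger than \<open>M\<close>, so both come closer than \<open>d\<close> to
  \<open>h\<close>. Then both contain the same soft threshold \<open>r\<close> of \<open>h\<close> at some level below \<open>d\<close>, and \<open>r\<^sup>3 \<in> M1 r M2 \<subseteq> M\<close> forces \<open>r \<in> M\<close>,
  although \<open>r\<close> is closer than \<open>d\<close> to \<open>h\<close>.
\<close>
lemma prime:
  assumes xy: "\<And>c. x * c * y \<in> M"
  shows "x \<in> M \<or> y \<in> M"
proof (rule ccontr)
  assume n: "\<not> (x \<in> M \<or> y \<in> M)"
  define M1 where "M1 = {u. \<forall>c. u * c * y \<in> M}"
  define M2 where "M2 = {v. \<forall>u\<in>M1. \<forall>c. u * c * v \<in> M}"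
  have M1: "two_sided_ideal M1"
    unfolding two_sided_ideal_def
    by (intro conjI allI ballI complex_vector.subspaceI)
       (auto simp: M1_def distrib_right mult_scaleC_left mult.assoc ideal_zero[OF ideal]
         intro: ideal_add[OF ideal] ideal_scale[OF ideal] ideal_left[OF ideal], metis mult.assoc)
  have M2: "two_sided_ideal M2"
    unfolding two_sided_ideal_def
  proof (intro conjI allI ballI complex_vector.subspaceI)
    show "0 \<in> M2" by (simp add: M2_def ideal_zero[OF ideal])
    show "v + v' \<in> M2" if "v \<in> M2" "v' \<in> M2" for v v'
      using that by (auto simp: M2_def distrib_left intro: ideal_add[OF ideal])
    show "k *\<^sub>C v \<in> M2" if "v \<in> M2" for v k
      using that by (auto simp: M2_def mult_scaleC_right intro: ideal_scale[OF ideal])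
    show "v * a \<in> M2" if "v \<in> M2" for v a
      using that by (auto simp: M2_def intro: ideal_right[OF ideal] simp flip: mult.assoc)
    show "a * v \<in> M2" if "v \<in> M2" for v a
      unfolding M2_def
    proof (intro CollectI ballI allI)
      fix u c assume "u \<in> M1"
      then have "u * (c * a) * v \<in> M" using that unfolding M2_def by blast
      then show "u * c * (a * v) \<in> M" by (simp add: mult.assoc)
    qed
  qed
  have "M \<subseteq> M1" "M \<subseteq> M2"
    unfolding M1_def M2_def by (auto intro: ideal_left[OF ideal] ideal_right[OF ideal])
  moreover have "x \<in> M1" "y \<in> M2" using xy by (auto simp: M1_def M2_def)
  ultimately have "\<not> far_from h d M1" "\<not> far_from h d M2"
    using maximal[OF M1] maximal[OF M2] n by blast+
  then obtain m1 m2 where m: "m1 \<in> M1" "norm (h - m1) < d" "m2 \<in> M2" "norm (h - m2) < d"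
    unfolding far_from_def by force
  \<comment> \<open>A level strictly between the distances from \<open>m1\<close>, \<open>m2\<close> to \<open>h\<close> and \<open>d\<close>.\<close>
  define d' where "d' = (max (norm (h - m1)) (norm (h - m2)) + d) / 2"
  have d': "norm (h - m1) < d'" "norm (h - m2) < d'" "d' < d" using m by (auto simp: d'_def max_def)
  define r where "r t = t - max (- d') (min d' t)" for t
  have "d' > 0" using d'(1) norm_ge_zero[of "h - m1"] by linarith
  interpret selfadjoint h by standard (rule h)
  have rc: "continuous_on UNIV r" "r 0 = 0"
    unfolding r_def[abs_def] using \<open>d' > 0\<close> by (auto intro!: continuous_intros continuous_on_max continuous_on_min)
  have "cfc0 h r \<in> M1" "cfc0 h r \<in> M2"
    unfolding r_def[abs_def]
    by (rule soft_threshold_in_ideal[OF M1 h m(1) d'(1)], rule soft_threshold_in_ideal[OF M2 h m(3) d'(2)])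
  then have "cfc0 h r * cfc0 h r * cfc0 h r \<in> M" unfolding M2_def by blast
  then have "cfc0 h r \<in> M" by (rule closed_ideal_cube_root[OF ideal closed star_cfc0[OF rc]])
  then have "d \<le> norm (h - cfc0 h r)" using far unfolding far_from_def by blast
  also have "\<dots> \<le> d'" by (rule norm_diff_cfc0_le[OF rc]) (use \<open>d' > 0\<close> in \<open>auto simp: r_def\<close>)
  finally show False using d'(3) by simp
qed

text \<open>
  Membership of \<open>u\<close> in the ideal that \<open>M\<close> induces in the unitization; it allows to speak of \<open>f(a)\<close> modulo \<open>M\<close>
  when \<open>f 0 \<noteq> 0\<close>.
\<close>
definition null_multiplier :: "'a unitization \<Rightarrow> bool"
  where "null_multiplier u \<longleftrightarrow> (\<forall>b. act u b \<in> M)"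

lemma null_multiplier_add: "null_multiplier u \<Longrightarrow> null_multiplier v \<Longrightarrow> null_multiplier (u + v)"
  by (simp add: null_multiplier_def act_simps ideal_add[OF ideal])

lemma null_multiplier_scale: "null_multiplier u \<Longrightarrow> null_multiplier (c *\<^sub>C u)"
  by (simp add: null_multiplier_def act_simps ideal_scale[OF ideal])

lemma null_multiplier_diff: "null_multiplier u \<Longrightarrow> null_multiplier v \<Longrightarrow> null_multiplier (u - v)"
  using null_multiplier_add[of u "(-1) *\<^sub>C v"] null_multiplier_scale[of v "-1"] by simp

lemma null_multiplier_left: "null_multiplier v \<Longrightarrow> null_multiplier (u * v)"
  by (simp add: null_multiplier_def act_simps ideal_act[OF ideal])

lemma not_null_multiplier_scalar: "null_multiplier (c *\<^sub>C 1) \<Longrightarrow> c = 0"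
proof (rule ccontr)
  assume c: "null_multiplier (c *\<^sub>C 1)" "c \<noteq> 0"
  then have "act (c *\<^sub>C 1) (inverse c *\<^sub>C h) \<in> M" unfolding null_multiplier_def by blast
  then have "h \<in> M" using c(2) by (simp add: act_simps scaleC_scaleC)
  then show False using far d unfolding far_from_def by force
qed

lemma null_multiplier_closed:
  assumes "\<And>n. null_multiplier (u n)" "u \<longlonglongrightarrow> v"
  shows "null_multiplier v"
  unfolding null_multiplier_def
proof
  fix b :: 'a
  have "(\<lambda>n. norm (u n - v) * norm b) \<longlonglongrightarrow> 0 * norm b"
    by (intro tendsto_intros tendsto_norm_zero LIM_zero assms(2))
  then have "(\<lambda>n. norm (u n - v) * norm b) \<longlonglongrightarrow> 0" by simp
  moreover have "norm (act (u n) b - act v b) \<le> norm (u n - v) * norm b" for n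
  proof -
    have "act (u n) b - act v b = act (u n - v) b"
      by (simp add: act_def left_diff_distrib complex_vector.scale_left_diff_distrib)
    then show ?thesis using norm_act_le[of "u n - v" b] by simp
  qed
  ultimately have "(\<lambda>n. act (u n) b - act v b) \<longlonglongrightarrow> 0"
    by (intro Lim_null_comparison[of "\<lambda>n. act (u n) b - act v b"] always_eventually allI)
  then have "(\<lambda>n. act (u n) b) \<longlonglongrightarrow> act v b" by (simp add: LIM_zero_iff)
  then show "act v b \<in> M"
    using closed_sequentially[OF closed, of "\<lambda>n. act (u n) b"] assms(1) unfolding null_multiplier_def by blast
qed

text \<open>
  Elements \<open>u x v\<close> have square zero when \<open>v u = 0\<close>, hence lie in \<open>M\<close>, and \<open>M\<close> is prime.
\<close>
lemma null_multiplier_orthogonal: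
  assumes "v * u = 0"
  shows "null_multiplier u \<or> null_multiplier v"
proof (rule ccontr)
  assume "\<not> (null_multiplier u \<or> null_multiplier v)"
  then obtain b c where bc: "act u b \<notin> M" "act v c \<notin> M" unfolding null_multiplier_def by blast
  have "act u b * x * act v c \<in> M" for x
  proof -
    define w where "w = elem_part (u * in_unitization (b * x) * v)"
    have w: "in_unitization w = u * in_unitization (b * x) * v"
      by (simp add: w_def unitization_eq_iff)
    have "in_unitization (w * w) = u * in_unitization (b * x) * ((v * u) * in_unitization (b * x) * v)"
      by (simp add: in_unitization_simps(3)[of w w] w mult.assoc)
    then have "in_unitization (w * w) = in_unitization 0" by (simp add: assms in_unitization_simps)
    then have "w * w = 0" by (simp only: in_unitization_inject)
    then have "w \<in> M" by (rule square_zero)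
    have "in_unitization (act u b * x * act v c) = in_unitization (w * c)"
      by (simp add: in_unitization_simps(3) in_unitization_act w mult.assoc)
    then have "act u b * x * act v c = w * c" by (simp only: in_unitization_inject)
    then show ?thesis using ideal_right[OF ideal \<open>w \<in> M\<close>] by simp
  qed
  then show False using prime bc by blast
qed

text \<open>
  The positive part \<open>f t\<close> and the negative part \<open>g t\<close> of \<open>s - t\<close> are orthogonal, so for each \<open>t\<close> one of them vanishes
  modulo \<open>M\<close>. At the threshold \<open>l\<close> between the two cases both do, by continuity, and \<open>f l - g l\<close> evaluated at \<open>a\<close> is \<open>a - l\<close>.
\<close>
lemma selfadjoint_scalar_mod:
  assumes "star a = a"
  shows "\<exists>r::real. null_multiplier (in_unitization a - r *\<^sub>R 1)"
proof -
  interpret selfadjoint a by standard fact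
  let ?u = "in_unitization a"
  note sa = selfadjoint_in_unitization
  define f where "f t s = max 0 (s - t)" for t s :: real
  define g where "g t s = max 0 (t - s)" for t s :: real
  have fc: "continuous_on UNIV (f t)" and gc: "continuous_on UNIV (g t)" for t
    unfolding f_def g_def by (auto intro!: continuous_intros continuous_on_max)
  have gf: "null_multiplier (cfc ?u (f t)) \<or> null_multiplier (cfc ?u (g t))" for t
  proof (rule null_multiplier_orthogonal)
    have "(\<lambda>s. g t s * f t s) = (\<lambda>_. 0)" by (auto simp: f_def g_def max_def)
    then show "cfc ?u (g t) * cfc ?u (f t) = 0"
      using cfc_mult[OF sa gc[of t] fc[of t]] cfc_const[OF sa, of 0] by simp
  qed
  have diff: "cfc ?u (f t) - cfc ?u (g t) = ?u - t *\<^sub>R 1" for t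
  proof -
    have "(\<lambda>s. f t s - g t s) = (\<lambda>s. s - t)" by (auto simp: f_def g_def max_def)
    then have "cfc ?u (f t) - cfc ?u (g t) = cfc ?u (\<lambda>s. s - t)"
      using cfc_diff[OF sa fc[of t] gc[of t]] by simp
    also have "\<dots> = ?u - t *\<^sub>R 1"
      using cfc_diff[OF sa, of "\<lambda>s. s" "\<lambda>_. t"] by (simp add: cfc_id[OF sa] cfc_const[OF sa])
    finally show ?thesis .
  qed
  have lip: "norm (cfc ?u (k t) - cfc ?u (k t')) \<le> \<bar>t - t'\<bar>" if "k = f \<or> k = g" for k t t'
  proof -
    have "norm (cfc ?u (\<lambda>s. k t s - k t' s)) \<le> \<bar>t - t'\<bar>"
      by (rule norm_cfc_le[OF sa]) (use that fc gc in \<open>auto intro!: continuous_intros simp: f_def g_def max_def\<close>)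
    then show ?thesis using that cfc_diff[OF sa] fc gc by metis
  qed
  have lim: "null_multiplier (cfc ?u (k t))"
    if k: "k = f \<or> k = g" and T: "\<And>n. null_multiplier (cfc ?u (k (T n)))" "T \<longlonglongrightarrow> t" for k t and T :: "nat \<Rightarrow> real"
  proof (rule null_multiplier_closed[OF T(1)])
    have "(\<lambda>n. \<bar>T n - t\<bar>) \<longlonglongrightarrow> 0" using T(2) by (simp add: tendsto_rabs_zero LIM_zero)
    then have "(\<lambda>n. cfc ?u (k (T n)) - cfc ?u (k t)) \<longlonglongrightarrow> 0"
      by (rule Lim_null_comparison[rotated]) (use lip[OF k] in simp)
    then show "(\<lambda>n. cfc ?u (k (T n))) \<longlonglongrightarrow> cfc ?u (k t)" by (simp add: LIM_zero_iff)
  qed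
  define R where "R = norm ?u + 1"
  define S where "S = {t. \<not> null_multiplier (cfc ?u (f t))}"
  have fR: "null_multiplier (cfc ?u (f t))" if "t \<ge> R" for t
  proof -
    have "cfc ?u (f t) = cfc ?u (\<lambda>_. 0)"
      by (rule cfc_cong[OF sa fc]) (use that in \<open>auto simp: f_def R_def\<close>)
    also have "\<dots> = 0" using cfc_const[OF sa, of 0] by simp
    finally show ?thesis by (simp add: null_multiplier_def act_def ideal_zero[OF ideal])
  qed
  have gR: "null_multiplier (cfc ?u (g t))" if "t \<le> - R" for t
  proof -
    have "cfc ?u (g t) = cfc ?u (\<lambda>_. 0)"
      by (rule cfc_cong[OF sa gc]) (use that in \<open>auto simp: g_def R_def\<close>)
    also have "\<dots> = 0" using cfc_const[OF sa, of 0] by simp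
    finally show ?thesis by (simp add: null_multiplier_def act_def ideal_zero[OF ideal])
  qed
  have S_le: "t \<le> R" if "t \<in> S" for t using that fR[of t] unfolding S_def by fastforce
  have "S \<noteq> {}"
  proof
    assume "S = {}"
    then have all: "null_multiplier (cfc ?u (f t))" for t unfolding S_def by blast
    have "null_multiplier (?u - t *\<^sub>R 1)" if "t \<le> - R" for t
      unfolding diff[symmetric] by (rule null_multiplier_diff[OF all gR[OF that]])
    from null_multiplier_diff[OF this[of "- R - 1"] this[of "- R"]]
    have "null_multiplier (1 *\<^sub>C 1)" by (simp add: algebra_simps)
    then show False using not_null_multiplier_scalar[of 1] by simp
  qed
  have bdd: "bdd_above S" using S_le by (intro bdd_aboveI)
  \<comment> \<open>The single point of the spectrum of \<open>a\<close> modulo \<open>M\<close>.\<close>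
  define l where "l = Sup S"
  have "null_multiplier (cfc ?u (f l))"
  proof (rule lim[of f])
    show "null_multiplier (cfc ?u (f (l + 1 / real (Suc n))))" for n
    proof (rule ccontr)
      assume "\<not> ?thesis"
      then have "l + 1 / real (Suc n) \<le> l" unfolding l_def by (intro cSup_upper bdd) (simp add: S_def)
      moreover have "1 / real (Suc n) > 0" by simp
      ultimately show False by linarith
    qed
    show "(\<lambda>n. l + 1 / real (Suc n)) \<longlonglongrightarrow> l"
      using tendsto_add[OF tendsto_const[of l] LIMSEQ_Suc[OF lim_1_over_n]] by simp
  qed simp
  moreover have "null_multiplier (cfc ?u (g l))"
  proof -
    have "\<exists>t\<in>S. l - 1 / real (Suc n) < t" for n
      unfolding l_def using \<open>S \<noteq> {}\<close> bdd by (subst less_cSup_iff[symmetric]) auto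
    then obtain T where T: "\<And>n. T n \<in> S" "\<And>n. l - 1 / real (Suc n) < T n" by metis
    have Tl: "T n \<le> l" for n unfolding l_def by (rule cSup_upper[OF T(1) bdd])
    show ?thesis
    proof (rule lim[of g])
      show "null_multiplier (cfc ?u (g (T n)))" for n using gf[of "T n"] T(1)[of n] unfolding S_def by blast
      show "T \<longlonglongrightarrow> l"
      proof (rule tendsto_sandwich[of "\<lambda>n. l - 1 / real (Suc n)" T sequentially "\<lambda>_. l"])
        show "(\<lambda>n. l - 1 / real (Suc n)) \<longlonglongrightarrow> l"
          using tendsto_diff[OF tendsto_const[of l] LIMSEQ_Suc[OF lim_1_over_n]] by simp
        show "\<forall>\<^sub>F n in sequentially. l - 1 / real (Suc n) \<le> T n"
          using T(2) by (intro always_eventually allI less_imp_le)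
      qed (use Tl in auto)
    qed simp
  qed
  ultimately have "null_multiplier (?u - l *\<^sub>R 1)" unfolding diff[symmetric] by (rule null_multiplier_diff)
  then show ?thesis ..
qed

lemma scalar_mod_unique:
  assumes "null_multiplier (in_unitization a - c *\<^sub>C 1)" "null_multiplier (in_unitization a - k *\<^sub>C 1)"
  shows "c = k"
proof -
  have "(in_unitization a - k *\<^sub>C 1) - (in_unitization a - c *\<^sub>C 1) = (c - k) *\<^sub>C 1"
    by (simp add: unitization_eq_iff)
  then show ?thesis using null_multiplier_diff[OF assms(2,1)] not_null_multiplier_scalar[of "c - k"] by simp
qed

text \<open>
  Combine the real scalars of the real and the imaginary part of \<open>a\<close>.
\<close>
lemma scalar_mod_star:
  "\<exists>c. null_multiplier (in_unitization a - c *\<^sub>C 1) \<and> null_multiplier (in_unitization (star a) - cnj c *\<^sub>C 1)"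
proof -
  define x where "x = (1/2) *\<^sub>C (a + star a)"
  define y where "y = (- \<i> / 2) *\<^sub>C (a - star a)"
  have "star x = x" by (simp add: x_def star_scaleC star_add star_star add.commute)
  then obtain r where r: "null_multiplier (in_unitization x - r *\<^sub>R 1)" using selfadjoint_scalar_mod by blast
  have "star y = y" by (simp add: y_def star_scaleC star_diff star_star complex_vector.scale_right_diff_distrib)
  then obtain s where s: "null_multiplier (in_unitization y - s *\<^sub>R 1)" using selfadjoint_scalar_mod by blast
  have half: "(1/2) *\<^sub>C z + (1/2) *\<^sub>C z = z" for z :: 'a
    by (simp flip: scaleC_add_left)
  have a: "a = x + \<i> *\<^sub>C y" and sa: "star a = x - \<i> *\<^sub>C y"
    unfolding x_def y_def
    by (simp_all add: scaleC_scaleC complex_vector.scale_right_diff_distrib scaleC_add_right half)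
  define c where "c = Complex r s"
  have "in_unitization a - c *\<^sub>C 1 = (in_unitization x - r *\<^sub>R 1) + \<i> *\<^sub>C (in_unitization y - s *\<^sub>R 1)"
    unfolding a by (simp add: unitization_eq_iff c_def complex_eq_iff)
  moreover have "in_unitization (star a) - cnj c *\<^sub>C 1 = (in_unitization x - r *\<^sub>R 1) - \<i> *\<^sub>C (in_unitization y - s *\<^sub>R 1)"
    unfolding sa by (simp add: unitization_eq_iff c_def complex_eq_iff)
  ultimately show ?thesis
    using null_multiplier_add[OF r null_multiplier_scale[OF s]] null_multiplier_diff[OF r null_multiplier_scale[OF s]]
    by metis
qed

lemma character_exists: "\<exists>\<phi> :: 'a \<Rightarrow> complex. star_hom \<phi> \<and> \<phi> \<noteq> (\<lambda>_. 0)"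
proof -
  define \<phi> where "\<phi> a = (THE c. null_multiplier (in_unitization a - c *\<^sub>C 1))" for a
  have \<phi>I: "\<phi> a = c" if "null_multiplier (in_unitization a - c *\<^sub>C 1)" for a c
    unfolding \<phi>_def using that scalar_mod_unique by (intro the_equality) auto
  have \<phi>: "null_multiplier (in_unitization a - \<phi> a *\<^sub>C 1)" for a
    using scalar_mod_star[of a] \<phi>I by metis
  have add: "\<phi> (a + b) = \<phi> a + \<phi> b" for a b
  proof (rule \<phi>I)
    have "in_unitization (a + b) - (\<phi> a + \<phi> b) *\<^sub>C 1 = (in_unitization a - \<phi> a *\<^sub>C 1) + (in_unitization b - \<phi> b *\<^sub>C 1)"
      by (simp add: unitization_eq_iff)
    then show "null_multiplier (in_unitization (a + b) - (\<phi> a + \<phi> b) *\<^sub>C 1)"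
      using null_multiplier_add[OF \<phi> \<phi>] by simp
  qed
  have scale: "\<phi> (c *\<^sub>C a) = c * \<phi> a" for a c
  proof (rule \<phi>I)
    have "in_unitization (c *\<^sub>C a) - (c * \<phi> a) *\<^sub>C 1 = c *\<^sub>C (in_unitization a - \<phi> a *\<^sub>C 1)"
      by (simp add: unitization_eq_iff algebra_simps)
    then show "null_multiplier (in_unitization (c *\<^sub>C a) - (c * \<phi> a) *\<^sub>C 1)"
      using null_multiplier_scale[OF \<phi>] by simp
  qed
  have mult: "\<phi> (a * b) = \<phi> a * \<phi> b" for a b
  proof (rule \<phi>I)
    have "in_unitization (a * b) - (\<phi> a * \<phi> b) *\<^sub>C 1 =
        in_unitization a * (in_unitization b - \<phi> b *\<^sub>C 1) + \<phi> b *\<^sub>C (in_unitization a - \<phi> a *\<^sub>C 1)"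
      by (simp add: unitization_eq_iff algebra_simps complex_vector.scale_minus_left)
    then show "null_multiplier (in_unitization (a * b) - (\<phi> a * \<phi> b) *\<^sub>C 1)"
      using null_multiplier_add[OF null_multiplier_left[OF \<phi>] null_multiplier_scale[OF \<phi>]] by simp
  qed
  have st: "\<phi> (star a) = cnj (\<phi> a)" for a
    using scalar_mod_star[of a] \<phi>I by metis
  have "\<phi> \<noteq> (\<lambda>_. 0)"
  proof
    assume 0: "\<phi> = (\<lambda>_. 0)"
    have "null_multiplier (in_unitization h)" using \<phi>[of h] unfolding 0 by simp
    then have "h * (h * h) \<in> M" unfolding null_multiplier_def act_def by (metis elem_part_in_unitization scalar_part_in_unitization complex_vector.scale_zero_left add_0_right)
    then have "h \<in> M" by (intro closed_ideal_cube_root[OF ideal closed h]) (simp add: mult.assoc)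
    then show False using far d unfolding far_from_def by force
  qed
  moreover have "star_hom \<phi>"
    unfolding star_hom_def
  proof (intro conjI allI)
    show "Vector_Spaces.linear scaleC scaleC \<phi>"
      by unfold_locales (simp_all add: add scale scaleC_complex_def algebra_simps)
  qed (simp_all add: mult st star_complex_def)
  ultimately show ?thesis by blast
qed

end

text \<open>
  Otherwise an ideal as in \<open>far_maximal_ideal\<close> exists for a self-adjoint \<open>h\<close> outside \<open>J\<close>, and it yields a character.
\<close>
lemma closed_ideal_eq_UNIV:
  fixes J :: "'a::cstar_algebra set"
  assumes "no_one_dim_reps TYPE('a)" and J: "two_sided_ideal J" "closed J"
    and sq: "\<And>w. w * w = 0 \<Longrightarrow> w \<in> J"
  shows "J = UNIV"
proof (rule ccontr)
  assume "J \<noteq> UNIV"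
  have "\<exists>h. star h = h \<and> h \<notin> J"
  proof (rule ccontr)
    assume n: "\<nexists>h. star h = h \<and> h \<notin> J"
    have "closure J = UNIV"
      by (rule dense_if_approximates_selfadjoint) (use J n in \<open>auto simp: two_sided_ideal_def intro!: bexI\<close>)
    then show False using J(2) \<open>J \<noteq> UNIV\<close> by simp
  qed
  then obtain h where h: "star h = h" "h \<notin> J" by blast
  then obtain d where d: "d > 0" "ball h d \<subseteq> - J" using J(2) open_contains_ball[of "- J"] by auto
  have far: "far_from h d J"
    unfolding far_from_def
  proof
    fix m assume "m \<in> J"
    then have "m \<notin> ball h d" using d(2) by blast
    then show "d \<le> norm (h - m)" by (simp add: dist_norm)
  qed
  obtain M where M: "two_sided_ideal M" "far_from h d M" "J \<subseteq> M" "closed M"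
    "\<And>N. two_sided_ideal N \<Longrightarrow> M \<subseteq> N \<Longrightarrow> far_from h d N \<Longrightarrow> N = M"
    using exists_maximal_far_ideal[OF J(1) far] by blast
  interpret far_maximal_ideal h d M
    by standard (use h d M sq in blast)+
  show False using character_exists assms(1) unfolding no_one_dim_reps_def by blast
qed

lemma core_ideal_dense:
  assumes "no_one_dim_reps TYPE('a::cstar_algebra)"
  shows "closure (core_ideal :: 'a set) = UNIV"
  by (rule closed_ideal_eq_UNIV[OF assms ideal_closure[OF ideal_core_ideal]])
     (simp_all add: square_zero_in_closure_core_ideal)

section \<open>Spans of square-zero elements\<close>

text \<open>
  The elements of \<open>SN2c\<close> are similar to elements of \<open>N2c\<close>, which have square zero.
\<close>
lemma SN2c_square_zero:
  assumes "z \<in> SN2c"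
  shows "z * z = 0"
proof -
  obtain x y where z: "z = y + x * y - y * x - x * y * x" "x \<in> N2 \<union> {0}" "y \<in> N2c"
    using assms unfolding SN2c_altdef by blast
  obtain e f where ef: "y * e = y" "f * y = y" "e * f = 0" using z(3) unfolding N2c_def by blast
  have 0: "x * x = 0" "y * y = 0" using z(2) N2c_orthogonal(3)[OF ef] by (auto simp: N2_def)
  show ?thesis unfolding z(1) by (simp add: algebra_simps 0 0[THEN mult_assoc_rule])
qed

theorem theorem4p2:
  assumes "no_one_dim_reps TYPE('a::cstar_algebra)"
  shows "cspan (SN2c :: 'a set) = commutator_span Ped Ped \<and>
    (is_unital TYPE('a) \<longrightarrow>
      cspan (N2 :: 'a set) = commutator_span UNIV UNIV \<and>
      (\<exists>K::nat. \<forall>x y :: 'a. \<exists>zs :: 'a list.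
        length zs \<le> K \<and> (\<forall>z \<in> set zs. z * z = 0) \<and> commutator x y = sum_list zs))"
proof (intro conjI impI)
  have Ped_core: "(Ped :: 'a set) \<subseteq> core_ideal"
    by (rule Ped_subset[OF ideal_core_ideal core_ideal_dense[OF assms]])
  show eq: "cspan (SN2c :: 'a set) = commutator_span Ped Ped"
  proof
    show "cspan SN2c \<subseteq> (commutator_span Ped Ped :: 'a set)"
      unfolding commutator_span_def
      by (rule complex_vector.span_minimal[OF SN2c_subset_commutators[unfolded commutator_span_def] complex_vector.subspace_span])
    show "commutator_span Ped Ped \<subseteq> cspan (SN2c :: 'a set)"
      unfolding commutator_span_def
    proof (rule complex_vector.span_minimal[OF _ complex_vector.subspace_span], safe)
      fix x y :: 'a assume x: "x \<in> Ped"

      have "x \<in> cspan {b * c | b c. b \<in> Ped \<and> c \<in> Ped}" using Ped_subset_products x by blast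
      then show "commutator x y \<in> cspan SN2c"
      proof (induction rule: complex_vector.span_induct_alt)
        case base
        show ?case by (simp add: commutator_zero_left complex_vector.span_zero)
      next
        case (step k p q)
        then obtain b c where "p = b * c" "c \<in> core_ideal" using Ped_core by blast
        with commutator_core_ideal[of c] have "commutator p y \<in> cspan SN2c"
          using SN2c_sums_subset_cspan by blast
        then show ?case using step(2)
          unfolding commutator_add_left commutator_scale_left
          by (intro complex_vector.span_add complex_vector.span_scale)
      qed
    qed
  qed
  assume unital: "is_unital TYPE('a)"
  then have Ped: "(Ped :: 'a set) = UNIV" by (rule Ped_eq_UNIV_if_unital)
  show "cspan (N2 :: 'a set) = commutator_span UNIV UNIV"
  proof
    show "cspan (N2 :: 'a set) \<subseteq> commutator_span UNIV UNIV"
      unfolding commutator_span_def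
    proof (rule complex_vector.span_minimal[OF _ complex_vector.subspace_span], safe)
      fix w :: 'a assume "w \<in> N2"
      then obtain y k where "w = commutator y k" using square_zero_is_commutator unfolding N2_def by blast
      then show "w \<in> cspan {commutator x y | x y. x \<in> UNIV \<and> y \<in> UNIV}"
        by (intro complex_vector.span_base) blast
    qed
    have "SN2c \<subseteq> cspan (N2 :: 'a set)"
    proof
      fix z :: 'a assume "z \<in> SN2c"
      then show "z \<in> cspan N2"
        using SN2c_square_zero[of z] complex_vector.span_zero complex_vector.span_base[of z N2]
        by (cases "z = 0") (auto simp: N2_def)
    qed
    then have "cspan SN2c \<subseteq> cspan (N2 :: 'a set)"
      by (rule complex_vector.span_minimal[OF _ complex_vector.subspace_span])
    then show "commutator_span UNIV UNIV \<subseteq> cspan (N2 :: 'a set)" unfolding eq Ped .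
  qed
  obtain u :: 'a where u: "\<And>a. u * a = a \<and> a * u = a" using unital unfolding is_unital_def by blast
  have "u \<in> core_ideal" using Ped_core Ped by blast
  then obtain K where K: "\<And>c a. commutator (a * u) c \<in> SN2c_sums K" using commutator_core_ideal by blast
  have "\<exists>zs. length zs \<le> K \<and> (\<forall>z\<in>set zs. z * z = 0) \<and> commutator x y = sum_list zs" for x y :: 'a
  proof -
    obtain zs where "length zs \<le> K" "set zs \<subseteq> SN2c" "commutator x y = sum_list zs"
      using K[of x y] unfolding SN2c_sums_def by (auto simp: u)
    then show ?thesis using SN2c_square_zero by blast
  qed
  then show "\<exists>K. \<forall>x y :: 'a. \<exists>zs. length zs \<le> K \<and> (\<forall>z\<in>set zs. z * z = 0) \<and> commutator x y = sum_list zs"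
    by blast
qed

end
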